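(* Let $\mathscr D$ be a derivator, $n\ge 2$, and $1\le k\le l\le n$. The following are equivalent for a restricted $n$-cube $X\in\mathscr D^{\square^n_{\le l}}$. (i) The restricted $n$-cube $X$ is $k$-cotruncated. (ii) All $m$-subcubes of $X$, $k<m\le l$, are cocartesian. (iii) All $(k+1)$-subcubes of $X$ are cocartesian.
   Context: Derivators. $\mathrm{Cat}$ is the 2-category of small categories, $\mathrm{CAT}$ that of not necessarily small categories, $\mathbb 1$ the terminal category. A prederivator is a strict 2-functor $\mathscr D\colon\mathrm{Cat}^{\mathrm{op}}\to\mathrm{CAT}$ (1-cells reversed); write $u^*=\mathscr D(u)$. It is a derivator if: (Der1) $\mathscr D(\coprod_i A_i)\to\prod_i\mathscr D(A_i)$ is an equivalence; (Der2) a morphism $f$ of $\mathscr D(A)$ is invertible iff $f_a:=a^*f$ is invertible for all objects $a\colon\mathbb 1\to A$; (Der3) every $u^*$ has a left adjoint $u_!$ and a right adjoint $u_*$; (Der4) for $u\colon A\to B$ and $b\in B$ the canonical maps $\operatorname{colim}_{(u/b)}p^*X\to (u_!X)_b$ and $(u_*X)_b\to\lim_{(b/u)}q^*X$ are isomorphisms, where $p\colon(u/b)\to A$, $q\colon (b/u)\to A$ are the projections and $\operatorname{colim}_A=\pi_!$, $\lim_A=\pi_*$ for $\pi\colon A\to\mathbb 1$. Morphisms of derivators are pseudo-natural transformations; natural transformations between them are modifications. For $A\in\mathrm{Cat}$, $\mathscr D^A$ is the derivator $B\mapsto\mathscr D(A\times B)$; a functor $u\colon A\to B$ induces morphisms of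 derivators $u^*\colon\mathscr D^B\to\mathscr D^A$ and $u_!,u_*\colon\mathscr D^A\to\mathscr D^B$. "$X\in\mathscr D^A$" means $X\in\mathscr D^A(B)$ for some $B\in\mathrm{Cat}$ (objects with parameters), and $X_a=a^*X$. Cubes. $\square^n$ is the power set of $\{1,\dots,n\}$ ordered by inclusion, identified with $[1]^n$, $[1]=(0<1)$. $\square^n_{\le l}$ is the full subposet of subsets with at most $l$ elements, and $\iota_{l,k}\colon\square^n_{\le k}\to\square^n_{\le l}$ is the inclusion for $k\le l$. For $m\ge 2$, an $m$-cube in $\mathscr D^{\square^m}$ is cocartesian if it lies in the essential image of left Kan extension along $\square^m_{\le m-1}\to\square^m$. A diagram $X\in\mathscr D^{\square^n_{\le l}}$ is $k$-cotruncated if it lies in the essential image of $(\iota_{l,k})_!\colon\mathscr D^{\square^n_{\le k}}\to\mathscr D^{\square^n_{\le l}}$. An $m$-subcube of $X\in\mathscr D^{\square^n_{\le l}}$ is the restriction of $X$ along a closed interval inclusion $\square^m\cong[x,y]=\{w\mid x\subseteq w\subseteq y\}\to\square^n_{\le l}$, where $x\subseteq y$ in $\square^n_{\le l}$ and the set $y\setminus x$ has $m$ elements. *)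

theory Defs
  imports "HOL-Library.FuncSet" "HOL-Library.Equipollence" "HOL-Library.Infinite_Typeclass"
begin

section \<open>Categories, functors, natural transformations\<close>

record ('o, 'm) cat =
  Obj :: "'o set"
  Arr :: "'m set"
  Dom :: "'m \<Rightarrow> 'o"
  Cod :: "'m \<Rightarrow> 'o"
  Ident :: "'o \<Rightarrow> 'm"
  Comp :: "'m \<Rightarrow> 'm \<Rightarrow> 'm"  \<comment> \<open>\<open>Comp C g f\<close> is \<open>f\<close> followed by \<open>g\<close>\<close>

definition category :: "('o, 'm) cat \<Rightarrow> bool" where
  "category C \<longleftrightarrow>
     (\<forall>f\<in>Arr C. Dom C f \<in> Obj C \<and> Cod C f \<in> Obj C) \<and>
     (\<forall>x\<in>Obj C. Ident C x \<in> Arr C \<and> Dom C (Ident C x) = x \<and> Cod C (Ident C x) = x) \<and>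
     (\<forall>f\<in>Arr C. \<forall>g\<in>Arr C. Dom C g = Cod C f \<longrightarrow>
        Comp C g f \<in> Arr C \<and> Dom C (Comp C g f) = Dom C f \<and> Cod C (Comp C g f) = Cod C g) \<and>
     (\<forall>f\<in>Arr C. Comp C f (Ident C (Dom C f)) = f \<and> Comp C (Ident C (Cod C f)) f = f) \<and>
     (\<forall>f\<in>Arr C. \<forall>g\<in>Arr C. \<forall>h\<in>Arr C. Dom C g = Cod C f \<longrightarrow> Dom C h = Cod C g \<longrightarrow>
        Comp C h (Comp C g f) = Comp C (Comp C h g) f)"

definition iso_arr :: "('o, 'm) cat \<Rightarrow> 'm \<Rightarrow> bool" where
  "iso_arr C f \<longleftrightarrow> f \<in> Arr C \<and>
     (\<exists>g\<in>Arr C. Dom C g = Cod C f \<and> Cod C g = Dom C f \<and>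
        Comp C g f = Ident C (Dom C f) \<and> Comp C f g = Ident C (Cod C f))"

definition isomorphic :: "('o, 'm) cat \<Rightarrow> 'o \<Rightarrow> 'o \<Rightarrow> bool" where
  "isomorphic C x y \<longleftrightarrow> (\<exists>f. iso_arr C f \<and> Dom C f = x \<and> Cod C f = y)"

text \<open>Functors and natural transformations carry their source and target, and the maps they consist
  of are required to be undefined off their domain, so that equality of records is equality of
  functors and of transformations. Strict functoriality of a prederivator relies on this.\<close>

record ('o, 'm, 'p, 'n) ftor =
  Src :: "('o, 'm) cat"
  Tgt :: "('p, 'n) cat"
  OM :: "'o \<Rightarrow> 'p"
  MM :: "'m \<Rightarrow> 'n"

definition is_functor :: "('o, 'm, 'p, 'n) ftor \<Rightarrow> bool" where
  "is_functor F \<longleftrightarrow>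
     category (Src F) \<and> category (Tgt F) \<and>
     OM F \<in> Obj (Src F) \<rightarrow>\<^sub>E Obj (Tgt F) \<and>
     MM F \<in> Arr (Src F) \<rightarrow>\<^sub>E Arr (Tgt F) \<and>
     (\<forall>f\<in>Arr (Src F). Dom (Tgt F) (MM F f) = OM F (Dom (Src F) f) \<and>
        Cod (Tgt F) (MM F f) = OM F (Cod (Src F) f)) \<and>
     (\<forall>x\<in>Obj (Src F). MM F (Ident (Src F) x) = Ident (Tgt F) (OM F x)) \<and>
     (\<forall>f\<in>Arr (Src F). \<forall>g\<in>Arr (Src F). Dom (Src F) g = Cod (Src F) f \<longrightarrow>
        MM F (Comp (Src F) g f) = Comp (Tgt F) (MM F g) (MM F f))"

definition id_functor :: "('o, 'm) cat \<Rightarrow> ('o, 'm, 'o, 'm) ftor" where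
  "id_functor C = \<lparr>Src = C, Tgt = C, OM = (\<lambda>x\<in>Obj C. x), MM = (\<lambda>f\<in>Arr C. f)\<rparr>"

definition comp_functor ::
    "('p, 'n, 'q, 'k) ftor \<Rightarrow> ('o, 'm, 'p, 'n) ftor \<Rightarrow> ('o, 'm, 'q, 'k) ftor" where
  "comp_functor G F = \<lparr>Src = Src F, Tgt = Tgt G,
     OM = compose (Obj (Src F)) (OM G) (OM F), MM = compose (Arr (Src F)) (MM G) (MM F)\<rparr>"

definition const_functor :: "('o, 'm) cat \<Rightarrow> ('p, 'n) cat \<Rightarrow> 'p \<Rightarrow> ('o, 'm, 'p, 'n) ftor" where
  "const_functor C E b =
     \<lparr>Src = C, Tgt = E, OM = (\<lambda>x\<in>Obj C. b), MM = (\<lambda>f\<in>Arr C. Ident E b)\<rparr>"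

definition ess_image :: "('o, 'm, 'p, 'n) ftor \<Rightarrow> 'p set" where
  "ess_image F = {X \<in> Obj (Tgt F). \<exists>Y\<in>Obj (Src F). isomorphic (Tgt F) (OM F Y) X}"

record ('o, 'm, 'p, 'n) ntrans =
  NSrc :: "('o, 'm, 'p, 'n) ftor"
  NTgt :: "('o, 'm, 'p, 'n) ftor"
  NComp :: "'o \<Rightarrow> 'n"

definition is_nat :: "('o, 'm, 'p, 'n) ntrans \<Rightarrow> bool" where
  "is_nat \<alpha> \<longleftrightarrow>
     is_functor (NSrc \<alpha>) \<and> is_functor (NTgt \<alpha>) \<and>
     Src (NSrc \<alpha>) = Src (NTgt \<alpha>) \<and> Tgt (NSrc \<alpha>) = Tgt (NTgt \<alpha>) \<and>
     NComp \<alpha> \<in> Obj (Src (NSrc \<alpha>)) \<rightarrow>\<^sub>E Arr (Tgt (NSrc \<alpha>)) \<and>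
     (\<forall>x\<in>Obj (Src (NSrc \<alpha>)). Dom (Tgt (NSrc \<alpha>)) (NComp \<alpha> x) = OM (NSrc \<alpha>) x \<and>
        Cod (Tgt (NSrc \<alpha>)) (NComp \<alpha> x) = OM (NTgt \<alpha>) x) \<and>
     (\<forall>f\<in>Arr (Src (NSrc \<alpha>)).
        Comp (Tgt (NSrc \<alpha>)) (NComp \<alpha> (Cod (Src (NSrc \<alpha>)) f)) (MM (NSrc \<alpha>) f) =
        Comp (Tgt (NSrc \<alpha>)) (MM (NTgt \<alpha>) f) (NComp \<alpha> (Dom (Src (NSrc \<alpha>)) f)))"

definition id_nat :: "('o, 'm, 'p, 'n) ftor \<Rightarrow> ('o, 'm, 'p, 'n) ntrans" where
  "id_nat F = \<lparr>NSrc = F, NTgt = F, NComp = (\<lambda>x\<in>Obj (Src F). Ident (Tgt F) (OM F x))\<rparr>"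

definition vcomp ::
    "('o, 'm, 'p, 'n) ntrans \<Rightarrow> ('o, 'm, 'p, 'n) ntrans \<Rightarrow> ('o, 'm, 'p, 'n) ntrans" where
  "vcomp \<beta> \<alpha> = \<lparr>NSrc = NSrc \<alpha>, NTgt = NTgt \<beta>,
     NComp = (\<lambda>x\<in>Obj (Src (NSrc \<alpha>)). Comp (Tgt (NSrc \<alpha>)) (NComp \<beta> x) (NComp \<alpha> x))\<rparr>"

definition hcomp ::
    "('p, 'n, 'q, 'k) ntrans \<Rightarrow> ('o, 'm, 'p, 'n) ntrans \<Rightarrow> ('o, 'm, 'q, 'k) ntrans" where
  "hcomp \<beta> \<alpha> =
     \<lparr>NSrc = comp_functor (NSrc \<beta>) (NSrc \<alpha>), NTgt = comp_functor (NTgt \<beta>) (NTgt \<alpha>),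
      NComp = (\<lambda>x\<in>Obj (Src (NSrc \<alpha>)).
        Comp (Tgt (NSrc \<beta>)) (NComp \<beta> (OM (NTgt \<alpha>) x)) (MM (NSrc \<beta>) (NComp \<alpha> x)))\<rparr>"

definition is_nat_iso :: "('o, 'm, 'p, 'n) ntrans \<Rightarrow> bool" where
  "is_nat_iso \<alpha> \<longleftrightarrow>
     is_nat \<alpha> \<and> (\<forall>x\<in>Obj (Src (NSrc \<alpha>)). iso_arr (Tgt (NSrc \<alpha>)) (NComp \<alpha> x))"

definition is_equivalence :: "('o, 'm, 'p, 'n) ftor \<Rightarrow> bool" where
  "is_equivalence F \<longleftrightarrow> is_functor F \<and>
     (\<exists>G \<eta> \<epsilon>. is_functor G \<and> Src G = Tgt F \<and> Tgt G = Src F \<and>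
        is_nat_iso \<eta> \<and> NSrc \<eta> = id_functor (Src F) \<and> NTgt \<eta> = comp_functor G F \<and>
        is_nat_iso \<epsilon> \<and> NSrc \<epsilon> = comp_functor F G \<and> NTgt \<epsilon> = id_functor (Tgt F))"

text \<open>\<open>adjunction L R \<eta> \<epsilon>\<close>: \<open>L\<close> is left adjoint to \<open>R\<close> with unit \<open>\<eta>\<close> and counit \<open>\<epsilon>\<close>.\<close>

definition adjunction ::
    "('o, 'm, 'p, 'n) ftor \<Rightarrow> ('p, 'n, 'o, 'm) ftor \<Rightarrow>
     ('o, 'm, 'o, 'm) ntrans \<Rightarrow> ('p, 'n, 'p, 'n) ntrans \<Rightarrow> bool" where
  "adjunction L R \<eta> \<epsilon> \<longleftrightarrow>
     is_functor L \<and> is_functor R \<and> Src R = Tgt L \<and> Tgt R = Src L \<and>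
     is_nat \<eta> \<and> NSrc \<eta> = id_functor (Src L) \<and> NTgt \<eta> = comp_functor R L \<and>
     is_nat \<epsilon> \<and> NSrc \<epsilon> = comp_functor L R \<and> NTgt \<epsilon> = id_functor (Tgt L) \<and>
     (\<forall>x\<in>Obj (Src L).
        Comp (Tgt L) (NComp \<epsilon> (OM L x)) (MM L (NComp \<eta> x)) = Ident (Tgt L) (OM L x)) \<and>
     (\<forall>y\<in>Obj (Tgt L).
        Comp (Src L) (MM R (NComp \<epsilon> y)) (NComp \<eta> (OM R y)) = Ident (Src L) (OM R y))"


section \<open>Constructions on categories\<close>

definition prod_cat :: "('o, 'm) cat \<Rightarrow> ('p, 'n) cat \<Rightarrow> ('o \<times> 'p, 'm \<times> 'n) cat" where
  "prod_cat A B = \<lparr>Obj = Obj A \<times> Obj B, Arr = Arr A \<times> Arr B,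
     Dom = map_prod (Dom A) (Dom B), Cod = map_prod (Cod A) (Cod B),
     Ident = map_prod (Ident A) (Ident B),
     Comp = (\<lambda>g f. (Comp A (fst g) (fst f), Comp B (snd g) (snd f)))\<rparr>"

definition prod_functor ::
    "('o, 'm, 'p, 'n) ftor \<Rightarrow> ('o2, 'm2, 'p2, 'n2) ftor \<Rightarrow>
     ('o \<times> 'o2, 'm \<times> 'm2, 'p \<times> 'p2, 'n \<times> 'n2) ftor" where
  "prod_functor F G = \<lparr>Src = prod_cat (Src F) (Src G), Tgt = prod_cat (Tgt F) (Tgt G),
     OM = (\<lambda>x\<in>Obj (Src F) \<times> Obj (Src G). map_prod (OM F) (OM G) x),
     MM = (\<lambda>f\<in>Arr (Src F) \<times> Arr (Src G). map_prod (MM F) (MM G) f)\<rparr>"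

definition coprod_cat :: "'i set \<Rightarrow> ('i \<Rightarrow> ('o, 'm) cat) \<Rightarrow> ('i \<times> 'o, 'i \<times> 'm) cat" where
  "coprod_cat I A = \<lparr>Obj = (SIGMA i:I. Obj (A i)), Arr = (SIGMA i:I. Arr (A i)),
     Dom = (\<lambda>(i, f). (i, Dom (A i) f)), Cod = (\<lambda>(i, f). (i, Cod (A i) f)),
     Ident = (\<lambda>(i, x). (i, Ident (A i) x)),
     Comp = (\<lambda>(i, g) (j, f). (i, Comp (A i) g f))\<rparr>"

definition coprod_incl ::
    "'i set \<Rightarrow> ('i \<Rightarrow> ('o, 'm) cat) \<Rightarrow> 'i \<Rightarrow> ('o, 'm, 'i \<times> 'o, 'i \<times> 'm) ftor" where
  "coprod_incl I A i = \<lparr>Src = A i, Tgt = coprod_cat I A,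
     OM = (\<lambda>x\<in>Obj (A i). (i, x)), MM = (\<lambda>f\<in>Arr (A i). (i, f))\<rparr>"

definition prod_fam_cat :: "'i set \<Rightarrow> ('i \<Rightarrow> ('o, 'm) cat) \<Rightarrow> ('i \<Rightarrow> 'o, 'i \<Rightarrow> 'm) cat" where
  "prod_fam_cat I C = \<lparr>Obj = (\<Pi>\<^sub>E i\<in>I. Obj (C i)), Arr = (\<Pi>\<^sub>E i\<in>I. Arr (C i)),
     Dom = (\<lambda>f. \<lambda>i\<in>I. Dom (C i) (f i)), Cod = (\<lambda>f. \<lambda>i\<in>I. Cod (C i) (f i)),
     Ident = (\<lambda>x. \<lambda>i\<in>I. Ident (C i) (x i)),
     Comp = (\<lambda>g f. \<lambda>i\<in>I. Comp (C i) (g i) (f i))\<rparr>"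

definition poset_cat :: "'a::order set \<Rightarrow> ('a, 'a \<times> 'a) cat" where
  "poset_cat P = \<lparr>Obj = P, Arr = {(x, y). x \<in> P \<and> y \<in> P \<and> x \<le> y},
     Dom = fst, Cod = snd, Ident = (\<lambda>x. (x, x)), Comp = (\<lambda>g f. (fst f, snd g))\<rparr>"

definition poset_functor ::
    "'a::order set \<Rightarrow> 'b::order set \<Rightarrow> ('a \<Rightarrow> 'b) \<Rightarrow> ('a, 'a \<times> 'a, 'b, 'b \<times> 'b) ftor" where
  "poset_functor P Q \<phi> = \<lparr>Src = poset_cat P, Tgt = poset_cat Q, OM = restrict \<phi> P,
     MM = (\<lambda>f\<in>Arr (poset_cat P). map_prod \<phi> \<phi> f)\<rparr>"

text \<open>The comma categories \<open>(u/b)\<close>, with objects \<open>(a, f : u a \<rightarrow> b)\<close>, and \<open>(b/u)\<close>, with objects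
  \<open>(a, f : b \<rightarrow> u a)\<close>. A morphism is a triple (source, morphism of the category \<open>Src u\<close>, target).\<close>

definition comma_obj :: "('o, 'm, 'p, 'n) ftor \<Rightarrow> 'p \<Rightarrow> ('o \<times> 'n) set" where
  "comma_obj u b = {(a, f). a \<in> Obj (Src u) \<and> f \<in> Arr (Tgt u) \<and>
     Dom (Tgt u) f = OM u a \<and> Cod (Tgt u) f = b}"

definition comma_cat ::
    "('o, 'm, 'p, 'n) ftor \<Rightarrow> 'p \<Rightarrow> ('o \<times> 'n, ('o \<times> 'n) \<times> 'm \<times> ('o \<times> 'n)) cat" where
  "comma_cat u b = \<lparr>Obj = comma_obj u b,
     Arr = {(s, g, t). s \<in> comma_obj u b \<and> t \<in> comma_obj u b \<and> g \<in> Arr (Src u) \<and>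
       Dom (Src u) g = fst s \<and> Cod (Src u) g = fst t \<and> Comp (Tgt u) (snd t) (MM u g) = snd s},
     Dom = (\<lambda>(s, g, t). s), Cod = (\<lambda>(s, g, t). t),
     Ident = (\<lambda>s. (s, Ident (Src u) (fst s), s)),
     Comp = (\<lambda>(s', g', t') (s, g, t). (s, Comp (Src u) g' g, t'))\<rparr>"

definition cocomma_obj :: "('o, 'm, 'p, 'n) ftor \<Rightarrow> 'p \<Rightarrow> ('o \<times> 'n) set" where
  "cocomma_obj u b = {(a, f). a \<in> Obj (Src u) \<and> f \<in> Arr (Tgt u) \<and>
     Dom (Tgt u) f = b \<and> Cod (Tgt u) f = OM u a}"

definition cocomma_cat ::
    "('o, 'm, 'p, 'n) ftor \<Rightarrow> 'p \<Rightarrow> ('o \<times> 'n, ('o \<times> 'n) \<times> 'm \<times> ('o \<times> 'n)) cat" where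
  "cocomma_cat u b = \<lparr>Obj = cocomma_obj u b,
     Arr = {(s, g, t). s \<in> cocomma_obj u b \<and> t \<in> cocomma_obj u b \<and> g \<in> Arr (Src u) \<and>
       Dom (Src u) g = fst s \<and> Cod (Src u) g = fst t \<and> Comp (Tgt u) (MM u g) (snd s) = snd t},
     Dom = (\<lambda>(s, g, t). s), Cod = (\<lambda>(s, g, t). t),
     Ident = (\<lambda>s. (s, Ident (Src u) (fst s), s)),
     Comp = (\<lambda>(s', g', t') (s, g, t). (s, Comp (Src u) g' g, t'))\<rparr>"

text \<open>Projection from either comma category \<open>E\<close> to the category \<open>A = Src u\<close>.\<close>

definition comma_proj ::
    "('a \<times> 'b, 'c \<times> 'm \<times> 'd) cat \<Rightarrow> ('a, 'm) cat \<Rightarrow> ('a \<times> 'b, 'c \<times> 'm \<times> 'd, 'a, 'm) ftor" where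
  "comma_proj E A = \<lparr>Src = E, Tgt = A,
     OM = (\<lambda>x\<in>Obj E. fst x), MM = (\<lambda>f\<in>Arr E. fst (snd f))\<rparr>"


section \<open>Small categories\<close>

text \<open>The infinite type \<open>'u\<close> plays the role of the universe: a small set is a subset of \<open>'u\<close> of
  strictly smaller cardinality, and Cat consists of the categories whose objects and arrows form
  small sets. If the cardinality of \<open>'u\<close> is strongly inaccessible, these are, up to
  isomorphism, the small categories of the corresponding Grothendieck universe. Finite products,
  comma categories and finite posets exist in Cat as soon as \<open>'u\<close> is infinite; for coproducts of small
  families see \<open>der1\<close> below.

  Posets of subsets, products, coproducts and comma categories have objects and arrows of other
  types. \<open>cp C\<close> is an isomorphic copy of \<open>C\<close> inside \<open>'u\<close>, obtained from a fixed choice of injections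
  (which exist when the carriers are small enough), and \<open>cp_to C\<close>, \<open>cp_from C\<close> are the mutually
  inverse isomorphisms between \<open>C\<close> and \<open>cp C\<close>.\<close>

type_synonym 'u scat = "('u, 'u) cat"
type_synonym 'u sftor = "('u, 'u, 'u, 'u) ftor"
type_synonym 'u sntrans = "('u, 'u, 'u, 'u) ntrans"

definition small :: "'u set \<Rightarrow> bool" where
  "small S \<longleftrightarrow> S \<prec> (UNIV :: 'u set)"

definition small_cat :: "'u scat \<Rightarrow> bool" where
  "small_cat A \<longleftrightarrow> category A \<and> small (Obj A) \<and> small (Arr A)"

definition small_functor :: "'u scat \<Rightarrow> 'u scat \<Rightarrow> 'u sftor \<Rightarrow> bool" where
  "small_functor A B u \<longleftrightarrow>
     is_functor u \<and> Src u = A \<and> Tgt u = B \<and> small_cat A \<and> small_cat B"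

definition small_nat :: "'u sftor \<Rightarrow> 'u sftor \<Rightarrow> 'u sntrans \<Rightarrow> bool" where
  "small_nat u v \<alpha> \<longleftrightarrow>
     is_nat \<alpha> \<and> NSrc \<alpha> = u \<and> NTgt \<alpha> = v \<and> small_cat (Src u) \<and> small_cat (Tgt u)"

definition enc :: "'a set \<Rightarrow> 'a \<Rightarrow> 'u" where
  "enc S = (SOME e. inj_on e S)"

definition dec :: "'a set \<Rightarrow> 'u \<Rightarrow> 'a" where
  "dec S = inv_into S (enc S)"

definition cp :: "('o, 'm) cat \<Rightarrow> 'u scat" where
  "cp C = \<lparr>Obj = enc (Obj C) ` Obj C, Arr = enc (Arr C) ` Arr C,
     Dom = (\<lambda>f. enc (Obj C) (Dom C (dec (Arr C) f))),
     Cod = (\<lambda>f. enc (Obj C) (Cod C (dec (Arr C) f))),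
     Ident = (\<lambda>x. enc (Arr C) (Ident C (dec (Obj C) x))),
     Comp = (\<lambda>g f. enc (Arr C) (Comp C (dec (Arr C) g) (dec (Arr C) f)))\<rparr>"

definition cp_to :: "('o, 'm) cat \<Rightarrow> ('o, 'm, 'u, 'u) ftor" where
  "cp_to C = \<lparr>Src = C, Tgt = cp C,
     OM = restrict (enc (Obj C)) (Obj C), MM = restrict (enc (Arr C)) (Arr C)\<rparr>"

definition cp_from :: "('o, 'm) cat \<Rightarrow> ('u, 'u, 'o, 'm) ftor" where
  "cp_from C = \<lparr>Src = cp C, Tgt = C,
     OM = restrict (dec (Obj C)) (Obj (cp C)), MM = restrict (dec (Arr C)) (Arr (cp C))\<rparr>"

definition cp_functor :: "('o, 'm, 'p, 'n) ftor \<Rightarrow> 'u sftor" where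
  "cp_functor F = comp_functor (cp_to (Tgt F)) (comp_functor F (cp_from (Src F)))"

definition one_cat :: "'u scat" where
  "one_cat = cp (poset_cat (UNIV :: unit set))"

definition one_obj :: "'u" where
  "one_obj = enc (UNIV :: unit set) ()"

definition bang :: "'u scat \<Rightarrow> 'u sftor" where
  "bang A = const_functor A one_cat one_obj"

definition pt :: "'u scat \<Rightarrow> 'u \<Rightarrow> 'u sftor" where
  "pt A a = const_functor one_cat A a"

definition slice :: "'u sftor \<Rightarrow> 'u \<Rightarrow> 'u scat" where
  "slice u b = cp (comma_cat u b)"

definition slice_proj :: "'u sftor \<Rightarrow> 'u \<Rightarrow> 'u sftor" where
  "slice_proj u b = comp_functor (comma_proj (comma_cat u b) (Src u)) (cp_from (comma_cat u b))"

text \<open>The tautological 2-cell \<open>u \<circ> p \<Rightarrow> b \<circ> \<pi>\<close> on \<open>(u/b)\<close>, with component \<open>f\<close> at \<open>(a, f)\<close>.\<close>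

definition slice_cell :: "'u sftor \<Rightarrow> 'u \<Rightarrow> 'u sntrans" where
  "slice_cell u b = \<lparr>NSrc = comp_functor u (slice_proj u b),
     NTgt = comp_functor (pt (Tgt u) b) (bang (slice u b)),
     NComp = (\<lambda>x\<in>Obj (slice u b). snd (dec (comma_obj u b) x))\<rparr>"

definition coslice :: "'u sftor \<Rightarrow> 'u \<Rightarrow> 'u scat" where
  "coslice u b = cp (cocomma_cat u b)"

definition coslice_proj :: "'u sftor \<Rightarrow> 'u \<Rightarrow> 'u sftor" where
  "coslice_proj u b =
     comp_functor (comma_proj (cocomma_cat u b) (Src u)) (cp_from (cocomma_cat u b))"

text \<open>The tautological 2-cell \<open>b \<circ> \<pi> \<Rightarrow> u \<circ> q\<close> on \<open>(b/u)\<close>.\<close>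

definition coslice_cell :: "'u sftor \<Rightarrow> 'u \<Rightarrow> 'u sntrans" where
  "coslice_cell u b = \<lparr>NSrc = comp_functor (pt (Tgt u) b) (bang (coslice u b)),
     NTgt = comp_functor u (coslice_proj u b),
     NComp = (\<lambda>x\<in>Obj (coslice u b). snd (dec (cocomma_obj u b) x))\<rparr>"


section \<open>Derivators\<close>

record ('u, 'o, 'm) prederiv =
  DOb :: "'u scat \<Rightarrow> ('o, 'm) cat"
  DFun :: "'u sftor \<Rightarrow> ('o, 'm, 'o, 'm) ftor"
  DNat :: "'u sntrans \<Rightarrow> ('o, 'm, 'o, 'm) ntrans"

definition prederivator :: "('u, 'o, 'm) prederiv \<Rightarrow> bool" where
  "prederivator D \<longleftrightarrow>
     (\<forall>A. small_cat A \<longrightarrow> category (DOb D A)) \<and>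
     (\<forall>A B u. small_functor A B u \<longrightarrow>
        is_functor (DFun D u) \<and> Src (DFun D u) = DOb D B \<and> Tgt (DFun D u) = DOb D A) \<and>
     (\<forall>u v \<alpha>. small_nat u v \<alpha> \<longrightarrow>
        is_nat (DNat D \<alpha>) \<and> NSrc (DNat D \<alpha>) = DFun D u \<and> NTgt (DNat D \<alpha>) = DFun D v) \<and>
     (\<forall>A. small_cat A \<longrightarrow> DFun D (id_functor A) = id_functor (DOb D A)) \<and>
     (\<forall>A B C u v. small_functor A B u \<longrightarrow> small_functor B C v \<longrightarrow>
        DFun D (comp_functor v u) = comp_functor (DFun D u) (DFun D v)) \<and>
     (\<forall>A B u. small_functor A B u \<longrightarrow> DNat D (id_nat u) = id_nat (DFun D u)) \<and>
     (\<forall>u v w \<alpha> \<beta>. small_nat u v \<alpha> \<longrightarrow> small_nat v w \<beta> \<longrightarrow>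
        DNat D (vcomp \<beta> \<alpha>) = vcomp (DNat D \<beta>) (DNat D \<alpha>)) \<and>
     (\<forall>u u' v v' \<alpha> \<beta>. small_nat u u' \<alpha> \<longrightarrow> small_nat v v' \<beta> \<longrightarrow> Tgt u = Src v \<longrightarrow>
        DNat D (hcomp \<beta> \<alpha>) = hcomp (DNat D \<alpha>) (DNat D \<beta>))"

definition der1_functor ::
    "('u, 'o, 'm) prederiv \<Rightarrow> 'u set \<Rightarrow> ('u \<Rightarrow> 'u scat) \<Rightarrow> ('o, 'm, 'u \<Rightarrow> 'o, 'u \<Rightarrow> 'm) ftor" where
  "der1_functor D I A =
     (let incl = (\<lambda>i. DFun D (comp_functor (cp_to (coprod_cat I A)) (coprod_incl I A i)))
      in \<lparr>Src = DOb D (cp (coprod_cat I A)), Tgt = prod_fam_cat I (\<lambda>i. DOb D (A i)),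
          OM = (\<lambda>X\<in>Obj (DOb D (cp (coprod_cat I A))). \<lambda>i\<in>I. OM (incl i) X),
          MM = (\<lambda>f\<in>Arr (DOb D (cp (coprod_cat I A))). \<lambda>i\<in>I. MM (incl i) f)\<rparr>)"

text \<open>The last hypothesis, that the coproduct is again in Cat, is automatic whenever the cardinality
  of \<open>'u\<close> is regular, in particular when it is inaccessible.\<close>

definition der1 :: "('u, 'o, 'm) prederiv \<Rightarrow> bool" where
  "der1 D \<longleftrightarrow> (\<forall>I A. small I \<longrightarrow> (\<forall>i\<in>I. small_cat (A i)) \<longrightarrow>
     (SIGMA i:I. Obj (A i)) \<prec> (UNIV :: 'u set) \<longrightarrow> (SIGMA i:I. Arr (A i)) \<prec> (UNIV :: 'u set) \<longrightarrow>
     is_equivalence (der1_functor D I A))"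

definition der2 :: "('u, 'o, 'm) prederiv \<Rightarrow> bool" where
  "der2 D \<longleftrightarrow> (\<forall>A. small_cat A \<longrightarrow> (\<forall>f\<in>Arr (DOb D A).
     iso_arr (DOb D A) f \<longleftrightarrow> (\<forall>a\<in>Obj A. iso_arr (DOb D one_cat) (MM (DFun D (pt A a)) f))))"

definition der3 :: "('u, 'o, 'm) prederiv \<Rightarrow> bool" where
  "der3 D \<longleftrightarrow> (\<forall>A B u. small_functor A B u \<longrightarrow>
     (\<exists>L \<eta> \<epsilon>. adjunction L (DFun D u) \<eta> \<epsilon>) \<and> (\<exists>R \<eta> \<epsilon>. adjunction (DFun D u) R \<eta> \<epsilon>))"

text \<open>A choice of the left adjoint \<open>u\<^sub>!\<close> and of the right adjoint \<open>u\<^sub>*\<close> of \<open>u\<^sup>*\<close>, together with units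
  and counits.\<close>

definition lkan_adj :: "('u, 'o, 'm) prederiv \<Rightarrow> 'u sftor \<Rightarrow>
    ('o, 'm, 'o, 'm) ftor \<times> ('o, 'm, 'o, 'm) ntrans \<times> ('o, 'm, 'o, 'm) ntrans" where
  "lkan_adj D u = (SOME (L, \<eta>, \<epsilon>). adjunction L (DFun D u) \<eta> \<epsilon>)"

definition lkan :: "('u, 'o, 'm) prederiv \<Rightarrow> 'u sftor \<Rightarrow> ('o, 'm, 'o, 'm) ftor" where
  "lkan D u = fst (lkan_adj D u)"

definition lkan_unit :: "('u, 'o, 'm) prederiv \<Rightarrow> 'u sftor \<Rightarrow> ('o, 'm, 'o, 'm) ntrans" where
  "lkan_unit D u = fst (snd (lkan_adj D u))"

definition lkan_counit :: "('u, 'o, 'm) prederiv \<Rightarrow> 'u sftor \<Rightarrow> ('o, 'm, 'o, 'm) ntrans" where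
  "lkan_counit D u = snd (snd (lkan_adj D u))"

definition rkan_adj :: "('u, 'o, 'm) prederiv \<Rightarrow> 'u sftor \<Rightarrow>
    ('o, 'm, 'o, 'm) ftor \<times> ('o, 'm, 'o, 'm) ntrans \<times> ('o, 'm, 'o, 'm) ntrans" where
  "rkan_adj D u = (SOME (R, \<eta>, \<epsilon>). adjunction (DFun D u) R \<eta> \<epsilon>)"

definition rkan :: "('u, 'o, 'm) prederiv \<Rightarrow> 'u sftor \<Rightarrow> ('o, 'm, 'o, 'm) ftor" where
  "rkan D u = fst (rkan_adj D u)"

definition rkan_unit :: "('u, 'o, 'm) prederiv \<Rightarrow> 'u sftor \<Rightarrow> ('o, 'm, 'o, 'm) ntrans" where
  "rkan_unit D u = fst (snd (rkan_adj D u))"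

definition rkan_counit :: "('u, 'o, 'm) prederiv \<Rightarrow> 'u sftor \<Rightarrow> ('o, 'm, 'o, 'm) ntrans" where
  "rkan_counit D u = snd (snd (rkan_adj D u))"

text \<open>The canonical map \<open>\<pi>\<^sub>! p\<^sup>* X \<rightarrow> b\<^sup>* u\<^sub>! X\<close>, i.e. the mate of the slice 2-cell:
  \<open>\<pi>\<^sub>! p\<^sup>* X \<rightarrow> \<pi>\<^sub>! p\<^sup>* u\<^sup>* u\<^sub>! X \<rightarrow> \<pi>\<^sub>! \<pi>\<^sup>* b\<^sup>* u\<^sub>! X \<rightarrow> b\<^sup>* u\<^sub>! X\<close>.\<close>

definition lkan_canon :: "('u, 'o, 'm) prederiv \<Rightarrow> 'u sftor \<Rightarrow> 'u \<Rightarrow> 'o \<Rightarrow> 'm" where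
  "lkan_canon D u b X =
     (let p = slice_proj u b; \<pi> = bang (slice u b); Y = OM (lkan D u) X; E = DOb D one_cat
      in Comp E (NComp (lkan_counit D \<pi>) (OM (DFun D (pt (Tgt u) b)) Y))
          (Comp E (MM (lkan D \<pi>) (NComp (DNat D (slice_cell u b)) Y))
            (MM (lkan D \<pi>) (MM (DFun D p) (NComp (lkan_unit D u) X)))))"

text \<open>Dually, \<open>b\<^sup>* u\<^sub>* X \<rightarrow> \<pi>\<^sub>* \<pi>\<^sup>* b\<^sup>* u\<^sub>* X \<rightarrow> \<pi>\<^sub>* q\<^sup>* u\<^sup>* u\<^sub>* X \<rightarrow> \<pi>\<^sub>* q\<^sup>* X\<close>.\<close>

definition rkan_canon :: "('u, 'o, 'm) prederiv \<Rightarrow> 'u sftor \<Rightarrow> 'u \<Rightarrow> 'o \<Rightarrow> 'm" where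
  "rkan_canon D u b X =
     (let q = coslice_proj u b; \<pi> = bang (coslice u b); Y = OM (rkan D u) X; E = DOb D one_cat
      in Comp E (MM (rkan D \<pi>) (MM (DFun D q) (NComp (rkan_counit D u) X)))
          (Comp E (MM (rkan D \<pi>) (NComp (DNat D (coslice_cell u b)) Y))
            (NComp (rkan_unit D \<pi>) (OM (DFun D (pt (Tgt u) b)) Y))))"

definition der4 :: "('u, 'o, 'm) prederiv \<Rightarrow> bool" where
  "der4 D \<longleftrightarrow> (\<forall>A B u. small_functor A B u \<longrightarrow> (\<forall>b\<in>Obj B. \<forall>X\<in>Obj (DOb D A).
     iso_arr (DOb D one_cat) (lkan_canon D u b X) \<and>
     iso_arr (DOb D one_cat) (rkan_canon D u b X)))"

definition derivator :: "('u, 'o, 'm) prederiv \<Rightarrow> bool" where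
  "derivator D \<longleftrightarrow> prederivator D \<and> der1 D \<and> der2 D \<and> der3 D \<and> der4 D"

text \<open>The derivator \<open>D\<^sup>A : B \<mapsto> D(A \<times> B)\<close>, and the components at \<open>B\<close> of the morphisms \<open>u\<^sup>*\<close> and \<open>u\<^sub>!\<close>
  between such derivators, which are \<open>(u \<times> B)\<^sup>*\<close> and \<open>(u \<times> B)\<^sub>!\<close>. Here \<open>A\<close> may have objects and
  arrows of any type; it is the parameter \<open>B\<close> that ranges over Cat.\<close>

definition shift_ob :: "('u, 'o, 'm) prederiv \<Rightarrow> ('p, 'n) cat \<Rightarrow> 'u scat \<Rightarrow> ('o, 'm) cat" where
  "shift_ob D A B = DOb D (cp (prod_cat A B))"

definition shift_pull ::
    "('u, 'o, 'm) prederiv \<Rightarrow> ('p, 'n, 'q, 'k) ftor \<Rightarrow> 'u scat \<Rightarrow> ('o, 'm, 'o, 'm) ftor" where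
  "shift_pull D u B = DFun D (cp_functor (prod_functor u (id_functor B)))"

definition shift_lkan ::
    "('u, 'o, 'm) prederiv \<Rightarrow> ('p, 'n, 'q, 'k) ftor \<Rightarrow> 'u scat \<Rightarrow> ('o, 'm, 'o, 'm) ftor" where
  "shift_lkan D u B = lkan D (cp_functor (prod_functor u (id_functor B)))"


section \<open>Cubes\<close>

definition cube :: "nat \<Rightarrow> nat set set" where
  "cube n = Pow {1..n}"

definition cube_le :: "nat \<Rightarrow> nat \<Rightarrow> nat set set" where
  "cube_le n l = {S \<in> cube n. card S \<le> l}"

definition cocartesian ::
    "('u, 'o, 'm) prederiv \<Rightarrow> 'u scat \<Rightarrow> nat \<Rightarrow> 'o \<Rightarrow> bool" where
  "cocartesian D B m Y \<longleftrightarrow>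
     Y \<in> ess_image (shift_lkan D (poset_functor (cube_le m (m - 1)) (cube m) id) B)"

definition cotruncated ::
    "('u, 'o, 'm) prederiv \<Rightarrow> 'u scat \<Rightarrow> nat \<Rightarrow> nat \<Rightarrow> nat \<Rightarrow> 'o \<Rightarrow> bool" where
  "cotruncated D B n l k X \<longleftrightarrow>
     X \<in> ess_image (shift_lkan D (poset_functor (cube_le n k) (cube_le n l) id) B)"

text \<open>All isomorphisms of the \<open>m\<close>-cube with intervals \<open>[x, y]\<close> are admitted.\<close>

definition interval_incl :: "nat \<Rightarrow> nat \<Rightarrow> nat \<Rightarrow> (nat set \<Rightarrow> nat set) \<Rightarrow> bool" where
  "interval_incl n l m \<phi> \<longleftrightarrow>
     (\<exists>x\<in>cube_le n l. \<exists>y\<in>cube_le n l. x \<subseteq> y \<and> card (y - x) = m \<and>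
        bij_betw \<phi> (cube m) {w. x \<subseteq> w \<and> w \<subseteq> y} \<and>
        (\<forall>S\<in>cube m. \<forall>T\<in>cube m. \<phi> S \<subseteq> \<phi> T \<longleftrightarrow> S \<subseteq> T))"

definition subcubes ::
    "('u, 'o, 'm) prederiv \<Rightarrow> 'u scat \<Rightarrow> nat \<Rightarrow> nat \<Rightarrow> nat \<Rightarrow> 'o \<Rightarrow> 'o set" where
  "subcubes D B n l m X =
     {OM (shift_pull D (poset_functor (cube m) (cube_le n l) \<phi>) B) X | \<phi>. interval_incl n l m \<phi>}"

end

theory Submission
  imports Defs
begin

text \<open>
  Call a cocone on a diagram \<open>F : K \<rightarrow> C\<close> with vertex \<open>c\<close> colimiting for \<open>W \<in> D(C)\<close> if it induces
  bijections \<open>Hom(c\<^sup>*W, E) \<cong> Hom(F\<^sup>*W, \<pi>\<^sup>*E)\<close>. By (Der2) and (Der4), for fully faithful \<open>u : A \<rightarrow> C\<close> the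
  object \<open>W\<close> lies in the essential image of \<open>u\<^sub>!\<close> iff for every \<open>c\<close> the canonical cocone on \<open>(u/c)\<close> is
  colimiting for \<open>W\<close>, and then \<open>u\<^sup>*\<close> is bijective on morphisms out of \<open>W\<close>. This notion does not change
  when the shape is restricted along a functor that has a left adjoint. In particular \<open>(S \<times> B)/(y, b)\<close>
  may be replaced by the poset of all \<open>w \<in> S\<close> with \<open>w \<subseteq> y\<close>, so the parameter category \<open>B\<close> only
  contributes its objects.

  Let \<open>x \<subseteq> y\<close> with \<open>y \<setminus> x\<close> of cardinality greater than \<open>k\<close>, let \<open>A\<close> be the poset of all
  \<open>w \<subseteq> y\<close> with at most \<open>k\<close> elements, and let \<open>T\<close> be the poset of all \<open>w \<subseteq> y\<close> with \<open>x \<union> w \<noteq> y\<close>. Then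
  \<open>A \<subseteq> T\<close>, and \<open>w \<mapsto> x \<union> w\<close> is left adjoint to the inclusion of the half-open interval \<open>[x, y)\<close> into
  \<open>T\<close>. If \<open>X\<close> restricted to the proper subsets of \<open>y\<close> is left Kan extended from \<open>A\<close>, the colimits
  of \<open>X\<close> over \<open>A\<close>, \<open>T\<close> and \<open>[x, y)\<close> agree. Thus \<open>X\<^sub>y\<close> is the colimit over \<open>A\<close> iff the subcube \<open>[x, y]\<close> is
  cocartesian, and induction on the cardinality of \<open>y\<close> gives the theorem.
\<close>

section \<open>Categories and universal arrows\<close>

text \<open>(Der4) speaks of chosen adjoints and of mates built from them, and such a mate would
  have to be recomputed after every change of shape. With universal arrows the adjoints enter only
  to turn (Der4) into a universal property; afterwards only sets of morphisms are compared. A second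
  obstacle is that \<open>D\<close> sees only categories inside \<open>'u\<close>, whereas posets,
  products and comma categories have other types. Copying into \<open>'u\<close> is strictly
  functorial, so \<open>D\<close> extends to small categories of any type. Morphisms out of the
  diagram over \<open>T\<close> into a constant diagram restrict bijectively to \<open>A\<close> and
  to the half-open interval, for different reasons: over \<open>A\<close> because the diagram is
  left Kan extended, over the interval because its inclusion is a right adjoint. The bound k < card
  (y - x) puts \<open>A\<close> inside \<open>T\<close>, since x \<union> w = y forces y - x
  \<subseteq> w. A set y with more than k elements contains some z with k + 1 elements, and the
  single interval from y - z to y decides the condition at y; this is why (k + 1)-subcubes
  suffice.\<close>

definition hom :: "('o, 'm) cat \<Rightarrow> 'o \<Rightarrow> 'o \<Rightarrow> 'm set" where
  "hom C x y = {f \<in> Arr C. Dom C f = x \<and> Cod C f = y}"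

lemma hom_arr: "f \<in> hom C x y \<Longrightarrow> f \<in> Arr C"
  by (simp add: hom_def)

lemma hom_objs: "category C \<Longrightarrow> f \<in> hom C x y \<Longrightarrow> x \<in> Obj C \<and> y \<in> Obj C"
  unfolding category_def hom_def by auto

lemma arr_hom: "f \<in> Arr C \<Longrightarrow> f \<in> hom C (Dom C f) (Cod C f)"
  by (simp add: hom_def)

lemma ident_hom: "category C \<Longrightarrow> x \<in> Obj C \<Longrightarrow> Ident C x \<in> hom C x x"
  unfolding category_def hom_def by auto

lemma comp_hom:
  "category C \<Longrightarrow> f \<in> hom C x y \<Longrightarrow> g \<in> hom C y z \<Longrightarrow> Comp C g f \<in> hom C x z"
  unfolding category_def hom_def by auto

lemma comp_assoc:
  "category C \<Longrightarrow> f \<in> hom C w x \<Longrightarrow> g \<in> hom C x y \<Longrightarrow> h \<in> hom C y z \<Longrightarrow>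
    Comp C (Comp C h g) f = Comp C h (Comp C g f)"
  unfolding category_def hom_def by auto

lemma ident_left: "category C \<Longrightarrow> f \<in> hom C x y \<Longrightarrow> Comp C (Ident C y) f = f"
  and ident_right: "category C \<Longrightarrow> f \<in> hom C x y \<Longrightarrow> Comp C f (Ident C x) = f"
  unfolding category_def hom_def by auto

lemma categoryI:
  assumes "\<And>f. f \<in> Arr C \<Longrightarrow> Dom C f \<in> Obj C \<and> Cod C f \<in> Obj C"
    and "\<And>x. x \<in> Obj C \<Longrightarrow> Ident C x \<in> Arr C \<and> Dom C (Ident C x) = x \<and> Cod C (Ident C x) = x"
    and "\<And>f g. f \<in> Arr C \<Longrightarrow> g \<in> Arr C \<Longrightarrow> Dom C g = Cod C f \<Longrightarrow>
      Comp C g f \<in> Arr C \<and> Dom C (Comp C g f) = Dom C f \<and> Cod C (Comp C g f) = Cod C g"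
    and "\<And>f. f \<in> Arr C \<Longrightarrow> Comp C f (Ident C (Dom C f)) = f \<and> Comp C (Ident C (Cod C f)) f = f"
    and "\<And>f g h. f \<in> Arr C \<Longrightarrow> g \<in> Arr C \<Longrightarrow> h \<in> Arr C \<Longrightarrow> Dom C g = Cod C f \<Longrightarrow>
      Dom C h = Cod C g \<Longrightarrow> Comp C h (Comp C g f) = Comp C (Comp C h g) f"
  shows "category C"
  unfolding category_def using assms by blast

lemma iso_arrI:
  "f \<in> hom C x y \<Longrightarrow> g \<in> hom C y x \<Longrightarrow> Comp C g f = Ident C x \<Longrightarrow> Comp C f g = Ident C y \<Longrightarrow>
    iso_arr C f"
  unfolding iso_arr_def hom_def by auto

lemma iso_arrE:
  assumes "iso_arr C f" "f \<in> hom C x y"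
  obtains g where "g \<in> hom C y x" "Comp C g f = Ident C x" "Comp C f g = Ident C y"
  using assms unfolding iso_arr_def hom_def by auto

section \<open>Functors and natural transformations with named source and target\<close>

definition funct :: "('o, 'm) cat \<Rightarrow> ('p, 'n) cat \<Rightarrow> ('o, 'm, 'p, 'n) ftor \<Rightarrow> bool" where
  "funct A B F \<longleftrightarrow> is_functor F \<and> Src F = A \<and> Tgt F = B"

definition natt ::
    "('o, 'm, 'p, 'n) ftor \<Rightarrow> ('o, 'm, 'p, 'n) ftor \<Rightarrow> ('o, 'm, 'p, 'n) ntrans \<Rightarrow> bool" where
  "natt F G \<alpha> \<longleftrightarrow> is_nat \<alpha> \<and> NSrc \<alpha> = F \<and> NTgt \<alpha> = G"

lemma funct_src [simp]: "funct A B F \<Longrightarrow> Src F = A"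
  and funct_tgt [simp]: "funct A B F \<Longrightarrow> Tgt F = B"
  and funct_cat_src: "funct A B F \<Longrightarrow> category A"
  and funct_cat_tgt: "funct A B F \<Longrightarrow> category B"
  unfolding funct_def is_functor_def by auto

lemma funct_obj: "funct A B F \<Longrightarrow> x \<in> Obj A \<Longrightarrow> OM F x \<in> Obj B"
  unfolding funct_def is_functor_def by auto

lemma funct_hom: "funct A B F \<Longrightarrow> f \<in> hom A x y \<Longrightarrow> MM F f \<in> hom B (OM F x) (OM F y)"
  unfolding funct_def is_functor_def hom_def by auto

lemma funct_arr: "funct A B F \<Longrightarrow> f \<in> Arr A \<Longrightarrow> MM F f \<in> Arr B"
  unfolding funct_def is_functor_def hom_def by auto

lemma funct_ident: "funct A B F \<Longrightarrow> x \<in> Obj A \<Longrightarrow> MM F (Ident A x) = Ident B (OM F x)"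
  unfolding funct_def is_functor_def by auto

lemma funct_comp: "funct A B F \<Longrightarrow> f \<in> hom A x y \<Longrightarrow> g \<in> hom A y z \<Longrightarrow>
    MM F (Comp A g f) = Comp B (MM F g) (MM F f)"
  unfolding funct_def is_functor_def hom_def by auto

lemma functI:
  assumes "category (Src F)" "category (Tgt F)" "Src F = A" "Tgt F = B"
    and "\<And>x. x \<in> Obj A \<Longrightarrow> OM F x \<in> Obj B" and "OM F \<in> extensional (Obj A)"
    and "\<And>f. f \<in> Arr A \<Longrightarrow> MM F f \<in> hom B (OM F (Dom A f)) (OM F (Cod A f))"
    and "MM F \<in> extensional (Arr A)"
    and "\<And>x. x \<in> Obj A \<Longrightarrow> MM F (Ident A x) = Ident B (OM F x)"
    and "\<And>f g. f \<in> Arr A \<Longrightarrow> g \<in> Arr A \<Longrightarrow> Dom A g = Cod A f \<Longrightarrow>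
      MM F (Comp A g f) = Comp B (MM F g) (MM F f)"
  shows "funct A B F"
  unfolding funct_def is_functor_def PiE_def using assms by (auto simp: hom_def)

lemma funct_eqI:
  assumes "funct A B F" "funct A B G"
    and "\<And>x. x \<in> Obj A \<Longrightarrow> OM F x = OM G x" and "\<And>f. f \<in> Arr A \<Longrightarrow> MM F f = MM G f"
  shows "F = G"
proof (rule ftor.equality)
  have "OM F \<in> Obj A \<rightarrow>\<^sub>E Obj B" "OM G \<in> Obj A \<rightarrow>\<^sub>E Obj B"
    "MM F \<in> Arr A \<rightarrow>\<^sub>E Arr B" "MM G \<in> Arr A \<rightarrow>\<^sub>E Arr B"
    using assms(1,2) unfolding funct_def is_functor_def by auto
  then show "OM F = OM G" "MM F = MM G"
    using assms(3,4) by (auto simp: PiE_def intro!: extensionalityI)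
qed (use assms(1,2) in auto)

lemma comp_functor_simps [simp]:
  "Src (comp_functor G F) = Src F" "Tgt (comp_functor G F) = Tgt G"
  "x \<in> Obj (Src F) \<Longrightarrow> OM (comp_functor G F) x = OM G (OM F x)"
  "f \<in> Arr (Src F) \<Longrightarrow> MM (comp_functor G F) f = MM G (MM F f)"
  by (auto simp: comp_functor_def compose_def)

lemma id_functor_simps [simp]:
  "Src (id_functor A) = A" "Tgt (id_functor A) = A"
  "x \<in> Obj A \<Longrightarrow> OM (id_functor A) x = x" "f \<in> Arr A \<Longrightarrow> MM (id_functor A) f = f"
  by (auto simp: id_functor_def)

lemma const_functor_simps [simp]:
  "Src (const_functor A B b) = A" "Tgt (const_functor A B b) = B"
  "x \<in> Obj A \<Longrightarrow> OM (const_functor A B b) x = b"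
  "f \<in> Arr A \<Longrightarrow> MM (const_functor A B b) f = Ident B b"
  by (auto simp: const_functor_def)

lemma comp_functor_funct: "funct A B F \<Longrightarrow> funct B C G \<Longrightarrow> funct A C (comp_functor G F)"
proof (rule functI, goal_cases)
  case 6 then show ?case by (auto simp: comp_functor_def compose_def)
next
  case 8 then show ?case by (auto simp: comp_functor_def compose_def)
next
  case (9 x) then show ?case
    using ident_hom[OF funct_cat_src[OF 9(1)] 9(3)] by (simp add: funct_ident funct_obj hom_arr)
next
  case (10 f g)
  then have h: "f \<in> hom A (Dom A f) (Dom A g)" "g \<in> hom A (Dom A g) (Cod A g)"
    by (auto simp: hom_def)
  then have "Comp A g f \<in> Arr A"
    using comp_hom[OF funct_cat_src, OF 10(1) h] by (simp add: hom_arr)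
  moreover have "MM G (Comp B (MM F g) (MM F f)) = Comp C (MM G (MM F g)) (MM G (MM F f))"
    using funct_comp[OF 10(2)] funct_hom[OF 10(1)] h by blast
  ultimately show ?case
    using 10 funct_comp[OF 10(1) h] by simp
next
  case (7 f)
  then have "MM F f \<in> hom B (OM F (Dom A f)) (OM F (Cod A f))"
    by (intro funct_hom[OF 7(1)] arr_hom)
  from funct_hom[OF 7(2) this] show ?case
    using 7 hom_objs[OF funct_cat_src[OF 7(1)] arr_hom[OF 7(3)]] by simp
qed (auto dest: funct_cat_src funct_cat_tgt simp: funct_obj)

lemma id_functor_funct: "category A \<Longrightarrow> funct A A (id_functor A)"
proof (rule functI, goal_cases)
  case (7 f) then show ?case using hom_objs[OF 7(1) arr_hom] arr_hom[OF 7(2)] by simp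
next
  case (10 f g) then show ?case using comp_hom[OF 10(1), of f "Dom A f" "Cod A f" g "Cod A g"]
    by (auto simp: hom_def)
qed (auto simp: id_functor_def ident_hom[THEN hom_arr])

lemma const_functor_funct:
  assumes "category A" "category B" "b \<in> Obj B"
  shows "funct A B (const_functor A B b)"
proof (rule functI, goal_cases)
  case (7 f) then show ?case using hom_objs[OF assms(1) arr_hom] ident_hom[OF assms(2,3)] by simp
next
  case (10 f g) then show ?case
    using comp_hom[OF assms(1), of f "Dom A f" "Cod A f" g "Cod A g"]
      ident_left[OF assms(2) ident_hom[OF assms(2,3)]]
    by (auto simp: hom_def)
qed (auto simp: const_functor_def ident_hom[THEN hom_arr] assms)

lemma comp_functor_assoc:
  assumes "funct A B F" "funct B C G" "funct C E H"
  shows "comp_functor H (comp_functor G F) = comp_functor (comp_functor H G) F"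
  by (rule funct_eqI[of A E]) (use assms in \<open>auto simp: funct_obj funct_arr intro!: comp_functor_funct\<close>)

lemma comp_functor_id:
  assumes "funct A B F"
  shows "comp_functor F (id_functor A) = F" "comp_functor (id_functor B) F = F"
proof -
  note 1 = id_functor_funct[OF funct_cat_src[OF assms]] id_functor_funct[OF funct_cat_tgt[OF assms]]
  show "comp_functor F (id_functor A) = F"
    by (rule funct_eqI[of A B]) (use assms 1 in \<open>auto intro: comp_functor_funct\<close>)
  show "comp_functor (id_functor B) F = F"
    by (rule funct_eqI[of A B])
      (use assms 1 in \<open>auto simp: funct_obj funct_arr intro: comp_functor_funct\<close>)
qed

lemma comp_const_functor:
  assumes "funct A B F" "category C" "c \<in> Obj C"
  shows "comp_functor (const_functor B C c) F = const_functor A C c"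
  by (rule funct_eqI[of A C])
    (use assms in \<open>auto simp: funct_obj funct_arr dest: funct_cat_src funct_cat_tgt
      intro!: comp_functor_funct const_functor_funct\<close>)

lemma comp_functor_const:
  assumes "funct B C F" "category A" "b \<in> Obj B"
  shows "comp_functor F (const_functor A B b) = const_functor A C (OM F b)"
  by (rule funct_eqI[of A C])
    (use assms in \<open>auto simp: funct_obj funct_arr funct_ident dest: funct_cat_src funct_cat_tgt
      intro!: comp_functor_funct const_functor_funct\<close>)

lemma nattD:
  assumes "natt F G \<alpha>" "funct A B F"
  shows "funct A B G"
    and "x \<in> Obj A \<Longrightarrow> NComp \<alpha> x \<in> hom B (OM F x) (OM G x)"
    and "f \<in> hom A x y \<Longrightarrow> Comp B (NComp \<alpha> y) (MM F f) = Comp B (MM G f) (NComp \<alpha> x)"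
    and "NComp \<alpha> \<in> extensional (Obj A)"
  using assms unfolding natt_def is_nat_def funct_def hom_def PiE_def by auto

lemma nattI:
  assumes "funct A B F" "funct A B G" "NSrc \<alpha> = F" "NTgt \<alpha> = G"
    and "\<And>x. x \<in> Obj A \<Longrightarrow> NComp \<alpha> x \<in> hom B (OM F x) (OM G x)"
    and "NComp \<alpha> \<in> extensional (Obj A)"
    and "\<And>f. f \<in> Arr A \<Longrightarrow>
      Comp B (NComp \<alpha> (Cod A f)) (MM F f) = Comp B (MM G f) (NComp \<alpha> (Dom A f))"
  shows "natt F G \<alpha>"
  using assms unfolding natt_def is_nat_def funct_def hom_def PiE_def by auto

lemma natt_eqI:
  assumes "natt F G \<alpha>" "natt F G \<beta>" "funct A B F"
    and "\<And>x. x \<in> Obj A \<Longrightarrow> NComp \<alpha> x = NComp \<beta> x"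
  shows "\<alpha> = \<beta>"
proof (rule ntrans.equality)
  show "NComp \<alpha> = NComp \<beta>"
    using nattD(4)[OF assms(1,3)] nattD(4)[OF assms(2,3)] assms(4) by (rule extensionalityI)
qed (use assms in \<open>auto simp: natt_def\<close>)

lemma id_nat_simps [simp]:
  "NSrc (id_nat F) = F" "NTgt (id_nat F) = F"
  "x \<in> Obj (Src F) \<Longrightarrow> NComp (id_nat F) x = Ident (Tgt F) (OM F x)"
  by (auto simp: id_nat_def)

lemma id_nat_natt: assumes F: "funct A B F" shows "natt F F (id_nat F)"
proof (rule nattI[OF F F], goal_cases)
  case (5 f)
  then have f: "f \<in> hom A (Dom A f) (Cod A f)" by (simp add: arr_hom)
  then have "Dom A f \<in> Obj A" "Cod A f \<in> Obj A"
    using hom_objs[OF funct_cat_src[OF F]] by auto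
  then show ?case
    using funct_hom[OF F f] ident_left[OF funct_cat_tgt[OF F]] ident_right[OF funct_cat_tgt[OF F]] F
    by simp
qed (use F in \<open>auto simp: id_nat_def funct_obj ident_hom funct_cat_tgt\<close>)

lemma hcomp_simps [simp]:
  "NSrc (hcomp \<beta> \<alpha>) = comp_functor (NSrc \<beta>) (NSrc \<alpha>)"
  "NTgt (hcomp \<beta> \<alpha>) = comp_functor (NTgt \<beta>) (NTgt \<alpha>)"
  "x \<in> Obj (Src (NSrc \<alpha>)) \<Longrightarrow> NComp (hcomp \<beta> \<alpha>) x =
    Comp (Tgt (NSrc \<beta>)) (NComp \<beta> (OM (NTgt \<alpha>) x)) (MM (NSrc \<beta>) (NComp \<alpha> x))"
  by (auto simp: hcomp_def)

lemma hcomp_natt: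
  assumes \<alpha>: "natt F G \<alpha>" and F: "funct A B F" and \<beta>: "natt H K \<beta>" and H: "funct B C H"
  shows "natt (comp_functor H F) (comp_functor K G) (hcomp \<beta> \<alpha>)"
proof -
  note G = nattD(1)[OF \<alpha> F] and K = nattD(1)[OF \<beta> H]
  have s: "NSrc \<alpha> = F" "NTgt \<alpha> = G" "NSrc \<beta> = H" "NTgt \<beta> = K"
    using \<alpha> \<beta> by (auto simp: natt_def)
  note C = funct_cat_tgt[OF H]
  have c: "NComp (hcomp \<beta> \<alpha>) x \<in> hom C (OM H (OM F x)) (OM K (OM G x))"
    "NComp (hcomp \<beta> \<alpha>) x = Comp C (NComp \<beta> (OM G x)) (MM H (NComp \<alpha> x))" if "x \<in> Obj A" for x
    using that s F H comp_hom[OF C funct_hom[OF H nattD(2)[OF \<alpha> F that]]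
        nattD(2)[OF \<beta> H funct_obj[OF G that]]] by auto
  show ?thesis
  proof (rule nattI[OF comp_functor_funct[OF F H] comp_functor_funct[OF G K]], goal_cases)
    case (5 f)
    then have f: "f \<in> hom A (Dom A f) (Cod A f)" by (simp add: arr_hom)
    let ?x = "Dom A f" and ?y = "Cod A f"
    have o: "?x \<in> Obj A" "?y \<in> Obj A"
      using hom_objs[OF funct_cat_src[OF F] f] by auto
    note Ff = funct_hom[OF F f] and Gf = funct_hom[OF G f]
    note ax = nattD(2)[OF \<alpha> F o(1)] and ay = nattD(2)[OF \<alpha> F o(2)]
    note bx = nattD(2)[OF \<beta> H funct_obj[OF G o(1)]] and b_y = nattD(2)[OF \<beta> H funct_obj[OF G o(2)]]
    have "Comp C (Comp C (NComp \<beta> (OM G ?y)) (MM H (NComp \<alpha> ?y))) (MM H (MM F f))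
       = Comp C (NComp \<beta> (OM G ?y)) (MM H (Comp B (NComp \<alpha> ?y) (MM F f)))"
      using comp_assoc[OF C funct_hom[OF H Ff] funct_hom[OF H ay] b_y] funct_comp[OF H Ff ay] by simp
    also have "\<dots> = Comp C (NComp \<beta> (OM G ?y)) (MM H (Comp B (MM G f) (NComp \<alpha> ?x)))"
      using nattD(3)[OF \<alpha> F f] by simp
    also have "\<dots> = Comp C (Comp C (NComp \<beta> (OM G ?y)) (MM H (MM G f))) (MM H (NComp \<alpha> ?x))"
      using comp_assoc[OF C funct_hom[OF H ax] funct_hom[OF H Gf] b_y] funct_comp[OF H ax Gf] by simp
    also have "\<dots> = Comp C (Comp C (MM K (MM G f)) (NComp \<beta> (OM G ?x))) (MM H (NComp \<alpha> ?x))"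
      using nattD(3)[OF \<beta> H Gf] by simp
    also have "\<dots> = Comp C (MM K (MM G f)) (Comp C (NComp \<beta> (OM G ?x)) (MM H (NComp \<alpha> ?x)))"
      using comp_assoc[OF C funct_hom[OF H ax] bx funct_hom[OF K Gf]] by simp
    finally show ?case
      using c(2)[OF o(1)] c(2)[OF o(2)] 5 F G by simp
  qed (use F G s c(1) in \<open>auto simp: hcomp_def\<close>)
qed

text \<open>Whiskering is expressed as horizontal composition with an identity because a
  prederivator is required to preserve \<open>hcomp\<close> and \<open>id_nat\<close>.\<close>

lemma hcomp_id_left:
  assumes "natt F G \<alpha>" "funct A B F" "funct B C H" "x \<in> Obj A"
  shows "NComp (hcomp (id_nat H) \<alpha>) x = MM H (NComp \<alpha> x)"
proof -
  have "NSrc \<alpha> = F" "NTgt \<alpha> = G"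
    using assms(1) by (auto simp: natt_def)
  then show ?thesis
    using assms nattD(1)[OF assms(1,2)] funct_hom[OF assms(3) nattD(2)[OF assms(1,2,4)]]
      ident_left[OF funct_cat_tgt[OF assms(3)]]
    by (simp add: funct_obj)
qed

lemma hcomp_id_right:
  assumes "natt F G \<alpha>" "funct A B F" "funct A' A S" "x \<in> Obj A'"
  shows "NComp (hcomp \<alpha> (id_nat S)) x = NComp \<alpha> (OM S x)"
proof -
  have "NSrc \<alpha> = F" "NTgt \<alpha> = G"
    using assms(1) by (auto simp: natt_def)
  then show ?thesis
    using assms nattD(2)[OF assms(1,2) funct_obj[OF assms(3,4)]] funct_obj[OF assms(3,4)]
      ident_right[OF funct_cat_tgt[OF assms(2)]]
    by (simp add: funct_ident)
qed

text \<open>This makes \<open>(N, g)\<close> an initial object of the comma category of arrows from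
  \<open>M\<close> to \<open>R\<close>: \<open>N\<close> behaves like the value at \<open>M\<close>
  of a left adjoint of \<open>R\<close>, with unit component \<open>g\<close>, without such an
  adjoint being given.\<close>

definition univ_arr ::
    "('p, 'n, 'o, 'm) ftor \<Rightarrow> 'o \<Rightarrow> 'p \<Rightarrow> 'm \<Rightarrow> bool" where
  "univ_arr R M N g \<longleftrightarrow> N \<in> Obj (Src R) \<and> g \<in> hom (Tgt R) M (OM R N) \<and>
     (\<forall>E\<in>Obj (Src R). \<forall>h\<in>hom (Tgt R) M (OM R E).
        \<exists>!f. f \<in> hom (Src R) N E \<and> Comp (Tgt R) (MM R f) g = h)"

lemma univ_arr_ex:
  assumes "univ_arr R M N g" "funct A B R" "E \<in> Obj A" "h \<in> hom B M (OM R E)"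
  obtains f where "f \<in> hom A N E" "Comp B (MM R f) g = h"
proof -
  have "\<exists>!f. f \<in> hom A N E \<and> Comp B (MM R f) g = h"
    using assms unfolding univ_arr_def by simp
  then show thesis using that by blast
qed

lemma univ_arr_unique:
  assumes "univ_arr R M N g" "funct A B R" "f \<in> hom A N E" "f' \<in> hom A N E"
    "Comp B (MM R f) g = Comp B (MM R f') g"
  shows "f = f'"
proof -
  have "E \<in> Obj A"
    using hom_objs[OF funct_cat_src[OF assms(2)] assms(3)] by simp
  moreover have "Comp B (MM R f) g \<in> hom B M (OM R E)"
    using assms(1,2) unfolding univ_arr_def
    by (auto intro!: comp_hom[OF funct_cat_tgt[OF assms(2)]] funct_hom[OF assms(2,3)])
  ultimately have "\<exists>!k. k \<in> hom A N E \<and> Comp B (MM R k) g = Comp B (MM R f) g"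
    using assms(1,2) unfolding univ_arr_def by auto
  then show ?thesis using assms(3-5) by auto
qed

text \<open>Precomposition with \<open>f\<close> matches the arrows out of \<open>N'\<close> with
  those out of \<open>N\<close>, so both factorization problems have the same solutions.
  Isomorphisms supplied by (Der4) or by a counit are absorbed into universal arrows in this
  way.\<close>

lemma univ_arr_iso_cod:
  assumes u: "univ_arr R M N g" and R: "funct A B R" and f: "iso_arr A f" "f \<in> hom A N N'"
  shows "univ_arr R M N' (Comp B (MM R f) g)"
proof -
  note A = funct_cat_src[OF R] and B = funct_cat_tgt[OF R]
  obtain k where k: "k \<in> hom A N' N" "Comp A k f = Ident A N" "Comp A f k = Ident A N'"
    using iso_arrE[OF f] by blast
  have g: "g \<in> hom B M (OM R N)" using u R by (auto simp: univ_arr_def)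
  show ?thesis
    unfolding univ_arr_def
  proof (intro conjI ballI)
    show "N' \<in> Obj (Src R)" using hom_objs[OF A f(2)] R by simp
    show "Comp B (MM R f) g \<in> hom (Tgt R) M (OM R N')"
      using comp_hom[OF B g funct_hom[OF R f(2)]] R by simp
    fix E h assume "E \<in> Obj (Src R)" "h \<in> hom (Tgt R) M (OM R E)"
    then obtain d where d: "d \<in> hom A N E" "Comp B (MM R d) g = h"
      using univ_arr_ex[OF u R] R by auto
    show "\<exists>!d. d \<in> hom (Src R) N' E \<and> Comp (Tgt R) (MM R d) (Comp B (MM R f) g) = h"
    proof (rule ex1I[of _ "Comp A d k"])
      have "Comp B (MM R (Comp A d k)) (Comp B (MM R f) g)
        = Comp B (MM R (Comp A (Comp A d k) f)) g"
        using comp_assoc[OF B g funct_hom[OF R f(2)] funct_hom[OF R comp_hom[OF A k(1) d(1)]]]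
          funct_comp[OF R f(2) comp_hom[OF A k(1) d(1)]] by simp
      also have "Comp A (Comp A d k) f = d"
        using comp_assoc[OF A f(2) k(1) d(1)] k(2) ident_right[OF A d(1)] by simp
      finally show "Comp A d k \<in> hom (Src R) N' E \<and>
          Comp (Tgt R) (MM R (Comp A d k)) (Comp B (MM R f) g) = h"
        using d comp_hom[OF A k(1) d(1)] R by simp
    next
      fix e assume "e \<in> hom (Src R) N' E \<and> Comp (Tgt R) (MM R e) (Comp B (MM R f) g) = h"
      then have e: "e \<in> hom A N' E" "Comp B (MM R e) (Comp B (MM R f) g) = h" using R by auto
      then have "Comp B (MM R (Comp A e f)) g = h"
        using comp_assoc[OF B g funct_hom[OF R f(2)] funct_hom[OF R e(1)]]
          funct_comp[OF R f(2) e(1)] by simp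
      then have "Comp A e f = d"
        using univ_arr_unique[OF u R comp_hom[OF A f(2) e(1)] d(1)] d(2) by simp
      then show "e = Comp A d k"
        using comp_assoc[OF A k(1) f(2) e(1)] k(3) ident_right[OF A e(1)] by simp
    qed
  qed
qed

text \<open>Precomposition with \<open>e\<close> matches the arrows out of \<open>M\<close> with
  those out of \<open>M'\<close>. With an inverse in the place of \<open>e\<close> it cancels an
  invertible first factor of a universal arrow.\<close>

lemma univ_arr_iso_dom:
  assumes u: "univ_arr R M N g" and R: "funct A B R" and e: "iso_arr B e" "e \<in> hom B M' M"
  shows "univ_arr R M' N (Comp B g e)"
proof -
  note A = funct_cat_src[OF R] and B = funct_cat_tgt[OF R]
  obtain k where k: "k \<in> hom B M M'" "Comp B k e = Ident B M'" "Comp B e k = Ident B M"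
    using iso_arrE[OF e] by blast
  have g: "g \<in> hom B M (OM R N)" using u R by (auto simp: univ_arr_def)
  show ?thesis
    unfolding univ_arr_def
  proof (intro conjI ballI)
    show "N \<in> Obj (Src R)" using u by (simp add: univ_arr_def)
    show "Comp B g e \<in> hom (Tgt R) M' (OM R N)"
      using comp_hom[OF B e(2) g] R by simp
    fix E h assume E: "E \<in> Obj (Src R)" and "h \<in> hom (Tgt R) M' (OM R E)"
    then have h: "h \<in> hom B M' (OM R E)" using R by simp
    then obtain d where d: "d \<in> hom A N E" "Comp B (MM R d) g = Comp B h k"
      using univ_arr_ex[OF u R _ comp_hom[OF B k(1) h]] E R by auto
    show "\<exists>!d. d \<in> hom (Src R) N E \<and> Comp (Tgt R) (MM R d) (Comp B g e) = h"
    proof (rule ex1I[of _ d])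
      have "Comp B (MM R d) (Comp B g e) = Comp B (Comp B h k) e"
        using comp_assoc[OF B e(2) g funct_hom[OF R d(1)]] d(2) by simp
      also have "\<dots> = h"
        using comp_assoc[OF B e(2) k(1) h] k(2) ident_right[OF B h] by simp
      finally show "d \<in> hom (Src R) N E \<and> Comp (Tgt R) (MM R d) (Comp B g e) = h"
        using d R by simp
    next
      fix d' assume "d' \<in> hom (Src R) N E \<and> Comp (Tgt R) (MM R d') (Comp B g e) = h"
      then have d': "d' \<in> hom A N E" "Comp B (MM R d') (Comp B g e) = h" using R by auto
      then have "Comp B (Comp B (MM R d') g) e = h"
        using comp_assoc[OF B e(2) g funct_hom[OF R d'(1)]] by simp
      then have "Comp B h k = Comp B (MM R d') g"
        using comp_assoc[OF B k(1) e(2) comp_hom[OF B g funct_hom[OF R d'(1)]]] k(3)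
          ident_right[OF B comp_hom[OF B g funct_hom[OF R d'(1)]]] by simp
      then show "d' = d"
        using univ_arr_unique[OF u R d'(1) d(1)] d(2) by simp
    qed
  qed
qed

text \<open>Each of the two universal arrows factors through the other, and uniqueness makes the
  factorizations mutually inverse.\<close>

lemma univ_arr_iso:
  assumes u: "univ_arr R M N g" and v: "univ_arr R M N' g'" and R: "funct A B R"
    and f: "f \<in> hom A N N'" "Comp B (MM R f) g = g'"
  shows "iso_arr A f"
proof -
  note A = funct_cat_src[OF R] and B = funct_cat_tgt[OF R]
  have g: "N \<in> Obj A" "g \<in> hom B M (OM R N)" using u R by (auto simp: univ_arr_def)
  have g': "N' \<in> Obj A" "g' \<in> hom B M (OM R N')" using v R by (auto simp: univ_arr_def)
  obtain k where k: "k \<in> hom A N' N" "Comp B (MM R k) g' = g"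
    using univ_arr_ex[OF v R g] .
  have "Comp B (MM R (Comp A k f)) g = g"
    using comp_assoc[OF B g(2) funct_hom[OF R f(1)] funct_hom[OF R k(1)]] funct_comp[OF R f(1) k(1)]
      f(2) k(2) by simp
  then have "Comp A k f = Ident A N"
    using univ_arr_unique[OF u R comp_hom[OF A f(1) k(1)] ident_hom[OF A g(1)]]
      ident_left[OF B g(2)] funct_ident[OF R g(1)] by simp
  moreover have "Comp B (MM R (Comp A f k)) g' = g'"
    using comp_assoc[OF B g'(2) funct_hom[OF R k(1)] funct_hom[OF R f(1)]]
      funct_comp[OF R k(1) f(1)] f(2) k(2) by simp
  then have "Comp A f k = Ident A N'"
    using univ_arr_unique[OF v R comp_hom[OF A k(1) f(1)] ident_hom[OF A g'(1)]]
      ident_left[OF B g'(2)] funct_ident[OF R g'(1)] by simp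
  ultimately show ?thesis using f(1) k(1) by (intro iso_arrI)
qed

text \<open>Compatibility of the bijections with composition is demanded only at \<open>g\<close>:
  universality of \<open>g\<close> concerns the map sending \<open>f\<close> to the composite of
  \<open>R f\<close> with \<open>g\<close>, and \<open>eq\<close> says that \<Phi> carries it to the
  corresponding map for \<open>\<Phi> g\<close>.\<close>

lemma univ_arr_transport:
  assumes R: "funct A B R" and R': "funct A B' R'" and N: "N \<in> Obj A" and g: "g \<in> hom B M (OM R N)"
    and bij: "\<And>E. E \<in> Obj A \<Longrightarrow> bij_betw \<Phi> (hom B M (OM R E)) (hom B' M' (OM R' E))"
    and eq: "\<And>f E. f \<in> hom A N E \<Longrightarrow> \<Phi> (Comp B (MM R f) g) = Comp B' (MM R' f) (\<Phi> g)"
  shows "univ_arr R M N g \<longleftrightarrow> univ_arr R' M' N (\<Phi> g)"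
proof -
  note A = funct_cat_src[OF R] and B = funct_cat_tgt[OF R]
  have "(\<forall>h\<in>hom B M (OM R E). \<exists>!f. f \<in> hom A N E \<and> Comp B (MM R f) g = h) \<longleftrightarrow>
      (\<forall>h\<in>hom B' M' (OM R' E). \<exists>!f. f \<in> hom A N E \<and> Comp B' (MM R' f) (\<Phi> g) = h)"
    if E: "E \<in> Obj A" for E
  proof -
    note inj = bij_betw_imp_inj_on[OF bij[OF E]]
    have "(f \<in> hom A N E \<and> Comp B' (MM R' f) (\<Phi> g) = \<Phi> h) \<longleftrightarrow>
        (f \<in> hom A N E \<and> Comp B (MM R f) g = h)" if "h \<in> hom B M (OM R E)" for f h
      using eq[of f E] inj_onD[OF inj, of "Comp B (MM R f) g" h] that
        comp_hom[OF B g funct_hom[OF R, of f N E]] by auto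
    then have "(\<forall>h\<in>\<Phi> ` hom B M (OM R E). \<exists>!f. f \<in> hom A N E \<and> Comp B' (MM R' f) (\<Phi> g) = h) \<longleftrightarrow>
      (\<forall>h\<in>hom B M (OM R E). \<exists>!f. f \<in> hom A N E \<and> Comp B (MM R f) g = h)"
      by simp
    then show ?thesis
      using bij_betw_imp_surj_on[OF bij[OF E]] by simp
  qed
  moreover have "\<Phi> g \<in> hom B' M' (OM R' N)"
    using bij_betwE[OF bij[OF N]] g by blast
  ultimately show ?thesis
    unfolding univ_arr_def using N g R R' by (simp cong: ball_cong)
qed

text \<open>Factoring the identity of \<open>M\<close> through \<open>g\<close> gives a left
  inverse; uniqueness of factorizations makes it a right inverse.\<close>

lemma univ_arr_id_iso:
  assumes "category A" "univ_arr (id_functor A) M N g"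
  shows "iso_arr A g"
proof -
  note I = id_functor_funct[OF assms(1)]
  have N: "N \<in> Obj A" "g \<in> hom A M N"
    using assms(2) by (auto simp: univ_arr_def)
  then have M: "M \<in> Obj A" using hom_objs[OF assms(1)] by blast
  obtain k where k: "k \<in> hom A N M" "Comp A k g = Ident A M"
    using univ_arr_ex[OF assms(2) I M] ident_hom[OF assms(1) M] M by (auto simp: hom_arr)
  have "Comp A (Comp A g k) g = g"
    using comp_assoc[OF assms(1) N(2) k(1) N(2)] k(2) ident_right[OF assms(1) N(2)] by simp
  then have "Comp A g k = Ident A N"
    using univ_arr_unique[OF assms(2) I comp_hom[OF assms(1) k(1) N(2)] ident_hom[OF assms(1) N(1)]]
      ident_left[OF assms(1) N(2)] comp_hom[OF assms(1) k(1) N(2)] ident_hom[OF assms(1) N(1)]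
    by (simp add: hom_arr)
  then show ?thesis using k N by (intro iso_arrI)
qed

section \<open>Adjunctions as a source of universal arrows\<close>

context
  fixes L :: "('o, 'm, 'p, 'n) ftor" and R and \<eta> \<epsilon> and A B
  assumes adj: "adjunction L R \<eta> \<epsilon>" and R: "funct A B R"
begin

lemma adjunction_functs: "funct B A L" "natt (id_functor B) (comp_functor R L) \<eta>"
    "natt (comp_functor L R) (id_functor A) \<epsilon>"
proof -
  show L: "funct B A L"
    using adj R unfolding adjunction_def funct_def by auto
  show "natt (id_functor B) (comp_functor R L) \<eta>" "natt (comp_functor L R) (id_functor A) \<epsilon>"
    using adj unfolding adjunction_def natt_def funct_src[OF L] funct_tgt[OF L] by blast+
qed

lemma unit_hom: "x \<in> Obj B \<Longrightarrow> NComp \<eta> x \<in> hom B x (OM R (OM L x))"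
  using nattD(2)[OF adjunction_functs(2) id_functor_funct[OF funct_cat_tgt[OF R]]]
    adjunction_functs(1) by simp

lemma counit_hom: "y \<in> Obj A \<Longrightarrow> NComp \<epsilon> y \<in> hom A (OM L (OM R y)) y"
  using nattD(2)[OF adjunction_functs(3) comp_functor_funct[OF R adjunction_functs(1)]] R by simp

lemma triangles:
  "x \<in> Obj B \<Longrightarrow> Comp A (NComp \<epsilon> (OM L x)) (MM L (NComp \<eta> x)) = Ident A (OM L x)"
  "y \<in> Obj A \<Longrightarrow> Comp B (MM R (NComp \<epsilon> y)) (NComp \<eta> (OM R y)) = Ident B (OM R y)"
  using adj unfolding adjunction_def funct_src[OF adjunction_functs(1)]
    funct_tgt[OF adjunction_functs(1)] by blast+

text \<open>Rests on the triangle identity at \<open>R\<close>. It is kept apart from universality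
  because it also identifies the transpose of the canonical map in (Der4).\<close>

lemma adjunction_transpose:
  assumes M: "M \<in> Obj B" and E: "E \<in> Obj A" and h: "h \<in> hom B M (OM R E)"
  shows "Comp B (MM R (Comp A (NComp \<epsilon> E) (MM L h))) (NComp \<eta> M) = h"
proof -
  note L = adjunction_functs(1) and \<eta> = adjunction_functs(2)
  note A = funct_cat_src[OF R] and B = funct_cat_tgt[OF R]
  note Lh = funct_hom[OF L h]
  have "Comp B (MM R (Comp A (NComp \<epsilon> E) (MM L h))) (NComp \<eta> M) =
      Comp B (MM R (NComp \<epsilon> E)) (Comp B (MM R (MM L h)) (NComp \<eta> M))"
    using funct_comp[OF R Lh counit_hom[OF E]]
      comp_assoc[OF B unit_hom[OF M] funct_hom[OF R Lh] funct_hom[OF R counit_hom[OF E]]] by simp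
  also have "Comp B (MM R (MM L h)) (NComp \<eta> M) = Comp B (NComp \<eta> (OM R E)) h"
    using nattD(3)[OF \<eta> id_functor_funct[OF B] h] h L by (simp add: hom_arr)
  also have "Comp B (MM R (NComp \<epsilon> E)) (Comp B (NComp \<eta> (OM R E)) h) = h"
    using comp_assoc[OF B h unit_hom funct_hom[OF R counit_hom[OF E]]] triangles(2)[OF E]
      ident_left[OF B h] funct_obj[OF R E] by simp
  finally show ?thesis .
qed

text \<open>Existence is \<open>adjunction_transpose\<close>; uniqueness comes from naturality of
  the counit and the triangle identity at \<open>L\<close>.\<close>

lemma adjunction_universal:
  assumes M: "M \<in> Obj B"
  shows "univ_arr R M (OM L M) (NComp \<eta> M)"
proof -
  note L = adjunction_functs(1) and \<epsilon> = adjunction_functs(3)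
  note A = funct_cat_src[OF R] and B = funct_cat_tgt[OF R]
  note h\<eta> = unit_hom and h\<epsilon> = counit_hom
  show ?thesis
    unfolding univ_arr_def
  proof (intro conjI ballI)
    show "OM L M \<in> Obj (Src R)" using funct_obj[OF L M] R by simp
    show "NComp \<eta> M \<in> hom (Tgt R) M (OM R (OM L M))" using h\<eta>[OF M] R by simp
    fix E h assume "E \<in> Obj (Src R)" "h \<in> hom (Tgt R) M (OM R E)"
    then have E: "E \<in> Obj A" and h: "h \<in> hom B M (OM R E)" using R by auto
    note Lh = funct_hom[OF L h]
    let ?f = "Comp A (NComp \<epsilon> E) (MM L h)"
    have f: "?f \<in> hom A (OM L M) E" by (rule comp_hom[OF A Lh h\<epsilon>[OF E]])
    show "\<exists>!f. f \<in> hom (Src R) (OM L M) E \<and> Comp (Tgt R) (MM R f) (NComp \<eta> M) = h"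
    proof (rule ex1I[of _ ?f])
      show "?f \<in> hom (Src R) (OM L M) E \<and> Comp (Tgt R) (MM R ?f) (NComp \<eta> M) = h"
        using f R adjunction_transpose[OF M E h] by simp
    next
      fix d assume "d \<in> hom (Src R) (OM L M) E \<and> Comp (Tgt R) (MM R d) (NComp \<eta> M) = h"
      then have d: "d \<in> hom A (OM L M) E" and h': "h = Comp B (MM R d) (NComp \<eta> M)" using R by auto
      note Rd = funct_hom[OF R d]
      have "?f = Comp A (NComp \<epsilon> E) (Comp A (MM L (MM R d)) (MM L (NComp \<eta> M)))"
        using funct_comp[OF L h\<eta>[OF M] Rd] h' by simp
      also have "\<dots> = Comp A (Comp A (NComp \<epsilon> E) (MM L (MM R d))) (MM L (NComp \<eta> M))"
        using comp_assoc[OF A funct_hom[OF L h\<eta>[OF M]] funct_hom[OF L Rd] h\<epsilon>[OF E]] by simp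
      also have "Comp A (NComp \<epsilon> E) (MM L (MM R d)) = Comp A d (NComp \<epsilon> (OM L M))"
        using nattD(3)[OF \<epsilon> comp_functor_funct[OF R L] d] d R by (simp add: hom_arr)
      also have "Comp A (Comp A d (NComp \<epsilon> (OM L M))) (MM L (NComp \<eta> M)) = d"
        using comp_assoc[OF A funct_hom[OF L h\<eta>[OF M]] h\<epsilon> d] triangles(1)[OF M] ident_right[OF A d]
          funct_obj[OF L M] by simp
      finally show "d = ?f" by simp
    qed
  qed
qed

end

section \<open>Copies inside the universe\<close>

text \<open>The first argument names the universe, which the type of \<open>K\<close> does not
  mention. The two bounds guarantee that the injections chosen by \<open>enc\<close> exist, so that
  \<open>cp K\<close> really is a copy of \<open>K\<close>.\<close>

definition small_in :: "'u itself \<Rightarrow> ('o, 'm) cat \<Rightarrow> bool" where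
  "small_in _ K \<longleftrightarrow> category K \<and> Obj K \<prec> (UNIV :: 'u set) \<and> Arr K \<prec> (UNIV :: 'u set)"

lemma small_inD:
  assumes "small_in TYPE('u) K"
  shows "category K" "Obj K \<prec> (UNIV :: 'u set)" "Arr K \<prec> (UNIV :: 'u set)"
  using assms by (auto simp: small_in_def)

lemma enc_inj: "S \<prec> (UNIV :: 'u set) \<Longrightarrow> inj_on (enc S :: 'a \<Rightarrow> 'u) S"
  unfolding enc_def lesspoll_def lepoll_def by (metis (mono_tags, lifting) someI_ex)

lemma dec_enc [simp]: "S \<prec> (UNIV :: 'u set) \<Longrightarrow> x \<in> S \<Longrightarrow> dec S (enc S x :: 'u) = x"
  unfolding dec_def using enc_inj by (auto intro: inv_into_f_f)

lemma cp_obj: "Obj (cp K) = enc (Obj K) ` Obj K"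
  and cp_arr: "Arr (cp K) = enc (Arr K) ` Arr K"
  by (simp_all add: cp_def)

context
  fixes K :: "('o, 'm) cat"
  assumes K: "small_in TYPE('u) K"
begin

lemma cp_simps:
  "x \<in> Obj K \<Longrightarrow> Ident (cp K :: 'u scat) (enc (Obj K) x) = enc (Arr K) (Ident K x)"
  "f \<in> Arr K \<Longrightarrow> Dom (cp K :: 'u scat) (enc (Arr K) f) = enc (Obj K) (Dom K f)"
  "f \<in> Arr K \<Longrightarrow> Cod (cp K :: 'u scat) (enc (Arr K) f) = enc (Obj K) (Cod K f)"
  "f \<in> Arr K \<Longrightarrow> g \<in> Arr K \<Longrightarrow>
    Comp (cp K :: 'u scat) (enc (Arr K) g) (enc (Arr K) f) = enc (Arr K) (Comp K g f)"
  using small_inD[OF K] by (simp_all add: cp_def)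

lemma cp_category: "category (cp K :: 'u scat)"
proof -
  note C = small_inD[OF K]
  have inj: "enc (Obj K) x = (enc (Obj K) y :: 'u) \<longleftrightarrow> x = y" if "x \<in> Obj K" "y \<in> Obj K" for x y
    using enc_inj[OF C(2)] that by (auto dest: inj_onD)
  have D: "Dom K f \<in> Obj K" "Cod K f \<in> Obj K" if "f \<in> Arr K" for f
    using C(1) that by (auto simp: category_def)
  have I: "Ident K x \<in> Arr K" "Dom K (Ident K x) = x" "Cod K (Ident K x) = x" if "x \<in> Obj K" for x
    using C(1) that by (auto simp: category_def)
  have M: "Comp K g f \<in> Arr K" "Dom K (Comp K g f) = Dom K f" "Cod K (Comp K g f) = Cod K g"
    if "f \<in> Arr K" "g \<in> Arr K" "Dom K g = Cod K f" for f g
    using C(1) that by (auto simp: category_def)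
  have A: "Comp K h (Comp K g f) = Comp K (Comp K h g) f"
    if "f \<in> Arr K" "g \<in> Arr K" "h \<in> Arr K" "Dom K g = Cod K f" "Dom K h = Cod K g" for f g h
    using C(1) that by (auto simp: category_def)
  have U: "Comp K f (Ident K (Dom K f)) = f" "Comp K (Ident K (Cod K f)) f = f" if "f \<in> Arr K" for f
    using C(1) that by (auto simp: category_def)
  show ?thesis
  proof (rule categoryI, goal_cases)
    case (1 f) then show ?case by (auto simp: cp_obj cp_arr cp_simps D)
  next
    case (2 x) then show ?case by (auto simp: cp_obj cp_arr cp_simps I)
  next
    case (3 f g) then show ?case by (auto simp: cp_arr cp_simps inj M D)
  next
    case (4 f) then show ?case by (auto simp: cp_arr cp_simps U D I)
  next
    case (5 f g h) then show ?case by (auto simp: cp_arr cp_simps inj M D A)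
  qed
qed

lemma cp_small: "small_cat (cp K :: 'u scat)"
  unfolding small_cat_def small_def cp_obj cp_arr
  using cp_category small_inD[OF K] by (meson image_lepoll lesspoll_trans1)

lemma cp_to_simps:
  "Src (cp_to K :: ('o, 'm, 'u, 'u) ftor) = K" "Tgt (cp_to K :: ('o, 'm, 'u, 'u) ftor) = cp K"
  "x \<in> Obj K \<Longrightarrow> OM (cp_to K :: ('o, 'm, 'u, 'u) ftor) x = enc (Obj K) x"
  "f \<in> Arr K \<Longrightarrow> MM (cp_to K :: ('o, 'm, 'u, 'u) ftor) f = enc (Arr K) f"
  by (auto simp: cp_to_def)

lemma cp_from_simps:
  "Src (cp_from K :: ('u, 'u, 'o, 'm) ftor) = cp K" "Tgt (cp_from K :: ('u, 'u, 'o, 'm) ftor) = K"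
  "x \<in> Obj K \<Longrightarrow> OM (cp_from K :: ('u, 'u, 'o, 'm) ftor) (enc (Obj K) x) = x"
  "f \<in> Arr K \<Longrightarrow> MM (cp_from K :: ('u, 'u, 'o, 'm) ftor) (enc (Arr K) f) = f"
  using small_inD[OF K] by (auto simp: cp_from_def cp_obj cp_arr)

lemma cp_to_funct: "funct K (cp K) (cp_to K :: ('o, 'm, 'u, 'u) ftor)"
proof (rule functI, goal_cases)
  case (7 f) then show ?case using hom_objs[OF small_inD(1)[OF K] arr_hom[OF 7]]
    by (auto simp: hom_def cp_to_simps cp_simps cp_arr)
next
  case (9 x) then show ?case using ident_hom[OF small_inD(1)[OF K] 9]
    by (auto simp: hom_def cp_to_simps cp_simps)
next
  case (10 f g) then show ?case using comp_hom[OF small_inD(1)[OF K], of f _ _ g]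
    by (auto simp: hom_def cp_to_simps cp_simps)
qed (auto simp: cp_to_simps cp_category small_inD[OF K] cp_obj, auto simp: cp_to_def)

lemma cp_from_funct: "funct (cp K) K (cp_from K :: ('u, 'u, 'o, 'm) ftor)"
proof (rule functI, goal_cases)
  case (7 f)
  then obtain f' where f: "f' \<in> Arr K" "f = enc (Arr K) f'" by (auto simp: cp_arr)
  then show ?case using hom_objs[OF small_inD(1)[OF K] arr_hom[OF f(1)]]
    by (auto simp: hom_def cp_from_simps cp_simps cp_arr)
next
  case (9 x)
  then obtain x' where x: "x' \<in> Obj K" "x = enc (Obj K) x'" by (auto simp: cp_obj)
  then show ?case using ident_hom[OF small_inD(1)[OF K] x(1)]
    by (auto simp: hom_def cp_from_simps cp_simps)
next
  case (10 f g)
  then obtain f' g' where f: "f' \<in> Arr K" "f = enc (Arr K) f'" "g' \<in> Arr K" "g = enc (Arr K) g'"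
    by (auto simp: cp_arr)
  \<comment> \<open>Composability is known only for the codes; injectivity of \<open>enc\<close>
    brings it back to \<open>K\<close>.\<close>
  moreover have "Dom K g' = Cod K f'"
    using 10 f inj_onD[OF enc_inj[OF small_inD(2)[OF K]], of "Dom K g'" "Cod K f'"]
      hom_objs[OF small_inD(1)[OF K] arr_hom[OF f(1)]] hom_objs[OF small_inD(1)[OF K] arr_hom[OF f(3)]]
    by (auto simp: cp_simps)
  ultimately show ?case using comp_hom[OF small_inD(1)[OF K], of f' _ _ g']
    by (auto simp: hom_def cp_from_simps cp_simps)
qed (auto simp: cp_from_simps cp_category small_inD[OF K] cp_obj, auto simp: cp_from_def cp_obj)

lemma cp_from_to: "comp_functor (cp_from K) (cp_to K :: ('o, 'm, 'u, 'u) ftor) = id_functor K"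
  by (rule funct_eqI[OF comp_functor_funct[OF cp_to_funct cp_from_funct]
        id_functor_funct[OF small_inD(1)[OF K]]])
    (auto simp: cp_to_simps cp_from_simps)

lemma cp_to_from: "comp_functor (cp_to K) (cp_from K :: ('u, 'u, 'o, 'm) ftor) = id_functor (cp K)"
  by (rule funct_eqI[OF comp_functor_funct[OF cp_from_funct cp_to_funct]
        id_functor_funct[OF cp_category]])
    (auto simp: cp_to_simps cp_from_simps cp_obj cp_arr)

lemma cp_functor_id: "cp_functor (id_functor K) = (id_functor (cp K) :: 'u sftor)"
  by (simp add: cp_functor_def comp_functor_id(2)[OF cp_from_funct] cp_to_from)

end

lemma cp_functor_funct:
  assumes "funct A B F" "small_in TYPE('u) A" "small_in TYPE('u) B"
  shows "funct (cp A) (cp B) (cp_functor F :: 'u sftor)"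
  unfolding cp_functor_def funct_src[OF assms(1)] funct_tgt[OF assms(1)]
  by (rule comp_functor_funct[OF comp_functor_funct[OF cp_from_funct[OF assms(2)] assms(1)]
        cp_to_funct[OF assms(3)]])

lemma cp_functor_simps:
  assumes "funct A B F" "small_in TYPE('u) A" "small_in TYPE('u) B"
  shows "x \<in> Obj A \<Longrightarrow> OM (cp_functor F :: 'u sftor) (enc (Obj A) x) = enc (Obj B) (OM F x)"
    and "f \<in> Arr A \<Longrightarrow> MM (cp_functor F :: 'u sftor) (enc (Arr A) f) = enc (Arr B) (MM F f)"
  unfolding cp_functor_def using assms
  by (auto simp: cp_from_simps cp_to_simps cp_obj cp_arr funct_obj funct_arr)

lemma cp_functor_comp:
  assumes F: "funct A B F" and G: "funct B C G"
    and sm: "small_in TYPE('u) A" "small_in TYPE('u) B" "small_in TYPE('u) C"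
  shows "cp_functor (comp_functor G F) = comp_functor (cp_functor G) (cp_functor F :: 'u sftor)"
  by (rule funct_eqI[of "cp A" "cp C"])
    (use assms in \<open>auto simp: cp_obj cp_arr cp_functor_simps[OF F] cp_functor_simps[OF G]
      cp_functor_simps[OF comp_functor_funct[OF F G]] funct_obj funct_arr
      funct_src[OF cp_functor_funct[OF F sm(1,2)]]
      intro!: cp_functor_funct comp_functor_funct\<close>)

lemma cp_functor_small:
  assumes "funct A B F" "small_in TYPE('u) A" "small_in TYPE('u) B"
  shows "small_functor (cp A) (cp B) (cp_functor F :: 'u sftor)"
  using cp_functor_funct[OF assms] cp_small[OF assms(2)] cp_small[OF assms(3)]
  unfolding small_functor_def funct_def by blast

lemma cp_const_functor:
  assumes "c \<in> Obj C" and sm: "small_in TYPE('u) K" "small_in TYPE('u) C"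
  shows "cp_functor (const_functor K C c) = (const_functor (cp K) (cp C) (enc (Obj C) c) :: 'u sftor)"
proof -
  have f: "funct K C (const_functor K C c)"
    using assms by (intro const_functor_funct small_inD(1))
  show ?thesis
    by (rule funct_eqI[of "cp K" "cp C"])
      (use assms f in \<open>auto simp: cp_obj cp_arr cp_functor_simps[OF f] cp_simps
        intro!: cp_functor_funct const_functor_funct cp_category\<close>)
qed

text \<open>Conjugation with the isomorphisms between categories and their copies. Writing it with
  \<open>hcomp\<close> lets naturality be inherited.\<close>

definition cp_nat :: "('o, 'm, 'p, 'n) ntrans \<Rightarrow> 'u sntrans" where
  "cp_nat \<alpha> = hcomp (id_nat (cp_to (Tgt (NSrc \<alpha>)))) (hcomp \<alpha> (id_nat (cp_from (Src (NSrc \<alpha>)))))"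

context
  fixes A :: "('o, 'm) cat" and B :: "('p, 'n) cat" and F G \<alpha>
  assumes F: "funct A B F" and \<alpha>: "natt F G \<alpha>"
    and sm: "small_in TYPE('u) A" "small_in TYPE('u) B"
begin

lemma cp_nat_natt: "natt (cp_functor F) (cp_functor G) (cp_nat \<alpha> :: 'u sntrans)"
proof -
  have "NSrc \<alpha> = F" using \<alpha> by (simp add: natt_def)
  then show ?thesis
    unfolding cp_nat_def cp_functor_def
    using F nattD(1)[OF \<alpha> F] sm \<alpha>
    by (auto intro!: hcomp_natt comp_functor_funct cp_from_funct cp_to_funct id_nat_natt)
qed

lemma cp_nat_comp:
  assumes "x \<in> Obj A"
  shows "NComp (cp_nat \<alpha> :: 'u sntrans) (enc (Obj A) x) = enc (Arr B) (NComp \<alpha> x)"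
proof -
  have s: "NSrc \<alpha> = F" using \<alpha> by (simp add: natt_def)
  note fr = cp_from_funct[OF sm(1)] and to = cp_to_funct[OF sm(2)]
  have x: "enc (Obj A) x \<in> Obj (cp A :: 'u scat)" using assms by (simp add: cp_obj)
  have "NComp \<alpha> x \<in> Arr B" using nattD(2)[OF \<alpha> F assms] by (rule hom_arr)
  then show ?thesis
    unfolding cp_nat_def s funct_src[OF F] funct_tgt[OF F]
      hcomp_id_left[OF hcomp_natt[OF id_nat_natt[OF fr] fr \<alpha> F] comp_functor_funct[OF fr F] to x]
      hcomp_id_right[OF \<alpha> F fr x] cp_from_simps(3)[OF sm(1) assms]
    by (rule cp_to_simps(4)[OF sm(2)])
qed

lemma cp_nat_small: "small_nat (cp_functor F) (cp_functor G) (cp_nat \<alpha> :: 'u sntrans)"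
  using cp_nat_natt cp_functor_small[OF F sm]
  unfolding small_nat_def natt_def small_functor_def by simp

end

text \<open>With \<open>cp_functor_comp\<close> and \<open>cp_nat_id\<close> this lets copying
  commute with whiskering, so that the strict 2-functoriality of \<open>D\<close> carries over to
  shapes of any type.\<close>

lemma cp_nat_hcomp:
  assumes \<alpha>: "natt F G \<alpha>" and F: "funct A B F" and \<beta>: "natt H K \<beta>" and H: "funct B C H"
    and sm: "small_in TYPE('u) A" "small_in TYPE('u) B" "small_in TYPE('u) C"
  shows "cp_nat (hcomp \<beta> \<alpha>) = hcomp (cp_nat \<beta>) (cp_nat \<alpha> :: 'u sntrans)"
proof -
  note G = nattD(1)[OF \<alpha> F] and K = nattD(1)[OF \<beta> H]
  note h = hcomp_natt[OF \<alpha> F \<beta> H] and HF = comp_functor_funct[OF F H]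
  note cF = cp_functor_funct[OF F sm(1,2)] and cH = cp_functor_funct[OF H sm(2,3)]
  note c\<alpha> = cp_nat_natt[OF F \<alpha> sm(1,2)] and c\<beta> = cp_nat_natt[OF H \<beta> sm(2,3)]
  have s: "NSrc \<alpha> = F" "NTgt \<alpha> = G" "NSrc \<beta> = H" "NTgt \<beta> = K"
    "NSrc (cp_nat \<alpha> :: 'u sntrans) = cp_functor F" "NTgt (cp_nat \<alpha> :: 'u sntrans) = cp_functor G"
    "NSrc (cp_nat \<beta> :: 'u sntrans) = cp_functor H" "NTgt (cp_nat \<beta> :: 'u sntrans) = cp_functor K"
    using \<alpha> \<beta> c\<alpha> c\<beta> by (simp_all add: natt_def)
  show ?thesis
  proof (rule natt_eqI)
    show "natt (cp_functor (comp_functor H F)) (cp_functor (comp_functor K G))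
        (cp_nat (hcomp \<beta> \<alpha>) :: 'u sntrans)"
      by (rule cp_nat_natt[OF HF h sm(1,3)])
    show "natt (cp_functor (comp_functor H F)) (cp_functor (comp_functor K G))
        (hcomp (cp_nat \<beta>) (cp_nat \<alpha>) :: 'u sntrans)"
      unfolding cp_functor_comp[OF F H sm] cp_functor_comp[OF G K sm]
      by (rule hcomp_natt[OF c\<alpha> cF c\<beta> cH])
    show "funct (cp A) (cp C) (cp_functor (comp_functor H F) :: 'u sftor)"
      by (rule cp_functor_funct[OF HF sm(1,3)])
    fix x assume "x \<in> Obj (cp A :: 'u scat)"
    then obtain a where a: "a \<in> Obj A" "x = enc (Obj A) a" by (auto simp: cp_obj)
    note aa = nattD(2)[OF \<alpha> F a(1)] and ba = nattD(2)[OF \<beta> H funct_obj[OF G a(1)]]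
    have "NComp (hcomp (cp_nat \<beta>) (cp_nat \<alpha>) :: 'u sntrans) x =
        enc (Arr C) (Comp C (NComp \<beta> (OM G a)) (MM H (NComp \<alpha> a)))"
      using a cF cH \<open>x \<in> Obj (cp A)\<close> hom_arr[OF aa] hom_arr[OF ba] hom_arr[OF funct_hom[OF H aa]]
      by (simp add: s cp_nat_comp[OF F \<alpha> sm(1,2)] cp_nat_comp[OF H \<beta> sm(2,3)] funct_obj[OF G]
          cp_functor_simps[OF G sm(1,2)] cp_functor_simps[OF H sm(2,3)] cp_simps[OF sm(3)])
    then show "NComp (cp_nat (hcomp \<beta> \<alpha>) :: 'u sntrans) x = NComp (hcomp (cp_nat \<beta>) (cp_nat \<alpha>)) x"
      using a F H by (simp add: cp_nat_comp[OF HF h sm(1,3)] s)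
  qed
qed

lemma cp_nat_id:
  assumes F: "funct A B F" and sm: "small_in TYPE('u) A" "small_in TYPE('u) B"
  shows "cp_nat (id_nat F) = (id_nat (cp_functor F) :: 'u sntrans)"
proof (rule natt_eqI[OF cp_nat_natt[OF F id_nat_natt[OF F] sm] id_nat_natt])
  note cF = cp_functor_funct[OF F sm]
  show "funct (cp A) (cp B) (cp_functor F :: 'u sftor)" "funct (cp A) (cp B) (cp_functor F :: 'u sftor)"
    using cF by auto
  fix x assume "x \<in> Obj (cp A :: 'u scat)"
  then obtain a where a: "a \<in> Obj A" "x = enc (Obj A) a" by (auto simp: cp_obj)
  then show "NComp (cp_nat (id_nat F) :: 'u sntrans) x = NComp (id_nat (cp_functor F)) x"
    using F cF \<open>x \<in> Obj (cp A)\<close>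
    by (simp add: cp_nat_comp[OF F id_nat_natt[OF F] sm] cp_functor_simps[OF F sm] cp_simps[OF sm(2)]
        funct_obj)
qed

section \<open>Prederivators on small categories of arbitrary type\<close>

abbreviation unit_cat :: "(unit, unit \<times> unit) cat" where
  "unit_cat \<equiv> poset_cat UNIV"

lemma poset_cat_simps [simp]:
  "Obj (poset_cat P) = P" "(x, y) \<in> Arr (poset_cat P) \<longleftrightarrow> x \<in> P \<and> y \<in> P \<and> x \<le> y"
  "Dom (poset_cat P) = fst" "Cod (poset_cat P) = snd" "Ident (poset_cat P) x = (x, x)"
  "Comp (poset_cat P) g f = (fst f, snd g)"
  by (auto simp: poset_cat_def)

lemma poset_category: "category (poset_cat P)"
  by (auto simp: category_def poset_cat_def)

lemma poset_functor_simps [simp]: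
  "Src (poset_functor P Q \<phi>) = poset_cat P" "Tgt (poset_functor P Q \<phi>) = poset_cat Q"
  "x \<in> P \<Longrightarrow> OM (poset_functor P Q \<phi>) x = \<phi> x"
  "x \<in> P \<Longrightarrow> y \<in> P \<Longrightarrow> x \<le> y \<Longrightarrow> MM (poset_functor P Q \<phi>) (x, y) = (\<phi> x, \<phi> y)"
  by (auto simp: poset_functor_def)

lemma poset_functor_funct:
  assumes "\<And>x. x \<in> P \<Longrightarrow> \<phi> x \<in> Q" and "\<And>x y. x \<in> P \<Longrightarrow> y \<in> P \<Longrightarrow> x \<le> y \<Longrightarrow> \<phi> x \<le> \<phi> y"
  shows "funct (poset_cat P) (poset_cat Q) (poset_functor P Q \<phi>)"
proof (rule functI, goal_cases)
  case (7 f) then show ?case using assms by (cases f) (auto simp: hom_def)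
next
  case (10 f g) then show ?case by (cases f; cases g) (auto intro: order_trans)
qed (auto simp: assms poset_category, auto simp: poset_functor_def)

locale prederiv =
  fixes D :: "('u, 'o, 'm) prederiv"
  assumes prederivator: "prederivator D"
begin

definition DC :: "('a, 'b) cat \<Rightarrow> ('o, 'm) cat" where
  "DC K = DOb D (cp K)"

definition pull :: "('a, 'b, 'c, 'd) ftor \<Rightarrow> ('o, 'm, 'o, 'm) ftor" where
  "pull F = DFun D (cp_functor F)"

text \<open>For a cocone \<open>\<alpha>\<close> from \<open>F\<close> to the constant functor at
  \<open>c\<close>, this is the induced map in \<open>D\<close> from F^*W to the constant diagram on
  c^*W.\<close>

definition cell :: "('a, 'b, 'c, 'd) ntrans \<Rightarrow> 'o \<Rightarrow> 'm" where
  "cell \<alpha> = NComp (DNat D (cp_nat \<alpha>))"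

lemma D_category: "small_cat A \<Longrightarrow> category (DOb D A)"
  using prederivator unfolding prederivator_def by (elim conjE) metis

lemma D_funct: "small_functor A B u \<Longrightarrow> funct (DOb D B) (DOb D A) (DFun D u)"
  using prederivator unfolding prederivator_def funct_def by (elim conjE) metis

lemma D_nat: "small_nat u v \<alpha> \<Longrightarrow> natt (DFun D u) (DFun D v) (DNat D \<alpha>)"
  using prederivator unfolding prederivator_def natt_def by (elim conjE) metis

lemma D_hcomp: "small_nat u u' \<alpha> \<Longrightarrow> small_nat v v' \<beta> \<Longrightarrow> Tgt u = Src v \<Longrightarrow>
    DNat D (hcomp \<beta> \<alpha>) = hcomp (DNat D \<alpha>) (DNat D \<beta>)"
  using prederivator unfolding prederivator_def by (elim conjE) metis

lemma D_id_nat: "small_functor A B u \<Longrightarrow> DNat D (id_nat u) = id_nat (DFun D u)"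
  using prederivator unfolding prederivator_def by (elim conjE) metis

lemma D_id: "small_cat A \<Longrightarrow> DFun D (id_functor A) = id_functor (DOb D A)"
  using prederivator unfolding prederivator_def by (elim conjE) metis

lemma D_comp: "small_functor A B u \<Longrightarrow> small_functor B C v \<Longrightarrow>
    DFun D (comp_functor v u) = comp_functor (DFun D u) (DFun D v)"
  using prederivator unfolding prederivator_def by (elim conjE) metis

lemma DC_category: "small_in TYPE('u) K \<Longrightarrow> category (DC K)"
  unfolding DC_def by (rule D_category[OF cp_small])

lemma pull_funct: "funct A B F \<Longrightarrow> small_in TYPE('u) A \<Longrightarrow> small_in TYPE('u) B \<Longrightarrow> funct (DC B) (DC A) (pull F)"
  unfolding DC_def pull_def by (rule D_funct[OF cp_functor_small])

lemma pull_id: "small_in TYPE('u) K \<Longrightarrow> pull (id_functor K) = id_functor (DC K)"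
  unfolding DC_def pull_def by (simp add: cp_functor_id D_id cp_small)

lemma pull_comp:
  assumes "funct A B F" "funct B C G" "small_in TYPE('u) A" "small_in TYPE('u) B" "small_in TYPE('u) C"
  shows "pull (comp_functor G F) = comp_functor (pull F) (pull G)"
  unfolding pull_def cp_functor_comp[OF assms]
  by (rule D_comp[OF cp_functor_small[OF assms(1,3,4)] cp_functor_small[OF assms(2,4,5)]])

lemma pull_comp_obj:
  assumes "funct A B F" "funct B C G" "small_in TYPE('u) A" "small_in TYPE('u) B" "small_in TYPE('u) C" "W \<in> Obj (DC C)"
  shows "OM (pull (comp_functor G F)) W = OM (pull F) (OM (pull G) W)"
  using pull_comp[OF assms(1-5)] pull_funct[OF assms(2,4,5)] assms(6) by simp

lemma pull_comp_arr:
  assumes "funct A B F" "funct B C G" "small_in TYPE('u) A" "small_in TYPE('u) B" "small_in TYPE('u) C" "f \<in> hom (DC C) W W'"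
  shows "MM (pull (comp_functor G F)) f = MM (pull F) (MM (pull G) f)"
  using pull_comp[OF assms(1-5)] pull_funct[OF assms(2,4,5)] assms(6) by (simp add: hom_arr)

context
  fixes A :: "('a, 'b) cat" and B :: "('c, 'd) cat" and F G \<alpha>
  assumes \<alpha>: "natt F G \<alpha>" and F: "funct A B F" and sm: "small_in TYPE('u) A" "small_in TYPE('u) B"
begin

lemma cell_natt: "natt (pull F) (pull G) (DNat D (cp_nat \<alpha>))"
  unfolding pull_def by (rule D_nat[OF cp_nat_small[OF F \<alpha> sm]])

lemma cell_hom: "W \<in> Obj (DC B) \<Longrightarrow> cell \<alpha> W \<in> hom (DC A) (OM (pull F) W) (OM (pull G) W)"
  unfolding cell_def by (rule nattD(2)[OF cell_natt pull_funct[OF F sm]])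

lemma cell_naturality: "f \<in> hom (DC B) W W' \<Longrightarrow>
    Comp (DC A) (cell \<alpha> W') (MM (pull F) f) = Comp (DC A) (MM (pull G) f) (cell \<alpha> W)"
  unfolding cell_def by (rule nattD(3)[OF cell_natt pull_funct[OF F sm]])

text \<open>\<open>D\<close> reverses 1-cells, so precomposing a 2-cell with \<open>S\<close>
  amounts to applying S^* to its components. For a cocone this is restriction of its shape along
  \<open>S\<close>.\<close>

lemma cell_whisker_right:
  assumes S: "funct A' A S" "small_in TYPE('u) A'" and W: "W \<in> Obj (DC B)"
  shows "cell (hcomp \<alpha> (id_nat S)) W = MM (pull S) (cell \<alpha> W)"
proof -
  have "DNat D (cp_nat (hcomp \<alpha> (id_nat S))) = hcomp (id_nat (pull S)) (DNat D (cp_nat \<alpha>))"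
    unfolding cp_nat_hcomp[OF id_nat_natt[OF S(1)] S(1) \<alpha> F S(2) sm] cp_nat_id[OF S sm(1)] pull_def
      D_id_nat[OF cp_functor_small[OF S sm(1)], symmetric]
    using cp_functor_funct[OF S sm(1)] cp_functor_funct[OF F sm]
      cp_nat_small[OF S(1) id_nat_natt[OF S(1)] S(2) sm(1)]
    by (intro D_hcomp[OF _ cp_nat_small[OF F \<alpha> sm]]) (auto simp: cp_nat_id[OF S sm(1)])
  then show ?thesis
    unfolding cell_def
    using hcomp_id_left[OF cell_natt pull_funct[OF F sm] pull_funct[OF S sm(1)] W] by simp
qed

text \<open>Dually, postcomposing with \<open>H\<close> only changes the object at which the
  component is taken.\<close>

lemma cell_whisker_left:
  assumes H: "funct B C H" "small_in TYPE('u) C" and W: "W \<in> Obj (DC C)"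
  shows "cell (hcomp (id_nat H) \<alpha>) W = cell \<alpha> (OM (pull H) W)"
proof -
  have "DNat D (cp_nat (hcomp (id_nat H) \<alpha>)) = hcomp (DNat D (cp_nat \<alpha>)) (id_nat (pull H))"
    unfolding cp_nat_hcomp[OF \<alpha> F id_nat_natt[OF H(1)] H(1) sm H(2)] cp_nat_id[OF H(1) sm(2) H(2)]
      pull_def D_id_nat[OF cp_functor_small[OF H(1) sm(2) H(2)], symmetric]
    using cp_functor_funct[OF H(1) sm(2) H(2)] cp_functor_funct[OF F sm]
      cp_nat_small[OF H(1) id_nat_natt[OF H(1)] sm(2) H(2)]
    by (intro D_hcomp[OF cp_nat_small[OF F \<alpha> sm]]) (auto simp: cp_nat_id[OF H(1) sm(2) H(2)])
  then show ?thesis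
    unfolding cell_def
    using hcomp_id_right[OF cell_natt pull_funct[OF F sm] pull_funct[OF H(1) sm(2) H(2)] W] by simp
qed

end

lemma cell_id:
  assumes "funct A B F" "small_in TYPE('u) A" "small_in TYPE('u) B" "W \<in> Obj (DC B)"
  shows "cell (id_nat F) W = Ident (DC A) (OM (pull F) W)"
  using D_id_nat[OF cp_functor_small[OF assms(1-3)]] pull_funct[OF assms(1-3)] assms(4)
  by (simp add: cell_def cp_nat_id[OF assms(1-3)] pull_def)

end

section \<open>Products of small sets, comma categories\<close>

lemma infinite_times_eqpoll: "infinite S \<Longrightarrow> S \<times> S \<approx> S"
  using card_of_Times_same_infinite[of S] unfolding eqpoll_def card_of_ordIso .

lemma lepoll_linear: "S \<lesssim> T \<or> T \<lesssim> S"
  unfolding lepoll_def card_of_ordLeq by (rule ordLeq_total) (rule card_of_Well_order)+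

lemma times_lesspoll_aux:
  assumes "Y \<lesssim> X" "infinite X \<or> infinite Y" "X \<prec> U"
  shows "X \<times> Y \<prec> U" "Y \<times> X \<prec> U"
proof -
  have "infinite X" using assms(1,2) inj_on_finite unfolding lepoll_def by blast
  note eq = eqpoll_imp_lepoll[OF infinite_times_eqpoll[OF this]]
  show "X \<times> Y \<prec> U" "Y \<times> X \<prec> U"
    using lepoll_trans[OF times_lepoll_mono[OF lepoll_refl assms(1)] eq, THEN lesspoll_trans1, OF assms(3)]
      lepoll_trans[OF times_lepoll_mono[OF assms(1) lepoll_refl] eq, THEN lesspoll_trans1, OF assms(3)]
    by auto
qed

text \<open>If both factors are finite, so is the product; otherwise the product is no larger than
  the larger factor. This keeps products and comma categories inside the universe.\<close>

lemma times_lesspoll: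
  assumes "infinite U" "S \<prec> U" "T \<prec> U"
  shows "S \<times> T \<prec> U"
proof (cases "finite S \<and> finite T")
  case True
  then show ?thesis by (intro finite_lesspoll_infinite[OF assms(1)] finite_cartesian_product) auto
next
  case False
  then show ?thesis
    using lepoll_linear[of S T] times_lesspoll_aux[OF _ _ assms(2), of T]
      times_lesspoll_aux[OF _ _ assms(3), of S] by blast
qed

lemma prod_category: "category A \<Longrightarrow> category B \<Longrightarrow> category (prod_cat A B)"
  unfolding category_def prod_cat_def by auto

lemma small_in_prod:
  assumes "small_in TYPE('u::infinite) A" "small_in TYPE('u) B"
  shows "small_in TYPE('u) (prod_cat A B)"
proof -
  have "category (prod_cat A B)"
    by (rule prod_category[OF small_inD(1)[OF assms(1)] small_inD(1)[OF assms(2)]])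
  then show ?thesis
    using times_lesspoll[OF infinite_UNIV small_inD(2)[OF assms(1)] small_inD(2)[OF assms(2)]]
      times_lesspoll[OF infinite_UNIV small_inD(3)[OF assms(1)] small_inD(3)[OF assms(2)]]
    by (simp add: small_in_def prod_cat_def)
qed

lemma small_in_poset:
  assumes "finite P"
  shows "small_in TYPE('u::infinite) (poset_cat P)"
proof -
  have "Arr (poset_cat P) \<subseteq> P \<times> P" by auto
  then have "finite (Arr (poset_cat P))" using assms finite_subset by blast
  then show ?thesis
    using assms finite_lesspoll_infinite[OF infinite_UNIV, of P]
      finite_lesspoll_infinite[OF infinite_UNIV, of "Arr (poset_cat P)"]
    by (simp add: small_in_def poset_category)
qed

section \<open>Comma categories and their tautological cocones\<close>

lemma comma_cat_simps [simp]:
  "Obj (comma_cat u c) = comma_obj u c"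
  "Dom (comma_cat u c) = fst" "Cod (comma_cat u c) = (\<lambda>f. snd (snd f))"
  "Ident (comma_cat u c) s = (s, Ident (Src u) (fst s), s)"
  "Comp (comma_cat u c) (s', g', t') (s, g, t) = (s, Comp (Src u) g' g, t')"
  by (auto simp: comma_cat_def)

lemma comma_obj_iff:
  "funct A C u \<Longrightarrow> (a, f) \<in> comma_obj u c \<longleftrightarrow> a \<in> Obj A \<and> f \<in> hom C (OM u a) c"
  by (auto simp: comma_obj_def hom_def)

lemma comma_hom_iff:
  "funct A C u \<Longrightarrow> x \<in> hom (comma_cat u c) s t \<longleftrightarrow> s \<in> comma_obj u c \<and> t \<in> comma_obj u c \<and>
    (\<exists>g. x = (s, g, t) \<and> g \<in> hom A (fst s) (fst t) \<and> Comp C (snd t) (MM u g) = snd s)"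
  unfolding hom_def by (cases x) (auto simp: comma_cat_def)

lemma comma_arrE:
  assumes "x \<in> Arr (comma_cat u c)" "funct A C u"
  obtains a f g b h where "x = ((a, f), g, (b, h))" "(a, f) \<in> comma_obj u c" "(b, h) \<in> comma_obj u c"
    "g \<in> hom A a b" "Comp C h (MM u g) = f"
  using assms that unfolding hom_def comma_cat_def by auto

lemma comma_category:
  assumes u: "funct A C u"
  shows "category (comma_cat u c)"
proof (rule categoryI, goal_cases)
  case (1 f) then show ?case by (auto simp: comma_cat_def)
next
  case (2 s)
  then obtain a f where s: "s = (a, f)" "a \<in> Obj A" "f \<in> hom C (OM u a) c"
    using comma_obj_iff[OF u] by (cases s) auto
  then have "Ident (comma_cat u c) s \<in> hom (comma_cat u c) s s"
    using 2 u ident_hom[OF funct_cat_src[OF u] s(2)] ident_right[OF funct_cat_tgt[OF u] s(3)]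
    by (simp add: comma_hom_iff[OF u] funct_ident)
  then show ?case unfolding hom_def by auto
next
  case (3 x y)
  obtain a f g b h where x: "x = ((a, f), g, (b, h))" "(a, f) \<in> comma_obj u c"
    "g \<in> hom A a b" "Comp C h (MM u g) = f" using comma_arrE[OF 3(1) u] by metis
  obtain a' f' g' b' h' where y: "y = ((a', f'), g', (b', h'))" "(b', h') \<in> comma_obj u c"
    "g' \<in> hom A a' b'" "Comp C h' (MM u g') = f'" using comma_arrE[OF 3(2) u] by metis
  have e: "a' = b" "f' = h" using 3(3) x y by auto
  have h': "h' \<in> hom C (OM u b') c" using y(2) comma_obj_iff[OF u] by blast
  have "Comp C h' (MM u (Comp A g' g)) = f"
    using funct_comp[OF u x(3)] y(3) x(4) y(4) e
      comp_assoc[OF funct_cat_tgt[OF u] funct_hom[OF u x(3)] funct_hom[OF u y(3)[unfolded e]] h'] by simp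
  then have "Comp (comma_cat u c) y x \<in> hom (comma_cat u c) (a, f) (b', h')"
    using x y e comp_hom[OF funct_cat_src[OF u] x(3)] u by (simp add: comma_hom_iff[OF u])
  then show ?case using x y unfolding hom_def by auto
next
  case (4 x)
  obtain a f g b h where x: "x = ((a, f), g, (b, h))" "g \<in> hom A a b"
    using comma_arrE[OF 4 u] by metis
  then show ?case
    using ident_right[OF funct_cat_src[OF u] x(2)] ident_left[OF funct_cat_src[OF u] x(2)] u
    by simp
next
  case (5 x y z)
  obtain a f g b h where x: "x = ((a, f), g, (b, h))" "g \<in> hom A a b"
    using comma_arrE[OF 5(1) u] by metis
  obtain a' f' g' b' h' where y: "y = ((a', f'), g', (b', h'))" "g' \<in> hom A a' b'"
    using comma_arrE[OF 5(2) u] by metis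
  obtain a'' f'' g'' b'' h'' where z: "z = ((a'', f''), g'', (b'', h''))" "g'' \<in> hom A a'' b''"
    using comma_arrE[OF 5(3) u] by metis
  show ?case using 5 x y z u comp_assoc[OF funct_cat_src[OF u] x(2), of g' b' g'' b''] by simp
qed

lemma small_in_comma:
  assumes u: "funct A C u" and sm: "small_in TYPE('u::infinite) A" "small_in TYPE('u) C"
  shows "small_in TYPE('u) (comma_cat u c)"
proof -
  note t = times_lesspoll[OF infinite_UNIV]
  have o: "Obj (comma_cat u c) \<prec> (UNIV :: 'u set)"
    by (rule lesspoll_trans1[OF subset_imp_lepoll t[OF small_inD(2)[OF sm(1)] small_inD(3)[OF sm(2)]]])
      (use u in \<open>auto simp: comma_obj_def\<close>)
  moreover have "Arr (comma_cat u c) \<prec> (UNIV :: 'u set)"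
    by (rule lesspoll_trans1[OF subset_imp_lepoll t[OF o t[OF small_inD(3)[OF sm(1)] o]]])
      (use u in \<open>auto simp: comma_cat_def\<close>)
  ultimately show ?thesis using comma_category[OF u] by (simp add: small_in_def)
qed

lemma comma_proj_simps [simp]:
  "Src (comma_proj E A) = E" "Tgt (comma_proj E A) = A"
  "x \<in> Obj E \<Longrightarrow> OM (comma_proj E A) x = fst x" "f \<in> Arr E \<Longrightarrow> MM (comma_proj E A) f = fst (snd f)"
  by (auto simp: comma_proj_def)

lemma comma_proj_funct:
  assumes u: "funct A C u"
  shows "funct (comma_cat u c) A (comma_proj (comma_cat u c) A)"
proof (rule functI, goal_cases)
  case (7 x) then show ?case using comma_arrE[OF 7 u] by (metis (no_types, opaque_lifting)
        comma_cat_simps(1-3) comma_proj_simps(3,4) fst_conv snd_conv)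
next
  case (9 x)
  then show ?case using ident_hom[OF comma_category[OF u], of x c] u by (simp add: hom_arr)
next
  case (10 x y)
  then have "Comp (comma_cat u c) y x \<in> Arr (comma_cat u c)"
    using comma_category[OF u] unfolding category_def by blast
  then show ?case using 10 u by (cases x; cases y) simp
qed (use u comma_category[OF u] in \<open>auto simp: comma_obj_iff[OF u] dest: funct_cat_src\<close>,
  auto simp: comma_proj_def)

text \<open>The cell \<open>slice_cell\<close> before copying. Its target is written as a constant
  functor instead of a composite through the terminal category, which makes it a cocone
  literally.\<close>

definition comma_cell ::
    "('o, 'm, 'p, 'n) ftor \<Rightarrow> 'p \<Rightarrow> ('o \<times> 'n, ('o \<times> 'n) \<times> 'm \<times> ('o \<times> 'n), 'p, 'n) ntrans" where
  "comma_cell u c = \<lparr>NSrc = comp_functor u (comma_proj (comma_cat u c) (Src u)),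
     NTgt = const_functor (comma_cat u c) (Tgt u) c, NComp = (\<lambda>x\<in>comma_obj u c. snd x)\<rparr>"

lemma comma_cell_natt:
  assumes u: "funct A C u" and c: "c \<in> Obj C"
  shows "natt (comp_functor u (comma_proj (comma_cat u c) A)) (const_functor (comma_cat u c) C c)
    (comma_cell u c)"
proof (rule nattI[OF comp_functor_funct[OF comma_proj_funct[OF u] u]
      const_functor_funct[OF comma_category[OF u] funct_cat_tgt[OF u] c]], goal_cases)
  case (3 x) then show ?case using comma_obj_iff[OF u] by (cases x) (auto simp: comma_cell_def)
next
  case (5 x)
  obtain a f g b h where x: "x = ((a, f), g, (b, h))" "(a, f) \<in> comma_obj u c"
    "(b, h) \<in> comma_obj u c" "g \<in> hom A a b" "Comp C h (MM u g) = f"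
    using comma_arrE[OF 5 u] .
  have "f \<in> hom C (OM u a) c" using x(2) comma_obj_iff[OF u] by blast
  then show ?case using x 5 ident_left[OF funct_cat_tgt[OF u]] by (simp add: comma_cell_def)
qed (use u in \<open>auto simp: comma_cell_def\<close>)

section \<open>Reflections and colimiting cocones\<close>

abbreviation terminal_functor :: "('a, 'b) cat \<Rightarrow> ('a, 'b, unit, unit \<times> unit) ftor" where
  "terminal_functor K \<equiv> const_functor K unit_cat ()"

abbreviation point :: "('a, 'b) cat \<Rightarrow> 'a \<Rightarrow> (unit, unit \<times> unit, 'a, 'b) ftor" where
  "point C c \<equiv> const_functor unit_cat C c"

lemma unit_small: "small_in TYPE('u::infinite) unit_cat"
  by (rule small_in_poset) simp

lemma terminal_funct: "category K \<Longrightarrow> funct K unit_cat (terminal_functor K)"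
  by (rule const_functor_funct[OF _ poset_category]) auto

lemma point_funct: "category C \<Longrightarrow> c \<in> Obj C \<Longrightarrow> funct unit_cat C (point C c)"
  by (rule const_functor_funct[OF poset_category])

lemma comp_terminal: "funct A K s \<Longrightarrow> comp_functor (terminal_functor K) s = terminal_functor A"
  by (rule comp_const_functor[OF _ poset_category]) auto

lemma comp_point: "funct C E u \<Longrightarrow> c \<in> Obj C \<Longrightarrow> comp_functor u (point C c) = point E (OM u c)"
  by (rule comp_functor_const[OF _ poset_category])

lemma point_terminal: "category C \<Longrightarrow> c \<in> Obj C \<Longrightarrow> category K \<Longrightarrow>
    comp_functor (point C c) (terminal_functor K) = const_functor K C c"
  by (rule comp_const_functor[OF terminal_funct])

text \<open>The functor \<open>r\<close> is left adjoint to \<open>s\<close> with unit \<open>\<eta>\<close>, the counit being the identity.\<close>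

definition reflection ::
    "('a, 'b) cat \<Rightarrow> ('c, 'd) cat \<Rightarrow> ('c, 'd, 'a, 'b) ftor \<Rightarrow> ('a, 'b, 'c, 'd) ftor \<Rightarrow>
      ('a, 'b, 'a, 'b) ntrans \<Rightarrow> bool" where
  "reflection K K' s r \<eta> \<longleftrightarrow> funct K' K s \<and> funct K K' r \<and> comp_functor r s = id_functor K' \<and>
     natt (id_functor K) (comp_functor s r) \<eta> \<and> (\<forall>k\<in>Obj K'. NComp \<eta> (OM s k) = Ident K (OM s k))"

text \<open>The last fact is a triangle identity as an equation between 2-cells, the form to which
  \<open>D\<close> can be applied.\<close>

lemma reflectionD:
  assumes "reflection K K' s r \<eta>"
  shows "funct K' K s" "funct K K' r" "comp_functor r s = id_functor K'"
    "natt (id_functor K) (comp_functor s r) \<eta>" "hcomp \<eta> (id_nat s) = id_nat s"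
proof -
  show s: "funct K' K s" and r: "funct K K' r" and rs: "comp_functor r s = id_functor K'" and
    \<eta>: "natt (id_functor K) (comp_functor s r) \<eta>"
    using assms by (auto simp: reflection_def)
  note I = id_functor_funct[OF funct_cat_tgt[OF s]]
  have eq: "comp_functor (id_functor K) s = s" "comp_functor (comp_functor s r) s = s"
    using comp_functor_id[OF s] comp_functor_assoc[OF s r s] rs by auto
  show "hcomp \<eta> (id_nat s) = id_nat s"
  proof (rule natt_eqI[OF _ id_nat_natt[OF s] s])
    show "natt s s (hcomp \<eta> (id_nat s))"
      using hcomp_natt[OF id_nat_natt[OF s] s \<eta> I] eq by simp
    fix k assume "k \<in> Obj K'"
    then show "NComp (hcomp \<eta> (id_nat s)) k = NComp (id_nat s) k"
      using hcomp_id_right[OF \<eta> I s] assms s by (simp add: reflection_def)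
  qed
qed

section \<open>Universal cocones and changes of their shape\<close>

locale derivator_setup = prederiv D for D :: "('u::infinite, 'o, 'm) prederiv" +
  assumes derivator: "derivator D"
begin

lemma pull_point_terminal:
  assumes "small_in TYPE('u) C" "c \<in> Obj C" "small_in TYPE('u) K" "W \<in> Obj (DC C)"
  shows "OM (pull (terminal_functor K)) (OM (pull (point C c)) W) = OM (pull (const_functor K C c)) W"
  using pull_comp_obj[OF terminal_funct point_funct assms(3) unit_small assms(1,4)] assms
  by (simp add: point_terminal small_inD)

lemma pull_terminal_comp:
  assumes s: "funct A K s" and sm: "small_in TYPE('u) A" "small_in TYPE('u) K"
  shows "E \<in> Obj (DC unit_cat) \<Longrightarrow>
      OM (pull s) (OM (pull (terminal_functor K)) E) = OM (pull (terminal_functor A)) E"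
    and "f \<in> hom (DC unit_cat) E E' \<Longrightarrow>
      MM (pull s) (MM (pull (terminal_functor K)) f) = MM (pull (terminal_functor A)) f"
  using pull_comp_obj[OF s terminal_funct sm unit_small] pull_comp_arr[OF s terminal_funct sm unit_small]
    small_inD(1)[OF sm(2)] by (simp_all add: comp_terminal[OF s])

lemma pull_terminal_funct:
  "small_in TYPE('u) K \<Longrightarrow> funct (DC unit_cat) (DC K) (pull (terminal_functor K))"
  by (rule pull_funct[OF terminal_funct _ unit_small]) (simp_all add: small_inD(1))

text \<open>The inverse sends \<open>h\<close> to r^*h composed with the component of \<eta> at
  \<open>M\<close>; here r^* takes constant diagrams to constant diagrams. One composite is the
  identity by naturality of \<eta>, whose component at a constant diagram is trivial, the other
  because \<eta> is trivial on the image of \<open>s\<close>.\<close>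

lemma reflection_bij:
  assumes refl: "reflection K K' s r \<eta>" and sm: "small_in TYPE('u) K" "small_in TYPE('u) K'"
    and M: "M \<in> Obj (DC K)" and E: "E \<in> Obj (DC unit_cat)"
  shows "bij_betw (MM (pull s)) (hom (DC K) M (OM (pull (terminal_functor K)) E))
    (hom (DC K') (OM (pull s) M) (OM (pull (terminal_functor K')) E))"
proof -
  note s = reflectionD(1)[OF refl] and r = reflectionD(2)[OF refl] and rs = reflectionD(3)[OF refl]
    and \<eta> = reflectionD(4)[OF refl] and \<eta>s = reflectionD(5)[OF refl]
  note K = small_inD(1)[OF sm(1)] and K' = small_inD(1)[OF sm(2)]
  note I = id_functor_funct[OF K] and sr = comp_functor_funct[OF r s]
  note ps = pull_funct[OF s sm(2,1)] and pr = pull_funct[OF r sm]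
  note C = DC_category[OF sm(1)] and C' = DC_category[OF sm(2)]
  let ?pE = "OM (pull (terminal_functor K)) E" and ?pE' = "OM (pull (terminal_functor K')) E"
  have pE: "?pE \<in> Obj (DC K)" using funct_obj[OF pull_terminal_funct[OF sm(1)] E] .
  have spE: "OM (pull s) ?pE = ?pE'" using pull_terminal_comp(1)[OF s sm(2,1) E] .
  have rpE: "OM (pull r) ?pE' = ?pE" using pull_terminal_comp(1)[OF r sm E] .
  have c: "cell \<eta> W \<in> hom (DC K) W (OM (pull r) (OM (pull s) W))" if "W \<in> Obj (DC K)" for W
    using cell_hom[OF \<eta> I sm(1,1) that] pull_comp_obj[OF r s sm(1,2,1) that] that
    by (simp add: pull_id[OF sm(1)])
  \<comment> \<open>Whiskering \<eta> with the functor to the terminal category leaves only an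
    identity 2-cell, and \<open>D\<close> preserves identity 2-cells.\<close>
  have const: "cell \<eta> ?pE = Ident (DC K) ?pE"
  proof -
    have "hcomp (id_nat (terminal_functor K)) \<eta> = id_nat (terminal_functor K)"
    proof (rule natt_eqI[OF _ id_nat_natt[OF terminal_funct[OF K]] terminal_funct[OF K]])
      show n: "natt (terminal_functor K) (terminal_functor K) (hcomp (id_nat (terminal_functor K)) \<eta>)"
        using hcomp_natt[OF \<eta> I id_nat_natt[OF terminal_funct[OF K]] terminal_funct[OF K]]
        by (simp add: comp_terminal[OF I] comp_terminal[OF sr])
      fix k assume k: "k \<in> Obj K"
      show "NComp (hcomp (id_nat (terminal_functor K)) \<eta>) k = NComp (id_nat (terminal_functor K)) k"
        by (rule prod_eqI) auto
    qed
    then show ?thesis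
      using cell_whisker_left[OF \<eta> I sm(1,1) terminal_funct[OF K] unit_small E]
        cell_id[OF terminal_funct[OF K] sm(1) unit_small E] by simp
  qed
  show ?thesis
  proof (rule bij_betwI[where g = "\<lambda>h. Comp (DC K) (MM (pull r) h) (cell \<eta> M)"])
    show "MM (pull s) \<in> hom (DC K) M ?pE \<rightarrow> hom (DC K') (OM (pull s) M) ?pE'"
      using funct_hom[OF ps] spE by (metis Pi_I)
    have rh: "MM (pull r) h \<in> hom (DC K) (OM (pull r) (OM (pull s) M)) ?pE"
      if "h \<in> hom (DC K') (OM (pull s) M) ?pE'" for h
      using funct_hom[OF pr that] rpE by simp
    then show "(\<lambda>h. Comp (DC K) (MM (pull r) h) (cell \<eta> M))
        \<in> hom (DC K') (OM (pull s) M) ?pE' \<rightarrow> hom (DC K) M ?pE"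
      using comp_hom[OF C c[OF M]] by blast
    fix f assume f: "f \<in> hom (DC K) M ?pE"
    have "Comp (DC K) (cell \<eta> ?pE) (MM (pull (id_functor K)) f) =
        Comp (DC K) (MM (pull (comp_functor s r)) f) (cell \<eta> M)"
      by (rule cell_naturality[OF \<eta> I sm(1,1) f])
    then show "Comp (DC K) (MM (pull r) (MM (pull s) f)) (cell \<eta> M) = f"
      using f pull_comp_arr[OF r s sm(1,2,1) f] ident_left[OF C f]
      by (simp add: const pull_id[OF sm(1)] hom_arr)
  next
    fix h assume h: "h \<in> hom (DC K') (OM (pull s) M) ?pE'"
    have rh: "MM (pull r) h \<in> hom (DC K) (OM (pull r) (OM (pull s) M)) ?pE"
      using funct_hom[OF pr h] rpE by simp
    have "MM (pull s) (cell \<eta> M) = Ident (DC K') (OM (pull s) M)"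
      using cell_whisker_right[OF \<eta> I sm(1,1) s sm(2) M] cell_id[OF s sm(2,1) M] \<eta>s by simp
    moreover have "MM (pull s) (MM (pull r) h) = h"
      using pull_comp_arr[OF s r sm(2,1,2) h] h by (simp add: rs pull_id[OF sm(2)] hom_arr)
    ultimately show "MM (pull s) (Comp (DC K) (MM (pull r) h) (cell \<eta> M)) = h"
      using funct_comp[OF ps c[OF M] rh] ident_right[OF C' h] by simp
  qed
qed

text \<open>A bijection on morphisms into constant diagrams is the only input, so that reflections
  and left Kan extended diagrams are covered by the same statement.\<close>

lemma restriction_universal:
  assumes s: "funct K' K s" and sm: "small_in TYPE('u) K" "small_in TYPE('u) K'"
    and bij: "\<And>E. E \<in> Obj (DC unit_cat) \<Longrightarrow>
      bij_betw (MM (pull s)) (hom (DC K) M (OM (pull (terminal_functor K)) E))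
        (hom (DC K') (OM (pull s) M) (OM (pull (terminal_functor K')) E))"
    and N: "N \<in> Obj (DC unit_cat)" and g: "g \<in> hom (DC K) M (OM (pull (terminal_functor K)) N)"
  shows "univ_arr (pull (terminal_functor K)) M N g \<longleftrightarrow>
    univ_arr (pull (terminal_functor K')) (OM (pull s) M) N (MM (pull s) g)"
proof (rule univ_arr_transport[OF pull_terminal_funct[OF sm(1)] pull_terminal_funct[OF sm(2)] N g bij])
  show "MM (pull s) (Comp (DC K) (MM (pull (terminal_functor K)) f) g) =
      Comp (DC K') (MM (pull (terminal_functor K')) f) (MM (pull s) g)"
    if f: "f \<in> hom (DC unit_cat) N E" for f E
    using funct_comp[OF pull_funct[OF s sm(2,1)] g funct_hom[OF pull_terminal_funct[OF sm(1)] f]]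
      pull_terminal_comp(2)[OF s sm(2,1) f] by simp
qed

lemma reflection_universal:
  assumes refl: "reflection K K' s r \<eta>" and sm: "small_in TYPE('u) K" "small_in TYPE('u) K'"
    and N: "N \<in> Obj (DC unit_cat)" and g: "g \<in> hom (DC K) M (OM (pull (terminal_functor K)) N)"
  shows "univ_arr (pull (terminal_functor K)) M N g \<longleftrightarrow>
    univ_arr (pull (terminal_functor K')) (OM (pull s) M) N (MM (pull s) g)"
proof -
  have "M \<in> Obj (DC K)" using hom_objs[OF DC_category[OF sm(1)] g] by simp
  from restriction_universal[OF reflectionD(1)[OF refl] sm reflection_bij[OF refl sm this] N g]
  show ?thesis .
qed

text \<open>Through the universal property rather than \<open>\<pi>\<^sub>!\<close>, so that a cocone can be restricted along any
  functor into its shape without computing mates.\<close>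

definition colimiting :: "('c, 'd) cat \<Rightarrow> 'c \<Rightarrow> ('a, 'b, 'c, 'd) ntrans \<Rightarrow> 'o \<Rightarrow> bool" where
  "colimiting C c \<alpha> W \<longleftrightarrow> univ_arr (pull (terminal_functor (Src (NSrc \<alpha>)))) (OM (pull (NSrc \<alpha>)) W)
     (OM (pull (point C c)) W) (cell \<alpha> W)"

lemma colimiting_iff:
  assumes "natt F (const_functor K C c) \<alpha>" "funct K C F"
  shows "colimiting C c \<alpha> W \<longleftrightarrow> univ_arr (pull (terminal_functor K)) (OM (pull F) W)
     (OM (pull (point C c)) W) (cell \<alpha> W)"
  using assms by (simp add: colimiting_def natt_def)

lemma cocone_hom:
  assumes \<alpha>: "natt F (const_functor K C c) \<alpha>" and F: "funct K C F" and c: "c \<in> Obj C"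
    and sm: "small_in TYPE('u) K" "small_in TYPE('u) C" and W: "W \<in> Obj (DC C)"
  shows "cell \<alpha> W \<in> hom (DC K) (OM (pull F) W)
      (OM (pull (terminal_functor K)) (OM (pull (point C c)) W))"
  using cell_hom[OF \<alpha> F sm W] pull_point_terminal[OF sm(2) c sm(1) W] by simp

lemma pull_point_obj:
  "small_in TYPE('u) C \<Longrightarrow> c \<in> Obj C \<Longrightarrow> W \<in> Obj (DC C) \<Longrightarrow> OM (pull (point C c)) W \<in> Obj (DC unit_cat)"
  by (rule funct_obj[OF pull_funct[OF point_funct unit_small]]) (auto simp: small_inD)

lemma colimiting_restriction:
  assumes \<alpha>: "natt F (const_functor K C c) \<alpha>" and F: "funct K C F" and c: "c \<in> Obj C"
    and s: "funct K' K s" and sm: "small_in TYPE('u) K" "small_in TYPE('u) K'" "small_in TYPE('u) C"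
    and W: "W \<in> Obj (DC C)"
    and bij: "\<And>E. E \<in> Obj (DC unit_cat) \<Longrightarrow>
      bij_betw (MM (pull s)) (hom (DC K) (OM (pull F) W) (OM (pull (terminal_functor K)) E))
        (hom (DC K') (OM (pull s) (OM (pull F) W)) (OM (pull (terminal_functor K')) E))"
  shows "colimiting C c \<alpha> W \<longleftrightarrow> colimiting C c (hcomp \<alpha> (id_nat s)) W"
proof -
  note C = small_inD(1)[OF sm(3)]
  have n: "natt (comp_functor F s) (const_functor K' C c) (hcomp \<alpha> (id_nat s))"
    using hcomp_natt[OF id_nat_natt[OF s] s \<alpha> F] comp_const_functor[OF s C c] by simp
  show ?thesis
    unfolding colimiting_iff[OF \<alpha> F] colimiting_iff[OF n comp_functor_funct[OF s F]]
      cell_whisker_right[OF \<alpha> F sm(1,3) s sm(2) W] pull_comp_obj[OF s F sm(2,1,3) W]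
    by (rule restriction_universal[OF s sm(1,2) bij pull_point_obj[OF sm(3) c W]
        cocone_hom[OF \<alpha> F c sm(1,3) W]])
qed

lemma colimiting_reflection:
  assumes refl: "reflection K K' s r \<eta>" and \<alpha>: "natt F (const_functor K C c) \<alpha>"
    and F: "funct K C F" and c: "c \<in> Obj C"
    and sm: "small_in TYPE('u) K" "small_in TYPE('u) K'" "small_in TYPE('u) C"
    and W: "W \<in> Obj (DC C)"
  shows "colimiting C c \<alpha> W \<longleftrightarrow> colimiting C c (hcomp \<alpha> (id_nat s)) W"
  by (rule colimiting_restriction[OF \<alpha> F c reflectionD(1)[OF refl] sm W
        reflection_bij[OF refl sm(1,2) funct_obj[OF pull_funct[OF F sm(1,3)] W]]])

text \<open>Both sides unfold to universality of one and the same arrow: the shape is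
  \<open>K\<close> in each case, and pulling back along \<Psi> and then \<open>F\<close> is pulling
  back along the composite.\<close>

lemma colimiting_pull:
  assumes \<alpha>: "natt F (const_functor K C c) \<alpha>" and F: "funct K C F" and c: "c \<in> Obj C"
    and \<Psi>: "funct C E \<Psi>" and sm: "small_in TYPE('u) K" "small_in TYPE('u) C" "small_in TYPE('u) E"
    and W: "W \<in> Obj (DC E)"
  shows "colimiting C c \<alpha> (OM (pull \<Psi>) W) \<longleftrightarrow> colimiting E (OM \<Psi> c) (hcomp (id_nat \<Psi>) \<alpha>) W"
proof -
  have n: "natt (comp_functor \<Psi> F) (const_functor K E (OM \<Psi> c)) (hcomp (id_nat \<Psi>) \<alpha>)"
    using hcomp_natt[OF \<alpha> F id_nat_natt[OF \<Psi>] \<Psi>] comp_functor_const[OF \<Psi> small_inD(1)[OF sm(1)] c]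
    by simp
  have p: "OM (pull (point C c)) (OM (pull \<Psi>) W) = OM (pull (point E (OM \<Psi> c))) W"
    using pull_comp_obj[OF point_funct[OF small_inD(1)[OF sm(2)] c] \<Psi> unit_small sm(2,3) W]
    by (simp add: comp_point[OF \<Psi> c])
  show ?thesis
    unfolding colimiting_iff[OF \<alpha> F] colimiting_iff[OF n comp_functor_funct[OF F \<Psi>]] p
      cell_whisker_left[OF \<alpha> F sm(1,2) \<Psi> sm(3) W] pull_comp_obj[OF F \<Psi> sm W] ..
qed

end

section \<open>(Der2), (Der3) and (Der4) for categories of arbitrary type\<close>

text \<open>The functor between comma categories induced by a strictly commuting square, with \<Phi>
  between the sources and \<Psi> between the targets of \<open>u\<close> and
  \<open>u'\<close>.\<close>

definition comma_map where
  "comma_map u c u' c' \<Phi> \<Psi> = \<lparr>Src = comma_cat u c, Tgt = comma_cat u' c',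
     OM = (\<lambda>x\<in>comma_obj u c. map_prod (OM \<Phi>) (MM \<Psi>) x),
     MM = (\<lambda>x\<in>Arr (comma_cat u c). (map_prod (OM \<Phi>) (MM \<Psi>) (fst x), MM \<Phi> (fst (snd x)),
       map_prod (OM \<Phi>) (MM \<Psi>) (snd (snd x))))\<rparr>"

lemma comma_map_simps:
  "Src (comma_map u c u' c' \<Phi> \<Psi>) = comma_cat u c" "Tgt (comma_map u c u' c' \<Phi> \<Psi>) = comma_cat u' c'"
  "x \<in> comma_obj u c \<Longrightarrow> OM (comma_map u c u' c' \<Phi> \<Psi>) x = map_prod (OM \<Phi>) (MM \<Psi>) x"
  "y \<in> Arr (comma_cat u c) \<Longrightarrow> MM (comma_map u c u' c' \<Phi> \<Psi>) y = (map_prod (OM \<Phi>) (MM \<Psi>) (fst y),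
     MM \<Phi> (fst (snd y)), map_prod (OM \<Phi>) (MM \<Psi>) (snd (snd y)))"
  by (auto simp: comma_map_def)

lemma comma_map_funct:
  assumes u: "funct A C u" and u': "funct A' C' u'" and \<Phi>: "funct A A' \<Phi>" and \<Psi>: "funct C C' \<Psi>"
    and eq: "comp_functor \<Psi> u = comp_functor u' \<Phi>" and c: "OM \<Psi> c = c'"
  shows "funct (comma_cat u c) (comma_cat u' c') (comma_map u c u' c' \<Phi> \<Psi>)"
proof -
  have eqo: "OM \<Psi> (OM u a) = OM u' (OM \<Phi> a)" if "a \<in> Obj A" for a
    using arg_cong[OF eq, of "\<lambda>F. OM F a"] u \<Phi> that by simp
  have eqm: "MM \<Psi> (MM u f) = MM u' (MM \<Phi> f)" if "f \<in> Arr A" for f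
    using arg_cong[OF eq, of "\<lambda>F. MM F f"] u \<Phi> that by simp
  have o: "map_prod (OM \<Phi>) (MM \<Psi>) x \<in> comma_obj u' c'" if "x \<in> comma_obj u c" for x
    using that funct_hom[OF \<Psi>] funct_obj[OF \<Phi>] eqo c
    by (cases x) (auto simp: comma_obj_iff[OF u] comma_obj_iff[OF u'], metis)
  show ?thesis
  proof (rule functI, goal_cases)
    case (5 x) then show ?case using o by (simp add: comma_map_simps)
  next
    case (7 x)
    then obtain a f g b h where x: "x = ((a, f), g, (b, h))" "(a, f) \<in> comma_obj u c"
      "(b, h) \<in> comma_obj u c" "g \<in> hom A a b" "Comp C h (MM u g) = f"
      using comma_arrE[OF _ u] by metis
    have h: "h \<in> hom C (OM u b) c" using x(3) comma_obj_iff[OF u] by blast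
    have "Comp C' (MM \<Psi> h) (MM u' (MM \<Phi> g)) = MM \<Psi> f"
      using funct_comp[OF \<Psi> funct_hom[OF u x(4)] h] eqm[OF hom_arr[OF x(4)]] x(5) by simp
    then show ?case
      using 7 x o[OF x(2)] o[OF x(3)] funct_hom[OF \<Phi> x(4)]
      by (simp add: comma_map_simps comma_hom_iff[OF u'])
  next
    case (9 x)
    have "Ident (comma_cat u c) x \<in> Arr (comma_cat u c)"
      by (rule hom_arr[OF ident_hom[OF comma_category[OF u] 9]])
    then show ?case using 9 u u' \<Phi> funct_ident[OF \<Phi>, of "fst x"] comma_obj_iff[OF u]
      by (cases x) (simp add: comma_map_simps)
  next
    case (10 x y)
    obtain a f g b h where x: "x = ((a, f), g, (b, h))" "g \<in> hom A a b"
      using comma_arrE[OF 10(1) u] by metis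
    obtain a' f' g' b' h' where y: "y = ((a', f'), g', (b', h'))" "g' \<in> hom A a' b'"
      using comma_arrE[OF 10(2) u] by metis
    have "Comp (comma_cat u c) y x \<in> Arr (comma_cat u c)"
      using comma_category[OF u] 10 unfolding category_def by blast
    then show ?case using 10 x y u u' funct_comp[OF \<Phi> x(2), of g' b']
      by (simp add: comma_map_simps)
  qed (use comma_category[OF u] comma_category[OF u'] in \<open>auto simp: comma_map_def\<close>)
qed

lemma cp_square:
  assumes "funct A C u" "small_in TYPE('u) A" "small_in TYPE('u) C"
  shows "comp_functor (cp_to C) u = comp_functor (cp_functor u :: 'u sftor) (cp_to A)"
    and "comp_functor (cp_from C) (cp_functor u :: 'u sftor) = comp_functor u (cp_from A)"
proof -
  note to = cp_to_funct[OF assms(2)] cp_to_funct[OF assms(3)]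
    and fr = cp_from_funct[OF assms(2)] cp_from_funct[OF assms(3)]
  note uf = comp_functor_funct[OF fr(1) assms(1)]
  show "comp_functor (cp_to C) u = comp_functor (cp_functor u :: 'u sftor) (cp_to A)"
    unfolding cp_functor_def funct_src[OF assms(1)] funct_tgt[OF assms(1)]
      comp_functor_assoc[OF to(1) uf to(2), symmetric] comp_functor_assoc[OF to(1) fr(1) assms(1), symmetric]
      cp_from_to[OF assms(2)] comp_functor_id[OF assms(1)] ..
  show "comp_functor (cp_from C) (cp_functor u :: 'u sftor) = comp_functor u (cp_from A)"
    unfolding cp_functor_def funct_src[OF assms(1)] funct_tgt[OF assms(1)]
      comp_functor_assoc[OF uf to(2) fr(2)] cp_from_to[OF assms(3)] comp_functor_id[OF uf] ..
qed

text \<open>The two functors are mutually inverse. Phrasing this as a reflection with identity unit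
  makes \<open>reflection_universal\<close> applicable, which moves universal arrows from the comma
  category of the copy, the one in (Der4), to that of \<open>u\<close>.\<close>

lemma comma_cp_reflection:
  fixes u :: "('a, 'b, 'c, 'd) ftor"
  assumes u: "funct A C u" and sm: "small_in TYPE('u::infinite) A" "small_in TYPE('u) C" and c: "c \<in> Obj C"
  defines "cu \<equiv> cp_functor u :: 'u sftor" and "c' \<equiv> enc (Obj C) c :: 'u"
  shows "reflection (comma_cat cu c') (comma_cat u c) (comma_map u c cu c' (cp_to A) (cp_to C))
    (comma_map cu c' u c (cp_from A) (cp_from C)) (id_nat (id_functor (comma_cat cu c')))"
proof -
  have cu: "funct (cp A) (cp C) cu" unfolding cu_def by (rule cp_functor_funct[OF u sm])
  have e: "OM (cp_to C) c = c'" "OM (cp_from C) c' = c"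
    using c by (auto simp: c'_def cp_to_simps[OF sm(2)] cp_from_simps[OF sm(2)])
  let ?s = "comma_map u c cu c' (cp_to A) (cp_to C)" and ?r = "comma_map cu c' u c (cp_from A) (cp_from C)"
  have s: "funct (comma_cat u c) (comma_cat cu c') ?s"
    by (rule comma_map_funct[OF u cu cp_to_funct[OF sm(1)] cp_to_funct[OF sm(2)] _ e(1)])
      (simp add: cu_def cp_square[OF u sm])
  have r: "funct (comma_cat cu c') (comma_cat u c) ?r"
    by (rule comma_map_funct[OF cu u cp_from_funct[OF sm(1)] cp_from_funct[OF sm(2)] _ e(2)])
      (simp add: cu_def cp_square[OF u sm])
  have A: "OM (cp_from A) (OM (cp_to A :: ('a, 'b, 'u, 'u) ftor) a) = a" if "a \<in> Obj A" for a
    using that by (simp add: cp_to_simps[OF sm(1)] cp_from_simps[OF sm(1)])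
  have Am: "MM (cp_from A) (MM (cp_to A :: ('a, 'b, 'u, 'u) ftor) a) = a" if "a \<in> Arr A" for a
    using that by (simp add: cp_to_simps[OF sm(1)] cp_from_simps[OF sm(1)])
  have Cm: "MM (cp_from C) (MM (cp_to C :: ('c, 'd, 'u, 'u) ftor) a) = a" if "a \<in> Arr C" for a
    using that by (simp add: cp_to_simps[OF sm(2)] cp_from_simps[OF sm(2)])
  have A': "OM (cp_to A) (OM (cp_from A :: ('u, 'u, 'a, 'b) ftor) a) = a" if "a \<in> Obj (cp A)" for a
    using that by (auto simp: cp_to_simps[OF sm(1)] cp_from_simps[OF sm(1)] cp_obj)
  have Am': "MM (cp_to A) (MM (cp_from A :: ('u, 'u, 'a, 'b) ftor) a) = a" if "a \<in> Arr (cp A)" for a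
    using that by (auto simp: cp_to_simps[OF sm(1)] cp_from_simps[OF sm(1)] cp_arr)
  have Cm': "MM (cp_to C) (MM (cp_from C :: ('u, 'u, 'c, 'd) ftor) a) = a" if "a \<in> Arr (cp C)" for a
    using that by (auto simp: cp_to_simps[OF sm(2)] cp_from_simps[OF sm(2)] cp_arr)
  have o: "x \<in> Obj A \<and> f \<in> Arr C" if "(x, f) \<in> comma_obj u c" for x f
    using that comma_obj_iff[OF u, of x f c] by (auto dest: hom_arr)
  have o': "x \<in> Obj (cp A) \<and> f \<in> Arr (cp C)" if "(x, f) \<in> comma_obj cu c'" for x f
    using that comma_obj_iff[OF cu, of x f c'] by (auto dest: hom_arr)
  have rs: "comp_functor ?r ?s = id_functor (comma_cat u c)"
  proof (rule funct_eqI[OF comp_functor_funct[OF s r] id_functor_funct[OF comma_category[OF u]]])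
    fix x assume x: "x \<in> Obj (comma_cat u c)"
    then show "OM (comp_functor ?r ?s) x = OM (id_functor (comma_cat u c)) x"
      using funct_obj[OF s x] o by (cases x) (simp add: comma_map_simps A Cm)
  next
    fix x assume x: "x \<in> Arr (comma_cat u c)"
    then obtain a f g b h where "x = ((a, f), g, (b, h))" "(a, f) \<in> comma_obj u c"
      "(b, h) \<in> comma_obj u c" "g \<in> hom A a b"
      using comma_arrE[OF _ u] by metis
    then show "MM (comp_functor ?r ?s) x = MM (id_functor (comma_cat u c)) x"
      using funct_arr[OF s x] x o by (simp add: comma_map_simps A Am Cm hom_arr)
  qed
  have sr: "comp_functor ?s ?r = id_functor (comma_cat cu c')"
  proof (rule funct_eqI[OF comp_functor_funct[OF r s] id_functor_funct[OF comma_category[OF cu]]])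
    fix x assume x: "x \<in> Obj (comma_cat cu c')"
    then show "OM (comp_functor ?s ?r) x = OM (id_functor (comma_cat cu c')) x"
      using funct_obj[OF r x] o' by (cases x) (simp add: comma_map_simps A' Cm')
  next
    fix x assume x: "x \<in> Arr (comma_cat cu c')"
    then obtain a f g b h where "x = ((a, f), g, (b, h))" "(a, f) \<in> comma_obj cu c'"
      "(b, h) \<in> comma_obj cu c'" "g \<in> hom (cp A) a b"
      using comma_arrE[OF _ cu] by metis
    then show "MM (comp_functor ?s ?r) x = MM (id_functor (comma_cat cu c')) x"
      using funct_arr[OF r x] x o' by (simp add: comma_map_simps A' Am' Cm' hom_arr)
  qed
  show ?thesis
    unfolding reflection_def sr
    using s r rs id_nat_natt[OF id_functor_funct[OF comma_category[OF cu]]] funct_obj[OF s] by simp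
qed

lemma small_cat_iff: "small_cat (A :: 'u scat) \<longleftrightarrow> small_in TYPE('u) A"
  by (simp add: small_cat_def small_in_def small_def)

lemma bang_cp:
  "small_in TYPE('u::infinite) K \<Longrightarrow> bang (cp K :: 'u scat) = cp_functor (terminal_functor K)"
  using cp_const_functor[where 'u = 'u, of "()" unit_cat K] unit_small[where 'u = 'u]
  by (simp add: bang_def one_cat_def one_obj_def)

lemma pt_cp: "small_in TYPE('u::infinite) C \<Longrightarrow> c \<in> Obj C \<Longrightarrow>
    pt (cp C) (enc (Obj C) c :: 'u) = cp_functor (point C c)"
  using cp_const_functor[where 'u = 'u, of c C unit_cat] unit_small[where 'u = 'u]
  by (simp add: pt_def one_cat_def)

lemma slice_proj_funct:
  fixes u :: "('u::infinite) sftor"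
  assumes u: "funct A B u" and sm: "small_in TYPE('u) A" "small_in TYPE('u) B"
  shows "funct (slice u b) A (slice_proj u b)"
  unfolding slice_proj_def slice_def funct_src[OF u]
  by (rule comp_functor_funct[OF cp_from_funct[OF small_in_comma[OF u sm]] comma_proj_funct[OF u]])

text \<open>The given 2-cell reduces to \<open>comma_cell\<close>, from which it inherits
  naturality.\<close>

lemma slice_cell_eq:
  fixes u :: "('u::infinite) sftor"
  assumes u: "funct A B u" and sm: "small_in TYPE('u) A" "small_in TYPE('u) B" and b: "b \<in> Obj B"
  shows "slice_cell u b = hcomp (comma_cell u b) (id_nat (cp_from (comma_cat u b)))"
    and "comp_functor (pt B b) (bang (slice u b)) = const_functor (slice u b) B b"
proof -
  let ?K = "comma_cat u b"
  note K = small_in_comma[OF u sm, of b]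
  note fr = cp_from_funct[OF K] and p = comma_proj_funct[OF u, of b] and B = small_inD(1)[OF sm(2)]
  note n = comma_cell_natt[OF u b]
  have bang: "funct (cp ?K) one_cat (bang (cp ?K :: 'u scat))"
    unfolding bang_def
    by (rule const_functor_funct[OF cp_category[OF K]])
      (simp_all add: one_cat_def one_obj_def cp_obj cp_category[OF unit_small])
  have pb: "comp_functor (pt B b) (bang (cp ?K)) = const_functor (cp ?K) B b"
    unfolding pt_def by (rule comp_const_functor[OF bang B b])
  then show "comp_functor (pt B b) (bang (slice u b)) = const_functor (slice u b) B b"
    by (simp add: slice_def)
  show "slice_cell u b = hcomp (comma_cell u b) (id_nat (cp_from ?K))"
  proof (rule ntrans.equality)
    show "NSrc (slice_cell u b) = NSrc (hcomp (comma_cell u b) (id_nat (cp_from ?K)))"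
      using comp_functor_assoc[OF fr p u] u
      by (simp add: slice_cell_def slice_proj_def comma_cell_def)
    show "NTgt (slice_cell u b) = NTgt (hcomp (comma_cell u b) (id_nat (cp_from ?K)))"
      using pb comp_const_functor[OF fr B b] u
      by (simp add: slice_cell_def slice_def comma_cell_def)
    show "NComp (slice_cell u b) = NComp (hcomp (comma_cell u b) (id_nat (cp_from ?K)))"
    proof (rule extensionalityI[of _ "Obj (cp ?K)"])
      fix x assume x: "x \<in> Obj (cp ?K :: 'u scat)"
      then obtain y where y: "y \<in> comma_obj u b" "x = enc (comma_obj u b) y" by (auto simp: cp_obj)
      have "NComp (slice_cell u b) x = snd y"
        using x y dec_enc[OF small_inD(2)[OF K], of y] by (simp add: slice_cell_def slice_def)
      moreover have "NComp (hcomp (comma_cell u b) (id_nat (cp_from ?K))) x = snd y"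
        using hcomp_id_right[OF n comp_functor_funct[OF p u] fr x] y cp_from_simps(3)[OF K, of y]
        by (simp add: comma_cell_def)
      ultimately show "NComp (slice_cell u b) x = NComp (hcomp (comma_cell u b) (id_nat (cp_from ?K))) x"
        by simp
    qed (auto simp: slice_cell_def slice_def hcomp_def cp_from_simps[OF K])
  qed simp
qed

lemma slice_cell_natt:
  fixes u :: "('u::infinite) sftor"
  assumes u: "funct A B u" and sm: "small_in TYPE('u) A" "small_in TYPE('u) B" and b: "b \<in> Obj B"
  shows "natt (comp_functor u (slice_proj u b)) (const_functor (slice u b) B b) (slice_cell u b)"
  unfolding slice_cell_eq[OF assms] slice_proj_def funct_src[OF u] slice_def
  using hcomp_natt[OF id_nat_natt[OF cp_from_funct[OF small_in_comma[OF u sm]]]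
      cp_from_funct[OF small_in_comma[OF u sm]] comma_cell_natt[OF u b]
      comp_functor_funct[OF comma_proj_funct[OF u] u]]
    comp_functor_assoc[OF cp_from_funct[OF small_in_comma[OF u sm]] comma_proj_funct[OF u] u]
    comp_const_functor[OF cp_from_funct[OF small_in_comma[OF u sm]] small_inD(1)[OF sm(2)] b]
  by simp

section \<open>The axioms rephrased through universal arrows\<close>

context derivator_setup
begin

lemma iso_pointwise:
  assumes sm: "small_in TYPE('u) K" and f: "f \<in> Arr (DC K)"
  shows "iso_arr (DC K) f \<longleftrightarrow> (\<forall>a\<in>Obj K. iso_arr (DC unit_cat) (MM (pull (point K a)) f))"
proof -
  have "iso_arr (DOb D (cp K)) f \<longleftrightarrow> (\<forall>a\<in>Obj (cp K). iso_arr (DOb D one_cat) (MM (DFun D (pt (cp K) a)) f))"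
    using derivator cp_small[OF sm] f unfolding derivator_def der2_def DC_def by simp
  then show ?thesis
    using sm by (simp add: DC_def cp_obj pt_cp pull_def one_cat_def)
qed

text \<open>By (Der3) the choice in \<open>lkan_adj\<close> is made among existing
  adjunctions.\<close>

lemma lkan_adjunction:
  assumes "small_functor A B u"
  shows "adjunction (lkan D u) (DFun D u) (lkan_unit D u) (lkan_counit D u)"
proof -
  have "der3 D" using derivator by (simp add: derivator_def)
  then have "\<exists>L \<eta> \<epsilon>. adjunction L (DFun D u) \<eta> \<epsilon>"
    using assms unfolding der3_def by metis
  then obtain L \<eta> \<epsilon> where "adjunction L (DFun D u) \<eta> \<epsilon>" by metis
  then have "case (L, \<eta>, \<epsilon>) of (L, \<eta>, \<epsilon>) \<Rightarrow> adjunction L (DFun D u) \<eta> \<epsilon>"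
    by simp
  then have "case lkan_adj D u of (L, \<eta>, \<epsilon>) \<Rightarrow> adjunction L (DFun D u) \<eta> \<epsilon>"
    unfolding lkan_adj_def by (rule someI)
  then show ?thesis
    by (simp add: lkan_def lkan_unit_def lkan_counit_def split_beta)
qed

text \<open>(Der4) as a universal property: the unit of the adjunction for the colimit over the
  slice is universal, and following it by the invertible canonical map gives the adjoint transpose
  of that map, which is the arrow stated here.\<close>

lemma slice_universal:
  assumes u: "funct A B u" and sm: "small_in TYPE('u) A" "small_in TYPE('u) B" and b: "b \<in> Obj B"
    and X: "X \<in> Obj (DOb D A)"
  defines "V \<equiv> OM (lkan D u) X" and "K \<equiv> comma_cat u b"
  defines "\<alpha> \<equiv> NComp (DNat D (slice_cell u b)) V"
    and "p\<eta> \<equiv> MM (DFun D (slice_proj u b)) (NComp (lkan_unit D u) X)"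
  shows "univ_arr (pull (terminal_functor K)) (OM (DFun D (slice_proj u b)) X)
      (OM (DFun D (pt B b)) V) (Comp (DC K) \<alpha> p\<eta>)"
    and "p\<eta> \<in> hom (DC K) (OM (DFun D (slice_proj u b)) X) (OM (DFun D (comp_functor u (slice_proj u b))) V)"
    and "\<alpha> \<in> hom (DC K) (OM (DFun D (comp_functor u (slice_proj u b))) V)
      (OM (pull (terminal_functor K)) (OM (DFun D (pt B b)) V))"
proof -
  note K = small_in_comma[OF u sm, of b]
  let ?p = "slice_proj u b" and ?\<pi> = "bang (slice u b)"
  note p = slice_proj_funct[OF u sm, of b]
  have sK: "small_cat (slice u b)" "slice u b = cp K"
    using cp_small[OF K] by (simp_all add: slice_def K_def)
  have su: "small_functor A B u" and sp: "small_functor (slice u b) A ?p"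
    using u p sm sK unfolding small_functor_def small_cat_iff funct_def by auto
  have \<pi>: "?\<pi> = cp_functor (terminal_functor K)" unfolding sK(2) K_def by (rule bang_cp[OF K])
  have s\<pi>: "small_functor (slice u b) one_cat ?\<pi>"
    unfolding \<pi> unfolding sK(2) one_cat_def K_def
    by (rule cp_functor_small[OF terminal_funct[OF small_inD(1)[OF K]] K unit_small])
  have spt: "small_functor one_cat B (pt B b)"
    using const_functor_funct[OF cp_category[OF unit_small] small_inD(1)[OF sm(2)] b] sm(2)
      cp_small[OF unit_small[where 'u = 'u]]
    unfolding small_functor_def pt_def one_cat_def small_cat_iff funct_def by auto
  have P: "pull (terminal_functor K) = DFun D ?\<pi>" "DC K = DOb D (slice u b)"
    unfolding pull_def \<pi> DC_def by (simp_all add: sK(2))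
  note fu = D_funct[OF su] and fp = D_funct[OF sp] and f\<pi> = D_funct[OF s\<pi>] and fpt = D_funct[OF spt]
  note adj = lkan_adjunction[OF su]
  have V: "V \<in> Obj (DOb D B)"
    unfolding V_def by (rule funct_obj[OF adjunction_functs(1)[OF adj fu] X])
  let ?N = "OM (DFun D (pt B b)) V" and ?M = "OM (DFun D ?p) X"
  have N: "?N \<in> Obj (DOb D one_cat)" by (rule funct_obj[OF fpt V])
  have M: "?M \<in> Obj (DOb D (slice u b))" by (rule funct_obj[OF fp X])
  have c: "OM (DFun D (comp_functor u ?p)) V = OM (DFun D ?p) (OM (DFun D u) V)"
    using D_comp[OF sp su] fu V by simp
  have p\<eta>: "p\<eta> \<in> hom (DOb D (slice u b)) ?M (OM (DFun D (comp_functor u ?p)) V)"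
    unfolding c p\<eta>_def unfolding V_def by (rule funct_hom[OF fp unit_hom[OF adj fu X]])
  then show "p\<eta> \<in> hom (DC K) ?M (OM (DFun D (comp_functor u ?p)) V)" by (simp add: P)
  have "small_nat (comp_functor u ?p) (const_functor (slice u b) B b) (slice_cell u b)"
    using slice_cell_natt[OF u sm b] sK sm p u
    unfolding small_nat_def natt_def small_cat_iff by simp
  then have nn: "natt (DFun D (comp_functor u ?p)) (DFun D (comp_functor (pt B b) ?\<pi>)) (DNat D (slice_cell u b))"
    unfolding slice_cell_eq(2)[OF u sm b] by (rule D_nat)
  have "funct (DOb D B) (DOb D (slice u b)) (DFun D (comp_functor u ?p))"
    unfolding D_comp[OF sp su] by (rule comp_functor_funct[OF fu fp])
  note nattD(2)[OF nn this V]
  then have \<alpha>: "\<alpha> \<in> hom (DOb D (slice u b)) (OM (DFun D (comp_functor u ?p)) V) (OM (DFun D ?\<pi>) ?N)"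
    using V fpt unfolding \<alpha>_def D_comp[OF s\<pi> spt] by simp
  then show "\<alpha> \<in> hom (DC K) (OM (DFun D (comp_functor u ?p)) V) (OM (pull (terminal_functor K)) ?N)"
    by (simp add: P)
  let ?g = "Comp (DOb D (slice u b)) \<alpha> p\<eta>"
  have g: "?g \<in> hom (DOb D (slice u b)) ?M (OM (DFun D ?\<pi>) ?N)"
    by (rule comp_hom[OF funct_cat_tgt[OF fp] p\<eta> \<alpha>])
  note adj\<pi> = lkan_adjunction[OF s\<pi>]
  note L = adjunction_functs(1)[OF adj\<pi> f\<pi>]
  let ?c = "Comp (DOb D one_cat) (NComp (lkan_counit D ?\<pi>) ?N) (MM (lkan D ?\<pi>) ?g)"
  \<comment> \<open>The definition of the canonical map applies the left adjoint to the two factors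
    of \<open>?g\<close> separately; functoriality joins them.\<close>
  have "?c = lkan_canon D u b X"
    unfolding lkan_canon_def Let_def funct_tgt[OF u] funct_comp[OF L p\<eta> \<alpha>]
    by (simp add: \<alpha>_def p\<eta>_def V_def)
  then have "iso_arr (DOb D one_cat) ?c"
    using derivator su b X unfolding derivator_def der4_def by auto
  from univ_arr_iso_cod[OF adjunction_universal[OF adj\<pi> f\<pi> M] f\<pi> this
      comp_hom[OF funct_cat_src[OF f\<pi>] funct_hom[OF L g] counit_hom[OF adj\<pi> f\<pi> N]]]
  show "univ_arr (pull (terminal_functor K)) ?M ?N (Comp (DC K) \<alpha> p\<eta>)"
    unfolding adjunction_transpose[OF adj\<pi> f\<pi> M N g] P .
qed

end

section \<open>Pointwise left Kan extensions\<close>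

lemma funct_iso:
  assumes "funct A B F" "iso_arr A f" "f \<in> hom A x y"
  shows "iso_arr B (MM F f)"
proof -
  obtain g where g: "g \<in> hom A y x" "Comp A g f = Ident A x" "Comp A f g = Ident A y"
    using iso_arrE[OF assms(2,3)] .
  have "x \<in> Obj A" "y \<in> Obj A" using hom_objs[OF funct_cat_src[OF assms(1)] assms(3)] by auto
  then show ?thesis
    using funct_comp[OF assms(1,3) g(1)] funct_comp[OF assms(1) g(1) assms(3)] g(2,3)
      funct_ident[OF assms(1)]
    by (intro iso_arrI[OF funct_hom[OF assms(1,3)] funct_hom[OF assms(1) g(1)]]) simp_all
qed

lemma univ_arr_ident:
  assumes "category A" "N \<in> Obj A"
  shows "univ_arr (id_functor A) N N (Ident A N)"
  unfolding univ_arr_def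
proof (intro conjI ballI)
  fix E h assume "E \<in> Obj (Src (id_functor A))" "h \<in> hom (Tgt (id_functor A)) N (OM (id_functor A) E)"
  then have h: "h \<in> hom A N E" by simp
  have "MM (id_functor A) f = f \<and> Comp A f (Ident A N) = f" if "f \<in> hom A N E" for f
    using that ident_right[OF assms(1) that] by (simp add: hom_arr)
  then show "\<exists>!f. f \<in> hom (Src (id_functor A)) N E \<and>
      Comp (Tgt (id_functor A)) (MM (id_functor A) f) (Ident A N) = h"
    using h by (intro ex1I[of _ h]) auto
qed (use assms ident_hom in auto)

text \<open>Universality of an identity arrow says that every arrow out of \<open>OM R N\<close>
  into the image of \<open>R\<close> lifts uniquely.\<close>

lemma univ_arr_ident_bij:
  assumes R: "funct A B R" and u: "univ_arr R (OM R N) N (Ident B (OM R N))" and E: "E \<in> Obj A"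
  shows "bij_betw (MM R) (hom A N E) (hom B (OM R N) (OM R E))"
proof -
  note r = ident_right[OF funct_cat_tgt[OF R] funct_hom[OF R]]
  have "inj_on (MM R) (hom A N E)"
    using univ_arr_unique[OF u R, of _ E] r by (intro inj_onI) metis
  moreover have "MM R ` hom A N E = hom B (OM R N) (OM R E)"
  proof (intro equalityI subsetI)
    fix h assume "h \<in> hom B (OM R N) (OM R E)"
    then obtain f where "f \<in> hom A N E" "Comp B (MM R f) (Ident B (OM R N)) = h"
      using univ_arr_ex[OF u R E] by metis
    then show "h \<in> MM R ` hom A N E" using r by auto
  qed (use funct_hom[OF R] in auto)
  ultimately show ?thesis by (simp add: bij_betw_def)
qed

definition fully_faithful :: "('o, 'm, 'p, 'n) ftor \<Rightarrow> bool" where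
  "fully_faithful u \<longleftrightarrow> (\<forall>a\<in>Obj (Src u). \<forall>b\<in>Obj (Src u).
     bij_betw (MM u) (hom (Src u) a b) (hom (Tgt u) (OM u a) (OM u b)))"

text \<open>A terminal object is a right adjoint to the functor into the terminal category, so
  cocones over \<open>K\<close> can be tested at \<open>t\<close> alone.\<close>

lemma terminal_reflection:
  assumes K: "category K" and t: "t \<in> Obj K" and ex1: "\<And>k. k \<in> Obj K \<Longrightarrow> \<exists>!f. f \<in> hom K k t"
  obtains \<eta> where "reflection K unit_cat (point K t) (terminal_functor K) \<eta>"
proof
  let ?f = "\<lambda>k. THE f. f \<in> hom K k t"
  let ?\<eta> = "\<lparr>NSrc = id_functor K, NTgt = const_functor K K t, NComp = (\<lambda>k\<in>Obj K. ?f k)\<rparr>"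
  have f: "?f k \<in> hom K k t" if "k \<in> Obj K" for k
    using theI'[OF ex1[OF that]] .
  \<comment> \<open>This yields both naturality of the unit and its triviality at
    \<open>t\<close>.\<close>
  have eq: "g = h" if "g \<in> hom K k t" "h \<in> hom K k t" for g h k
    using ex1[of k] hom_objs[OF K that(1)] that by blast
  have "natt (id_functor K) (const_functor K K t) ?\<eta>"
  proof (rule nattI[OF id_functor_funct[OF K] const_functor_funct[OF K K t]], goal_cases)
    case (5 g)
    then have g: "g \<in> hom K (Dom K g) (Cod K g)" by (rule arr_hom)
    then have o: "Dom K g \<in> Obj K" "Cod K g \<in> Obj K" using hom_objs[OF K] by auto
    have "Comp K (?f (Cod K g)) g = Comp K (Ident K t) (?f (Dom K g))"
      by (rule eq[OF comp_hom[OF K g f[OF o(2)]] comp_hom[OF K f[OF o(1)] ident_hom[OF K t]]])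
    then show ?case using 5 o by simp
  qed (use f in auto)
  moreover have "comp_functor (terminal_functor K) (point K t) = id_functor unit_cat"
    by (rule funct_eqI[OF comp_functor_funct[OF point_funct[OF K t] terminal_funct[OF K]]
          id_functor_funct[OF poset_category]])
      (use t ident_hom[OF K t] in \<open>auto simp: hom_arr poset_cat_def\<close>)
  moreover have "?f t = Ident K t" by (rule eq[OF f[OF t] ident_hom[OF K t]])
  ultimately show "reflection K unit_cat (point K t) (terminal_functor K) ?\<eta>"
    using point_funct[OF K t] terminal_funct[OF K] t
    by (simp add: reflection_def point_terminal[OF K t K])
qed

lemma terminal_functor_unit: "terminal_functor unit_cat = id_functor unit_cat"
  by (rule funct_eqI[OF terminal_funct[OF poset_category] id_functor_funct[OF poset_category]])
    (auto simp: poset_cat_def)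

context
  fixes A :: "('a, 'b) cat" and C :: "('c, 'd) cat" and u a
  assumes u: "funct A C u" and ff: "fully_faithful u" and a: "a \<in> Obj A"
begin

text \<open>An object of the comma category over \<open>OM u a\<close> is an arrow between images of
  \<open>u\<close>; by full faithfulness it lifts uniquely to \<open>A\<close>, and the lift is the
  unique map to the identity.\<close>

lemma comma_terminal:
  shows "(a, Ident C (OM u a)) \<in> comma_obj u (OM u a)"
    and "k \<in> comma_obj u (OM u a) \<Longrightarrow> \<exists>!x. x \<in> hom (comma_cat u (OM u a)) k (a, Ident C (OM u a))"
proof -
  note C = funct_cat_tgt[OF u]
  note i = ident_hom[OF C funct_obj[OF u a]]
  show t: "(a, Ident C (OM u a)) \<in> comma_obj u (OM u a)"
    using a i by (simp add: comma_obj_iff[OF u])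
  assume k: "k \<in> comma_obj u (OM u a)"
  then obtain b f where b: "k = (b, f)" "b \<in> Obj A" "f \<in> hom C (OM u b) (OM u a)"
    using comma_obj_iff[OF u] by (cases k) auto
  have bij: "bij_betw (MM u) (hom A b a) (hom C (OM u b) (OM u a))"
    using ff a b(2) u by (simp add: fully_faithful_def)
  then obtain g where g: "g \<in> hom A b a" "MM u g = f"
    using b(3) unfolding bij_betw_def by (metis imageE)
  have id: "Comp C (Ident C (OM u a)) (MM u h) = MM u h" if "h \<in> hom A b a" for h
    using ident_left[OF C funct_hom[OF u that]] .
  show "\<exists>!x. x \<in> hom (comma_cat u (OM u a)) k (a, Ident C (OM u a))"
  proof (rule ex1I)
    show "(k, g, (a, Ident C (OM u a))) \<in> hom (comma_cat u (OM u a)) k (a, Ident C (OM u a))"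
      using k t b g id[OF g(1)] by (simp add: comma_hom_iff[OF u])
    fix x assume "x \<in> hom (comma_cat u (OM u a)) k (a, Ident C (OM u a))"
    then obtain h where h: "x = (k, h, (a, Ident C (OM u a)))" "h \<in> hom A b a" "MM u h = f"
      using b id by (auto simp: comma_hom_iff[OF u])
    then show "x = (k, g, (a, Ident C (OM u a)))"
      using g bij_betw_imp_inj_on[OF bij] by (auto dest: inj_onD)
  qed
qed

text \<open>Restricted to the terminal object, the tautological cocone becomes an identity 2-cell,
  so \<open>D\<close> sends it to identities.\<close>

lemma comma_terminal_point:
  defines "t \<equiv> point (comma_cat u (OM u a)) (a, Ident C (OM u a))"
  shows "funct unit_cat (comma_cat u (OM u a)) t"
    and "comp_functor (comma_proj (comma_cat u (OM u a)) A) t = point A a"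
    and "hcomp (comma_cell u (OM u a)) (id_nat t) = id_nat (point C (OM u a))"
proof -
  let ?K = "comma_cat u (OM u a)" and ?p = "comma_proj (comma_cat u (OM u a)) A"
  have o: "(a, Ident C (OM u a)) \<in> Obj ?K" using comma_terminal(1) by simp
  note ua = funct_obj[OF u a] and p = comma_proj_funct[OF u, of "OM u a"] and C = funct_cat_tgt[OF u]
  show t: "funct unit_cat ?K t" unfolding t_def by (rule point_funct[OF comma_category[OF u] o])
  show pt: "comp_functor ?p t = point A a"
    unfolding t_def comp_point[OF p o] using o by simp
  have n: "natt (comp_functor u ?p) (const_functor ?K C (OM u a)) (comma_cell u (OM u a))"
    by (rule comma_cell_natt[OF u ua])
  show "hcomp (comma_cell u (OM u a)) (id_nat t) = id_nat (point C (OM u a))"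
  proof (rule natt_eqI[OF _ id_nat_natt[OF point_funct[OF C ua]] point_funct[OF C ua]])
    show "natt (point C (OM u a)) (point C (OM u a)) (hcomp (comma_cell u (OM u a)) (id_nat t))"
      using hcomp_natt[OF id_nat_natt[OF t] t n comp_functor_funct[OF p u]]
      by (simp add: comp_const_functor[OF t C ua] comp_functor_assoc[OF t p u, symmetric] pt
          comp_point[OF u a])
    fix x assume "x \<in> Obj unit_cat"
    then show "NComp (hcomp (comma_cell u (OM u a)) (id_nat t)) x = NComp (id_nat (point C (OM u a))) x"
      using hcomp_id_right[OF n comp_functor_funct[OF p u] t, of x] o
      by (simp add: t_def comma_cell_def)
  qed
qed

end

text \<open>Compares the 2-cell of the copied functor, about which (Der4) speaks, with the one of
  \<open>u\<close>. The components agree after decoding.\<close>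

lemma comma_cell_cp:
  fixes u :: "('a, 'b, 'c, 'd) ftor"
  assumes u: "funct A C u" and sm: "small_in TYPE('u::infinite) A" "small_in TYPE('u) C" and c: "c \<in> Obj C"
  defines "cu \<equiv> cp_functor u :: 'u sftor" and "c' \<equiv> enc (Obj C) c :: 'u"
  defines "s \<equiv> comma_map u c cu c' (cp_to A) (cp_to C)"
  shows "comp_functor (slice_proj cu c') (cp_functor s) = cp_functor (comma_proj (comma_cat u c) A)"
    and "hcomp (slice_cell cu c') (id_nat (cp_functor s)) = cp_nat (comma_cell u c)"
proof -
  let ?K = "comma_cat u c" and ?K' = "comma_cat cu c'"
  let ?p = "comma_proj (comma_cat u c) A"
  have cu: "funct (cp A) (cp C) cu" unfolding cu_def by (rule cp_functor_funct[OF u sm])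
  have smc: "small_in TYPE('u) (cp A :: 'u scat)" "small_in TYPE('u) (cp C :: 'u scat)"
    using cp_small[OF sm(1)] cp_small[OF sm(2)] by (auto simp: small_cat_iff)
  have c': "c' \<in> Obj (cp C)" using c by (simp add: c'_def cp_obj)
  note smK = small_in_comma[OF u sm, of c] and smK' = small_in_comma[OF cu smc, of c']
  have s: "funct ?K ?K' s"
    using reflectionD(1)[OF comma_cp_reflection[OF u sm c]] by (simp add: s_def cu_def c'_def)
  note p = comma_proj_funct[OF u, of c] and up = comp_functor_funct[OF comma_proj_funct[OF u] u]
  note cs = cp_functor_funct[OF s smK smK']
  have sp: "funct (cp ?K') (cp A) (slice_proj cu c')"
    using slice_proj_funct[OF cu smc] by (simp add: slice_def)
  have so: "OM s y = (enc (Obj A) (fst y), enc (Arr C) (snd y))" if y: "y \<in> Obj ?K" for y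
  proof (cases y)
    case (Pair b f)
    then have "b \<in> Obj A" "f \<in> Arr C"
      using y comma_obj_iff[OF u, of b f c] by (auto dest: hom_arr)
    then show ?thesis
      using y Pair by (simp add: s_def comma_map_simps cp_to_simps[OF sm(1)] cp_to_simps[OF sm(2)])
  qed
  have sa: "fst (snd (MM s y)) = enc (Arr A) (fst (snd y))" if y: "y \<in> Arr ?K" for y
  proof -
    obtain b f g d h where "y = ((b, f), g, (d, h))" "g \<in> hom A b d"
      using comma_arrE[OF y u] by metis
    then show ?thesis
      using y by (simp add: s_def comma_map_simps cp_to_simps[OF sm(1)] hom_arr)
  qed
  show e1: "comp_functor (slice_proj cu c') (cp_functor s) = cp_functor ?p"
  proof (rule funct_eqI[OF comp_functor_funct[OF cs sp] cp_functor_funct[OF p smK sm(1)]])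
    fix x assume x: "x \<in> Obj (cp ?K :: 'u scat)"
    then obtain y where y: "y \<in> Obj ?K" "x = enc (Obj ?K) y" by (auto simp: cp_obj)
    show "OM (comp_functor (slice_proj cu c') (cp_functor s)) x = OM (cp_functor ?p) x"
      using x y cs funct_obj[OF s y(1)] so[OF y(1)] cp_from_simps(3)[OF smK' funct_obj[OF s y(1)]]
        cp_functor_simps(1)[OF s smK smK' y(1)] cp_functor_simps(1)[OF p smK sm(1) y(1)]
      by (simp add: slice_proj_def cp_from_simps(1)[OF smK'] cp_obj)
  next
    fix x assume x: "x \<in> Arr (cp ?K :: 'u scat)"
    then obtain y where y: "y \<in> Arr ?K" "x = enc (Arr ?K) y" by (auto simp: cp_arr)
    show "MM (comp_functor (slice_proj cu c') (cp_functor s)) x = MM (cp_functor ?p) x"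
      using x y cs funct_arr[OF s y(1)] sa[OF y(1)] cp_from_simps(4)[OF smK' funct_arr[OF s y(1)]]
        cp_functor_simps(2)[OF s smK smK' y(1)] cp_functor_simps(2)[OF p smK sm(1) y(1)]
      by (simp add: slice_proj_def cp_from_simps(1)[OF smK'] cp_arr)
  qed
  note scn = slice_cell_natt[OF cu smc c', unfolded slice_def]
  note cn = comma_cell_natt[OF u c]
  have cusp: "funct (cp ?K') (cp C) (comp_functor cu (slice_proj cu c'))"
    by (rule comp_functor_funct[OF sp cu])
  show "hcomp (slice_cell cu c') (id_nat (cp_functor s)) = cp_nat (comma_cell u c)"
  proof (rule natt_eqI[OF _ cp_nat_natt[OF up cn smK sm(2)] cp_functor_funct[OF up smK sm(2)]])
    show "natt (cp_functor (comp_functor u ?p)) (cp_functor (const_functor ?K C c))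
        (hcomp (slice_cell cu c') (id_nat (cp_functor s)))"
      using hcomp_natt[OF id_nat_natt[OF cs] cs scn cusp]
      by (simp add: cp_functor_comp[OF p u smK sm] comp_functor_assoc[OF cs sp cu, symmetric] e1
          comp_const_functor[OF cs small_inD(1)[OF smc(2)] c'] cp_const_functor[OF c smK sm(2)]
          cu_def[symmetric] c'_def[symmetric])
    fix x assume x: "x \<in> Obj (cp ?K :: 'u scat)"
    then obtain y where y: "y \<in> Obj ?K" "x = enc (Obj ?K) y" by (auto simp: cp_obj)
    have "NComp (hcomp (slice_cell cu c') (id_nat (cp_functor s))) x = NComp (slice_cell cu c') (OM (cp_functor s) x)"
      by (rule hcomp_id_right[OF scn cusp cs x])
    also have "OM (cp_functor s) x = enc (Obj ?K') (OM s y)"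
      using cp_functor_simps(1)[OF s smK smK' y(1)] y(2) by simp
    also have "NComp (slice_cell cu c') (enc (Obj ?K') (OM s y)) = snd (OM s y)"
      using funct_obj[OF s y(1)] dec_enc[OF small_inD(2)[OF smK'], of "OM s y"]
      by (simp add: slice_cell_def slice_def cp_obj)
    also have "\<dots> = NComp (cp_nat (comma_cell u c)) x"
      using y cp_nat_comp[OF up cn smK sm(2), of y] so[OF y(1)] by (simp add: comma_cell_def)
    finally show "NComp (hcomp (slice_cell cu c') (id_nat (cp_functor s))) x = NComp (cp_nat (comma_cell u c)) x" .
  qed
qed

section \<open>Left Kan extensions detected by colimiting cocones\<close>

context derivator_setup
begin

context
  fixes A :: "('a, 'b) cat" and C :: "('c, 'd) cat" and u
  assumes u: "funct A C u" and sm: "small_in TYPE('u) A" "small_in TYPE('u) C"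
begin

lemma lkan_adj: "adjunction (lkan D (cp_functor u)) (pull u) (lkan_unit D (cp_functor u)) (lkan_counit D (cp_functor u))"
  unfolding pull_def by (rule lkan_adjunction[OF cp_functor_small[OF u sm]])

lemma lkan_funct: "funct (DC A) (DC C) (lkan D (cp_functor u))"
  by (rule adjunction_functs(1)[OF lkan_adj pull_funct[OF u sm]])

text \<open>This is \<open>slice_universal\<close> for the copy of \<open>u\<close>, pulled back
  along the isomorphism from the comma category of \<open>u\<close>. The remaining work identifies
  the pulled back object and arrow.\<close>

lemma comma_universal:
  assumes c: "c \<in> Obj C" and X: "X \<in> Obj (DC A)"
  defines "K \<equiv> comma_cat u c" and "V \<equiv> OM (lkan D (cp_functor u)) X"
  shows "univ_arr (pull (terminal_functor K)) (OM (pull (comma_proj K A)) X) (OM (pull (point C c)) V)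
    (Comp (DC K) (cell (comma_cell u c) V)
      (MM (pull (comma_proj K A)) (NComp (lkan_unit D (cp_functor u)) X)))"
proof -
  define cu where "cu = (cp_functor u :: 'u sftor)"
  define c' where "c' = (enc (Obj C) c :: 'u)"
  define s where "s = comma_map u c cu c' (cp_to A) (cp_to C)"
  let ?K' = "comma_cat cu c'"
  let ?\<eta> = "NComp (lkan_unit D cu) X"
  have cu: "funct (cp A) (cp C) cu" unfolding cu_def by (rule cp_functor_funct[OF u sm])
  have smc: "small_in TYPE('u) (cp A :: 'u scat)" "small_in TYPE('u) (cp C :: 'u scat)"
    using cp_small[OF sm(1)] cp_small[OF sm(2)] by (auto simp: small_cat_iff)
  have c': "c' \<in> Obj (cp C)" using c by (simp add: c'_def cp_obj)
  note smK = small_in_comma[OF u sm, of c] and smK' = small_in_comma[OF cu smc, of c']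
  have refl: "reflection ?K' K s (comma_map cu c' u c (cp_from A) (cp_from C)) (id_nat (id_functor ?K'))"
    unfolding K_def s_def cu_def c'_def by (rule comma_cp_reflection[OF u sm c])
  note s = reflectionD(1)[OF refl, unfolded K_def]
  have X': "X \<in> Obj (DOb D (cp A))" using X by (simp add: DC_def)
  note U = slice_universal[OF cu smc c' X']
  note g = comp_hom[OF DC_category[OF smK'] U(2,3)]
  have V: "V \<in> Obj (DC C)" unfolding V_def by (rule funct_obj[OF lkan_funct X])
  have pt: "OM (DFun D (pt (cp C) c')) V = OM (pull (point C c)) V"
    unfolding c'_def pt_cp[OF sm(2) c] pull_def ..
  have V': "OM (lkan D cu) X = V" by (simp add: V_def cu_def)
  note cs = cp_functor_funct[OF s smK smK']
  have sp: "funct (cp ?K') (cp A) (slice_proj cu c')"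
    using slice_proj_funct[OF cu smc] by (simp add: slice_def)
  have ssp: "small_functor (cp ?K') (cp A) (slice_proj cu c')"
    using sp cp_small[OF smK'] cp_small[OF sm(1)] unfolding small_functor_def funct_def by blast
  note ps = pull_funct[OF s smK smK']
  note e = comma_cell_cp[OF u sm c, folded cu_def c'_def, folded s_def]
  have sp_o: "OM (pull s) (OM (DFun D (slice_proj cu c')) X) = OM (pull (comma_proj K A)) X"
    using D_comp[OF cp_functor_small[OF s smK smK'] ssp] e(1) X' D_funct[OF ssp]
    by (simp add: pull_def K_def)
  have \<eta>: "?\<eta> \<in> hom (DC A) X (OM (pull u) V)"
    unfolding V_def cu_def by (rule unit_hom[OF lkan_adj pull_funct[OF u sm] X])
  have sp_m: "MM (pull s) (MM (DFun D (slice_proj cu c')) ?\<eta>) = MM (pull (comma_proj K A)) ?\<eta>"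
    using D_comp[OF cp_functor_small[OF s smK smK'] ssp] e(1) hom_arr[OF \<eta>] D_funct[OF ssp]
    by (simp add: pull_def K_def DC_def)
  have scn: "natt (comp_functor cu (slice_proj cu c')) (const_functor (cp ?K') (cp C) c') (slice_cell cu c')"
    using slice_cell_natt[OF cu smc c'] by (simp add: slice_def)
  have sscn: "small_nat (comp_functor cu (slice_proj cu c')) (const_functor (cp ?K') (cp C) c') (slice_cell cu c')"
    using scn cp_small[OF smK'] cp_small[OF sm(2)] sp cu
    unfolding small_nat_def natt_def by simp
  have "DNat D (hcomp (slice_cell cu c') (id_nat (cp_functor s)))
      = hcomp (DNat D (id_nat (cp_functor s))) (DNat D (slice_cell cu c'))"
    using cs cp_small[OF smK] cp_small[OF smK'] id_nat_natt[OF cs] sp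
    by (intro D_hcomp[OF _ sscn]) (auto simp: small_nat_def natt_def)
  \<comment> \<open>The comma cell is the slice cell whiskered with \<open>s\<close>, so its
    components are images under the pullback along \<open>s\<close>.\<close>
  then have "cell (comma_cell u c) V = NComp (hcomp (id_nat (pull s)) (DNat D (slice_cell cu c'))) V"
    unfolding cell_def e(2)[symmetric] D_id_nat[OF cp_functor_small[OF s smK smK']] pull_def by simp
  also have "\<dots> = MM (pull s) (NComp (DNat D (slice_cell cu c')) V)"
    using hcomp_id_left[OF D_nat[OF sscn] D_funct ps[unfolded DC_def[of ?K']]] V
      comp_functor_funct[OF sp cu] cp_small[OF smK'] cp_small[OF sm(2)]
    unfolding small_functor_def funct_def DC_def[of C] by blast
  finally have sc: "MM (pull s) (NComp (DNat D (slice_cell cu c')) V) = cell (comma_cell u c) V" ..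
  show ?thesis
    using iffD1[OF reflection_universal[OF refl smK' smK[folded K_def] _ g[unfolded V' pt]] U(1)[unfolded V' pt]]
      pull_point_obj[OF sm(2) c V] funct_comp[OF ps U(2,3)]
    unfolding V' sp_o sp_m sc by (simp add: K_def cu_def)
qed

lemma comma_proj_pull:
  "W \<in> Obj (DC C) \<Longrightarrow> OM (pull (comp_functor u (comma_proj (comma_cat u c) A))) W =
      OM (pull (comma_proj (comma_cat u c) A)) (OM (pull u) W)"
  "f \<in> hom (DC C) W W' \<Longrightarrow> MM (pull (comp_functor u (comma_proj (comma_cat u c) A))) f =
      MM (pull (comma_proj (comma_cat u c) A)) (MM (pull u) f)"
  using pull_comp_obj[OF comma_proj_funct[OF u] u small_in_comma[OF u sm] sm]
    pull_comp_arr[OF comma_proj_funct[OF u] u small_in_comma[OF u sm] sm] by auto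

text \<open>By (Der2) it suffices to look at each \<open>a\<close>. Restricting the universal arrow
  over (u/u a) to the terminal object leaves the unit at \<open>a\<close>; it is universal for an
  identity functor, hence invertible.\<close>

lemma unit_iso:
  assumes ff: "fully_faithful u" and X: "X \<in> Obj (DC A)"
  shows "iso_arr (DC A) (NComp (lkan_unit D (cp_functor u)) X)"
proof -
  let ?\<eta> = "NComp (lkan_unit D (cp_functor u)) X" and ?V = "OM (lkan D (cp_functor u)) X"
  have \<eta>: "?\<eta> \<in> hom (DC A) X (OM (pull u) ?V)"
    by (rule unit_hom[OF lkan_adj pull_funct[OF u sm] X])
  have V: "?V \<in> Obj (DC C)" by (rule funct_obj[OF lkan_funct X])
  have "iso_arr (DC unit_cat) (MM (pull (point A a)) ?\<eta>)" if a: "a \<in> Obj A" for a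
  proof -
    let ?K = "comma_cat u (OM u a)" and ?p = "comma_proj (comma_cat u (OM u a)) A"
    let ?t = "point ?K (a, Ident C (OM u a))"
    let ?\<alpha> = "comma_cell u (OM u a)"
    note smK = small_in_comma[OF u sm, of "OM u a"] and p = comma_proj_funct[OF u, of "OM u a"]
    note ua = funct_obj[OF u a]
    obtain \<theta> where refl: "reflection ?K unit_cat ?t (terminal_functor ?K) \<theta>"
      using terminal_reflection[OF comma_category[OF u]] comma_terminal[OF u ff a]
      by (metis comma_cat_simps(1))
    note t = comma_terminal_point[OF u ff a]
    note U = comma_universal[OF ua X]
    have p\<eta>: "MM (pull ?p) ?\<eta> \<in> hom (DC ?K) (OM (pull ?p) X) (OM (pull (comp_functor u ?p)) ?V)"
      unfolding comma_proj_pull(1)[OF V] by (rule funct_hom[OF pull_funct[OF p smK sm(1)] \<eta>])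
    note n = comma_cell_natt[OF u ua] and up = comp_functor_funct[OF p u]
    note \<alpha> = cocone_hom[OF n up ua smK sm(2) V]
    note pt = pull_funct[OF t(1) unit_small smK]
    have "MM (pull ?t) (Comp (DC ?K) (cell ?\<alpha> ?V) (MM (pull ?p) ?\<eta>)) =
        Comp (DC unit_cat) (MM (pull ?t) (cell ?\<alpha> ?V)) (MM (pull ?t) (MM (pull ?p) ?\<eta>))"
      by (rule funct_comp[OF pt p\<eta> \<alpha>])
    also have "MM (pull ?t) (MM (pull ?p) ?\<eta>) = MM (pull (point A a)) ?\<eta>"
      using pull_comp_arr[OF t(1) p unit_small smK sm(1) \<eta>] t(2) by simp
    also have "MM (pull ?t) (cell ?\<alpha> ?V) = Ident (DC unit_cat) (OM (pull (point C (OM u a))) ?V)"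
      using cell_whisker_right[OF n up smK sm(2) t(1) unit_small V] t(3)
        cell_id[OF point_funct[OF small_inD(1)[OF sm(2)] ua] unit_small sm(2) V] by simp
    also have "OM (pull (point C (OM u a))) ?V = OM (pull (point A a)) (OM (pull u) ?V)"
      using pull_comp_obj[OF point_funct[OF small_inD(1)[OF sm(1)] a] u unit_small sm V]
        comp_point[OF u a] by simp
    also have "Comp (DC unit_cat) (Ident (DC unit_cat) \<dots>) (MM (pull (point A a)) ?\<eta>) = MM (pull (point A a)) ?\<eta>"
      by (rule ident_left[OF DC_category[OF unit_small]
            funct_hom[OF pull_funct[OF point_funct[OF small_inD(1)[OF sm(1)] a] unit_small sm(1)] \<eta>]])
    finally have e: "MM (pull ?t) (Comp (DC ?K) (cell ?\<alpha> ?V) (MM (pull ?p) ?\<eta>)) = MM (pull (point A a)) ?\<eta>" .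
    show ?thesis
      using iffD1[OF reflection_universal[OF refl smK unit_small pull_point_obj[OF sm(2) ua V]
          comp_hom[OF DC_category[OF smK] p\<eta> \<alpha>]] U]
      unfolding e terminal_functor_unit pull_id[OF unit_small]
      by (rule univ_arr_id_iso[OF DC_category[OF unit_small]])
  qed
  then show ?thesis using iso_pointwise[OF sm(1) hom_arr[OF \<eta>]] by blast
qed

text \<open>The shape has a terminal object, where the cocone restricts to an identity. Hence
  membership in the essential image is a condition only at objects outside the image of
  \<open>u\<close>.\<close>

lemma colimiting_at_image:
  assumes ff: "fully_faithful u" and a: "a \<in> Obj A" and W: "W \<in> Obj (DC C)"
  shows "colimiting C (OM u a) (comma_cell u (OM u a)) W"
proof -
  let ?K = "comma_cat u (OM u a)" and ?c = "OM u a"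
  note smK = small_in_comma[OF u sm, of ?c] and p = comma_proj_funct[OF u, of ?c]
  note ua = funct_obj[OF u a] and C = small_inD(1)[OF sm(2)]
  note n = comma_cell_natt[OF u ua] and up = comp_functor_funct[OF p u]
  note pc = point_funct[OF C ua]
  obtain \<theta> where refl: "reflection ?K unit_cat (point ?K (a, Ident C ?c)) (terminal_functor ?K) \<theta>"
    using terminal_reflection[OF comma_category[OF u]] comma_terminal[OF u ff a]
    by (metis comma_cat_simps(1))
  have "colimiting C ?c (id_nat (point C ?c)) W"
    unfolding colimiting_iff[OF id_nat_natt[OF pc] pc] terminal_functor_unit pull_id[OF unit_small]
      cell_id[OF pc unit_small sm(2) W]
    by (rule univ_arr_ident[OF DC_category[OF unit_small] pull_point_obj[OF sm(2) ua W]])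
  then show ?thesis
    unfolding colimiting_reflection[OF refl n up ua smK unit_small sm(2) W]
      comma_terminal_point(3)[OF u ff a] .
qed

text \<open>For a left Kan extension itself, cancelling the invertible unit in
  \<open>comma_universal\<close> leaves the tautological cocone. An isomorphism \<open>e\<close>
  then carries the property to \<open>X\<close>.\<close>

lemma ess_image_colimiting:
  assumes ff: "fully_faithful u" and X: "X \<in> ess_image (lkan D (cp_functor u))" and c: "c \<in> Obj C"
  shows "colimiting C c (comma_cell u c) X"
proof -
  let ?K = "comma_cat u c" and ?p = "comma_proj (comma_cat u c) A" and ?\<alpha> = "comma_cell u c"
  note smK = small_in_comma[OF u sm, of c] and p = comma_proj_funct[OF u, of c]
  note n = comma_cell_natt[OF u c] and up = comp_functor_funct[OF p u]
  note CK = DC_category[OF smK]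
  obtain Y where Y: "Y \<in> Obj (DC A)" and X: "X \<in> Obj (DC C)"
    and i: "isomorphic (DC C) (OM (lkan D (cp_functor u)) Y) X"
    using X lkan_funct unfolding ess_image_def by auto
  obtain e where e': "iso_arr (DC C) e" "Dom (DC C) e = OM (lkan D (cp_functor u)) Y" "Cod (DC C) e = X"
    using i unfolding isomorphic_def by auto
  then have e: "iso_arr (DC C) e" "e \<in> hom (DC C) (OM (lkan D (cp_functor u)) Y) X"
    by (auto simp: hom_def iso_arr_def)
  let ?V = "OM (lkan D (cp_functor u)) Y" and ?\<eta> = "NComp (lkan_unit D (cp_functor u)) Y"
  have V: "?V \<in> Obj (DC C)" by (rule funct_obj[OF lkan_funct Y])
  have \<eta>: "?\<eta> \<in> hom (DC A) Y (OM (pull u) ?V)"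
    by (rule unit_hom[OF lkan_adj pull_funct[OF u sm] Y])
  note pp = pull_funct[OF p smK sm(1)] and pc = pull_funct[OF point_funct[OF small_inD(1)[OF sm(2)] c] unit_small sm(2)]
  note pt = pull_terminal_funct[OF smK] and pup = pull_funct[OF up smK sm(2)]
  note p\<eta> = funct_hom[OF pp \<eta>]
  \<comment> \<open>This is the inverse of the restricted unit; composing with it removes the unit
    from the universal arrow.\<close>
  obtain k where k: "k \<in> hom (DC ?K) (OM (pull ?p) (OM (pull u) ?V)) (OM (pull ?p) Y)"
    "Comp (DC ?K) k (MM (pull ?p) ?\<eta>) = Ident (DC ?K) (OM (pull ?p) Y)"
    "Comp (DC ?K) (MM (pull ?p) ?\<eta>) k = Ident (DC ?K) (OM (pull ?p) (OM (pull u) ?V))"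
    using iso_arrE[OF funct_iso[OF pp unit_iso[OF ff Y] \<eta>] p\<eta>] .
  have ki: "iso_arr (DC ?K) k" by (rule iso_arrI[OF k(1) p\<eta> k(3,2)])
  have \<alpha>V: "cell ?\<alpha> ?V \<in> hom (DC ?K) (OM (pull ?p) (OM (pull u) ?V))
      (OM (pull (terminal_functor ?K)) (OM (pull (point C c)) ?V))"
    using cocone_hom[OF n up c smK sm(2) V] comma_proj_pull(1)[OF V] by simp
  have "univ_arr (pull (terminal_functor ?K)) (OM (pull ?p) (OM (pull u) ?V)) (OM (pull (point C c)) ?V)
      (Comp (DC ?K) (Comp (DC ?K) (cell ?\<alpha> ?V) (MM (pull ?p) ?\<eta>)) k)"
    by (rule univ_arr_iso_dom[OF comma_universal[OF c Y] pt ki k(1)])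
  also have "Comp (DC ?K) (Comp (DC ?K) (cell ?\<alpha> ?V) (MM (pull ?p) ?\<eta>)) k = cell ?\<alpha> ?V"
    using comp_assoc[OF CK k(1) p\<eta> \<alpha>V] k(3) ident_right[OF CK \<alpha>V] by simp
  finally have "univ_arr (pull (terminal_functor ?K)) (OM (pull ?p) (OM (pull u) ?V))
      (OM (pull (point C c)) ?V) (cell ?\<alpha> ?V)" .
  note u1 = univ_arr_iso_cod[OF this pt funct_iso[OF pc e] funct_hom[OF pc e(2)]]
  have e': "MM (pull (comp_functor u ?p)) e \<in> hom (DC ?K) (OM (pull ?p) (OM (pull u) ?V)) (OM (pull (comp_functor u ?p)) X)"
    using funct_hom[OF pup e(2)] comma_proj_pull(1)[OF V] by simp
  have const: "MM (pull (terminal_functor ?K)) (MM (pull (point C c)) e) = MM (pull (const_functor ?K C c)) e"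
    using pull_comp_arr[OF terminal_funct[OF small_inD(1)[OF smK]] point_funct[OF small_inD(1)[OF sm(2)] c] smK unit_small sm(2) e(2)]
      point_terminal[OF small_inD(1)[OF sm(2)] c small_inD(1)[OF smK]] by simp
  \<comment> \<open>Naturality moves \<open>e\<close> from the vertex to the diagram, where its
    inverse can be applied at the source of the universal arrow.\<close>
  have "Comp (DC ?K) (MM (pull (terminal_functor ?K)) (MM (pull (point C c)) e)) (cell ?\<alpha> ?V) =
      Comp (DC ?K) (cell ?\<alpha> X) (MM (pull (comp_functor u ?p)) e)"
    unfolding const by (rule cell_naturality[OF n up smK sm(2) e(2), symmetric])
  note u2 = u1[unfolded this]
  obtain k' where k': "k' \<in> hom (DC ?K) (OM (pull (comp_functor u ?p)) X) (OM (pull ?p) (OM (pull u) ?V))"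
    "Comp (DC ?K) k' (MM (pull (comp_functor u ?p)) e) = Ident (DC ?K) (OM (pull ?p) (OM (pull u) ?V))"
    "Comp (DC ?K) (MM (pull (comp_functor u ?p)) e) k' = Ident (DC ?K) (OM (pull (comp_functor u ?p)) X)"
    using iso_arrE[OF funct_iso[OF pup e] e'] .
  note \<alpha>X = cocone_hom[OF n up c smK sm(2) X]
  have "univ_arr (pull (terminal_functor ?K)) (OM (pull (comp_functor u ?p)) X) (OM (pull (point C c)) X)
      (Comp (DC ?K) (Comp (DC ?K) (cell ?\<alpha> X) (MM (pull (comp_functor u ?p)) e)) k')"
    by (rule univ_arr_iso_dom[OF u2 pt iso_arrI[OF k'(1) e' k'(3,2)] k'(1)])
  also have "Comp (DC ?K) (Comp (DC ?K) (cell ?\<alpha> X) (MM (pull (comp_functor u ?p)) e)) k' = cell ?\<alpha> X"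
    using comp_assoc[OF CK k'(1) e' \<alpha>X] k'(3) ident_right[OF CK \<alpha>X] by simp
  finally show ?thesis unfolding colimiting_iff[OF n up] .
qed

text \<open>At each \<open>c\<close> the counit compares two universal arrows out of the same
  diagram, that of u_!u^*X and that of \<open>X\<close>, so it is invertible there and (Der2) makes
  it invertible. Through this isomorphism \<open>X\<close> itself is universal for u^*, with an
  identity arrow, which gives the bijection on morphisms.\<close>

lemma colimiting_ess_image:
  assumes X: "X \<in> Obj (DC C)" and col: "\<And>c. c \<in> Obj C \<Longrightarrow> colimiting C c (comma_cell u c) X"
  shows "X \<in> ess_image (lkan D (cp_functor u))"
    and "Z \<in> Obj (DC C) \<Longrightarrow> bij_betw (MM (pull u)) (hom (DC C) X Z) (hom (DC A) (OM (pull u) X) (OM (pull u) Z))"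
proof -
  let ?L = "lkan D (cp_functor u)" and ?Y = "OM (pull u) X"
  note pu = pull_funct[OF u sm]
  have Y: "?Y \<in> Obj (DC A)" by (rule funct_obj[OF pu X])
  let ?V = "OM ?L ?Y" and ?\<eta> = "NComp (lkan_unit D (cp_functor u)) ?Y" and ?\<epsilon> = "NComp (lkan_counit D (cp_functor u)) X"
  have V: "?V \<in> Obj (DC C)" by (rule funct_obj[OF lkan_funct Y])
  have \<eta>: "?\<eta> \<in> hom (DC A) ?Y (OM (pull u) ?V)" by (rule unit_hom[OF lkan_adj pu Y])
  have \<epsilon>: "?\<epsilon> \<in> hom (DC C) ?V X" by (rule counit_hom[OF lkan_adj pu X])
  have tri: "Comp (DC A) (MM (pull u) ?\<epsilon>) ?\<eta> = Ident (DC A) ?Y" by (rule triangles(2)[OF lkan_adj pu X])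
  have "iso_arr (DC unit_cat) (MM (pull (point C c)) ?\<epsilon>)" if c: "c \<in> Obj C" for c
  proof -
    let ?K = "comma_cat u c" and ?p = "comma_proj (comma_cat u c) A" and ?\<alpha> = "comma_cell u c"
    note smK = small_in_comma[OF u sm, of c] and p = comma_proj_funct[OF u, of c]
    note n = comma_cell_natt[OF u c] and up = comp_functor_funct[OF p u]
    note CK = DC_category[OF smK]
    note pp = pull_funct[OF p smK sm(1)] and pc = pull_funct[OF point_funct[OF small_inD(1)[OF sm(2)] c] unit_small sm(2)]
    have X': "univ_arr (pull (terminal_functor ?K)) (OM (pull ?p) ?Y) (OM (pull (point C c)) X) (cell ?\<alpha> X)"
      using col[OF c] unfolding colimiting_iff[OF n up] comma_proj_pull(1)[OF X] .
    have \<alpha>V: "cell ?\<alpha> ?V \<in> hom (DC ?K) (OM (pull ?p) (OM (pull u) ?V))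
        (OM (pull (terminal_functor ?K)) (OM (pull (point C c)) ?V))"
      using cocone_hom[OF n up c smK sm(2) V] comma_proj_pull(1)[OF V] by simp
    have \<alpha>X: "cell ?\<alpha> X \<in> hom (DC ?K) (OM (pull ?p) ?Y) (OM (pull (terminal_functor ?K)) (OM (pull (point C c)) X))"
      using cocone_hom[OF n up c smK sm(2) X] comma_proj_pull(1)[OF X] by simp
    note c\<epsilon> = funct_hom[OF pc \<epsilon>] and p\<eta> = funct_hom[OF pp \<eta>]
    have const: "MM (pull (terminal_functor ?K)) (MM (pull (point C c)) ?\<epsilon>) = MM (pull (const_functor ?K C c)) ?\<epsilon>"
      using pull_comp_arr[OF terminal_funct[OF small_inD(1)[OF smK]] point_funct[OF small_inD(1)[OF sm(2)] c] smK unit_small sm(2) \<epsilon>]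
        point_terminal[OF small_inD(1)[OF sm(2)] c small_inD(1)[OF smK]] by simp
    note t\<epsilon> = funct_hom[OF pull_terminal_funct[OF smK] c\<epsilon>]
    note pu\<epsilon> = funct_hom[OF pp funct_hom[OF pu \<epsilon>]]
    \<comment> \<open>The counit carries the universal arrow of the Kan extension to the cocone of
      \<open>X\<close>: naturality exchanges cell and counit, and then the triangle identity
      applies.\<close>
    have "Comp (DC ?K) (MM (pull (terminal_functor ?K)) (MM (pull (point C c)) ?\<epsilon>))
        (Comp (DC ?K) (cell ?\<alpha> ?V) (MM (pull ?p) ?\<eta>)) =
        Comp (DC ?K) (Comp (DC ?K) (MM (pull (const_functor ?K C c)) ?\<epsilon>) (cell ?\<alpha> ?V)) (MM (pull ?p) ?\<eta>)"
      using comp_assoc[OF CK p\<eta> \<alpha>V t\<epsilon>] const by simp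
    also have "Comp (DC ?K) (MM (pull (const_functor ?K C c)) ?\<epsilon>) (cell ?\<alpha> ?V) =
        Comp (DC ?K) (cell ?\<alpha> X) (MM (pull ?p) (MM (pull u) ?\<epsilon>))"
      using cell_naturality[OF n up smK sm(2) \<epsilon>] comma_proj_pull(2)[OF \<epsilon>] by simp
    also have "Comp (DC ?K) (Comp (DC ?K) (cell ?\<alpha> X) (MM (pull ?p) (MM (pull u) ?\<epsilon>))) (MM (pull ?p) ?\<eta>) =
        Comp (DC ?K) (cell ?\<alpha> X) (MM (pull ?p) (Comp (DC A) (MM (pull u) ?\<epsilon>) ?\<eta>))"
      using comp_assoc[OF CK p\<eta> pu\<epsilon> \<alpha>X] funct_comp[OF pp \<eta> funct_hom[OF pu \<epsilon>]] by simp
    also have "\<dots> = cell ?\<alpha> X"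
      unfolding tri funct_ident[OF pp Y] by (rule ident_right[OF CK \<alpha>X])
    finally show ?thesis
      by (rule univ_arr_iso[OF comma_universal[OF c Y] X' pull_terminal_funct[OF smK] c\<epsilon>])
  qed
  then have iso: "iso_arr (DC C) ?\<epsilon>" using iso_pointwise[OF sm(2) hom_arr[OF \<epsilon>]] by blast
  then have "isomorphic (DC C) ?V X"
    using \<epsilon> unfolding isomorphic_def hom_def by blast
  then show "X \<in> ess_image ?L"
    using X Y lkan_funct unfolding ess_image_def by auto
  have "univ_arr (pull u) ?Y X (Comp (DC A) (MM (pull u) ?\<epsilon>) ?\<eta>)"
    by (rule univ_arr_iso_cod[OF adjunction_universal[OF lkan_adj pu Y] pu iso \<epsilon>])
  then show "Z \<in> Obj (DC C) \<Longrightarrow> bij_betw (MM (pull u)) (hom (DC C) X Z) (hom (DC A) ?Y (OM (pull u) Z))"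
    unfolding tri by (rule univ_arr_ident_bij[OF pu])
qed

end

end

section \<open>Cocones over posets\<close>

definition cocone ::
    "('a, 'b, 'c, 'd) ftor \<Rightarrow> 'c \<Rightarrow> ('a \<Rightarrow> 'd) \<Rightarrow> ('a, 'b, 'c, 'd) ntrans" where
  "cocone F c \<sigma> = \<lparr>NSrc = F, NTgt = const_functor (Src F) (Tgt F) c, NComp = restrict \<sigma> (Obj (Src F))\<rparr>"

lemma cocone_natt:
  assumes F: "funct K C F" and c: "c \<in> Obj C"
    and \<sigma>: "\<And>k. k \<in> Obj K \<Longrightarrow> \<sigma> k \<in> hom C (OM F k) c"
    and nat: "\<And>f k k'. f \<in> hom K k k' \<Longrightarrow> Comp C (\<sigma> k') (MM F f) = \<sigma> k"
  shows "natt F (const_functor K C c) (cocone F c \<sigma>)"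
proof (rule nattI[OF F const_functor_funct[OF funct_cat_src[OF F] funct_cat_tgt[OF F] c]], goal_cases)
  case (5 f)
  have o: "Dom K f \<in> Obj K" "Cod K f \<in> Obj K"
    using hom_objs[OF funct_cat_src[OF F] arr_hom[OF 5]] by auto
  then show ?case
    using 5 F nat[OF arr_hom[OF 5]] ident_left[OF funct_cat_tgt[OF F] \<sigma>[OF o(1)]]
    by (simp add: cocone_def)
qed (use F \<sigma> in \<open>auto simp: cocone_def\<close>)

text \<open>The hypotheses are a left adjoint to \<open>s\<close> in elementary terms:
  \<open>\<rho>\<close> is the reflection on objects, \<open>h\<close> the underlying arrow of the
  unit, \<open>\<kappa>\<close> its functoriality and naturality, and \<open>triv\<close> the
  triviality of counit and unit on \<open>S\<close>.\<close>

lemma comma_poset_reflection: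
  fixes q :: "('k::order, 'k \<times> 'k, 'a, 'b) ftor"
  assumes u: "funct A C u" and q: "funct (poset_cat S) A q"
    and \<sigma>: "\<And>k. k \<in> S \<Longrightarrow> \<sigma> k \<in> hom C (OM u (OM q k)) c"
    and \<sigma>_nat: "\<And>k k'. k \<in> S \<Longrightarrow> k' \<in> S \<Longrightarrow> k \<le> k' \<Longrightarrow> Comp C (\<sigma> k') (MM u (MM q (k, k'))) = \<sigma> k"
    and \<rho>: "\<And>x. x \<in> comma_obj u c \<Longrightarrow> \<rho> x \<in> S"
    and h: "\<And>a f. (a, f) \<in> comma_obj u c \<Longrightarrow> h (a, f) \<in> hom A a (OM q (\<rho> (a, f)))"
      "\<And>a f. (a, f) \<in> comma_obj u c \<Longrightarrow> Comp C (\<sigma> (\<rho> (a, f))) (MM u (h (a, f))) = f"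
    and \<kappa>: "\<And>a f b f' g. (a, f) \<in> comma_obj u c \<Longrightarrow> (b, f') \<in> comma_obj u c \<Longrightarrow> g \<in> hom A a b \<Longrightarrow>
      Comp C f' (MM u g) = f \<Longrightarrow> \<rho> (a, f) \<le> \<rho> (b, f') \<and>
        Comp A (MM q (\<rho> (a, f), \<rho> (b, f'))) (h (a, f)) = Comp A (h (b, f')) g"
    and triv: "\<And>k. k \<in> S \<Longrightarrow> \<rho> (OM q k, \<sigma> k) = k"
      "\<And>k. k \<in> S \<Longrightarrow> h (OM q k, \<sigma> k) = Ident A (OM q k)"
  defines "s \<equiv> \<lparr>Src = poset_cat S, Tgt = comma_cat u c, OM = (\<lambda>k\<in>S. (OM q k, \<sigma> k)),
    MM = (\<lambda>x\<in>Arr (poset_cat S). ((OM q (fst x), \<sigma> (fst x)), MM q x, (OM q (snd x), \<sigma> (snd x))))\<rparr>"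
  obtains r \<eta> where "reflection (comma_cat u c) (poset_cat S) s r \<eta>"
proof
  define r where "r = \<lparr>Src = comma_cat u c, Tgt = poset_cat S, OM = (\<lambda>x\<in>comma_obj u c. \<rho> x),
    MM = (\<lambda>x\<in>Arr (comma_cat u c). (\<rho> (fst x), \<rho> (snd (snd x))))\<rparr>"
  define \<eta> where "\<eta> = \<lparr>NSrc = id_functor (comma_cat u c), NTgt = comp_functor s r,
    NComp = (\<lambda>x\<in>comma_obj u c. (x, h x, (OM q (\<rho> x), \<sigma> (\<rho> x))))\<rparr>"
  note K = comma_category[OF u]
  have s_simps: "Src s = poset_cat S" "Tgt s = comma_cat u c" "k \<in> S \<Longrightarrow> OM s k = (OM q k, \<sigma> k)"
    "k \<in> S \<Longrightarrow> k' \<in> S \<Longrightarrow> k \<le> k' \<Longrightarrow> MM s (k, k') = ((OM q k, \<sigma> k), MM q (k, k'), (OM q k', \<sigma> k'))" for k k'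
    by (auto simp: s_def)
  have r_simps: "Src r = comma_cat u c" "Tgt r = poset_cat S" "x \<in> comma_obj u c \<Longrightarrow> OM r x = \<rho> x"
    "y \<in> Arr (comma_cat u c) \<Longrightarrow> MM r y = (\<rho> (fst y), \<rho> (snd (snd y)))" for x y
    by (auto simp: r_def)
  have co: "(OM q k, \<sigma> k) \<in> comma_obj u c" if "k \<in> S" for k
    using that \<sigma> funct_obj[OF q] by (simp add: comma_obj_iff[OF u])
  have qh: "MM q (k, k') \<in> hom A (OM q k) (OM q k')" if "k \<in> S" "k' \<in> S" "k \<le> k'" for k k'
    by (rule funct_hom[OF q]) (use that in \<open>simp add: hom_def\<close>)
  have sh: "((OM q k, \<sigma> k), MM q (k, k'), (OM q k', \<sigma> k')) \<in> hom (comma_cat u c) (OM q k, \<sigma> k) (OM q k', \<sigma> k')"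
    if "k \<in> S" "k' \<in> S" "k \<le> k'" for k k'
    using that co qh \<sigma>_nat by (simp add: comma_hom_iff[OF u])
  have s: "funct (poset_cat S) (comma_cat u c) s"
  proof (rule functI, goal_cases)
    case (7 f) then show ?case by (cases f) (simp add: s_simps sh)
  next
    case (9 k) then show ?case using u funct_ident[OF q] by (simp add: s_simps)
  next
    case (10 f g)
    then obtain k k' k'' where k: "f = (k, k')" "g = (k', k'')" "k \<in> S" "k' \<in> S" "k'' \<in> S" "k \<le> k'" "k' \<le> k''"
      by (cases f; cases g) auto
    then show ?case
      using u funct_comp[OF q, of "(k, k')" k k' "(k', k'')" k''] order_trans[of k k' k'']
      by (simp add: s_simps hom_def)
  qed (auto simp: s_simps poset_category K co, auto simp: s_def)
  have rm: "\<rho> (a, f) \<le> \<rho> (b, f')" if "((a, f), g, (b, f')) \<in> Arr (comma_cat u c)" for a f g b f'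
    using comma_arrE[OF that u] \<kappa> by (metis prod.inject)
  have r: "funct (comma_cat u c) (poset_cat S) r"
  proof (rule functI, goal_cases)
    case (7 x)
    then obtain a f g b f' where x: "x = ((a, f), g, (b, f'))" "(a, f) \<in> comma_obj u c" "(b, f') \<in> comma_obj u c"
      using comma_arrE[OF _ u] by metis
    then show ?case using 7 rm \<rho> by (simp add: r_simps hom_def)
  next
    case (9 x)
    then show ?case using hom_arr[OF ident_hom[OF K 9]] by (simp add: r_simps)
  next
    case (10 x y)
    have "Comp (comma_cat u c) y x \<in> Arr (comma_cat u c)"
      using K 10 unfolding category_def by blast
    then show ?case using 10 by (cases x; cases y) (simp add: r_simps)
  qed (auto simp: r_simps poset_category K \<rho>, auto simp: r_def)
  have "comp_functor r s = id_functor (poset_cat S)"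
    by (rule funct_eqI[OF comp_functor_funct[OF s r] id_functor_funct[OF poset_category]])
      (auto simp: s_simps r_simps co triv hom_arr[OF sh])
  moreover have "natt (id_functor (comma_cat u c)) (comp_functor s r) \<eta>"
  proof (rule nattI[OF id_functor_funct[OF K] comp_functor_funct[OF r s]], goal_cases)
    case (3 x)
    then show ?case using h[of "fst x" "snd x"] co \<rho>
      by (simp add: \<eta>_def r_simps s_simps comma_hom_iff[OF u])
  next
    case (5 x)
    then obtain a f g b f' where x: "x = ((a, f), g, (b, f'))" "(a, f) \<in> comma_obj u c" "(b, f') \<in> comma_obj u c"
      "g \<in> hom A a b" "Comp C f' (MM u g) = f"
      using comma_arrE[OF _ u] by metis
    then show ?case using 5 \<kappa>[OF x(2-5)] \<rho> u
      by (simp add: \<eta>_def r_simps s_simps)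
  qed (auto simp: \<eta>_def)
  ultimately show "reflection (comma_cat u c) (poset_cat S) s r \<eta>"
    using s r by (simp add: reflection_def \<eta>_def s_simps co triv funct_src[OF u])
qed

text \<open>Replaces a comma category by a finite poset. Naturality of the new cocone is part of the
  conclusion so that it can be pushed forward afterwards.\<close>

lemma (in derivator_setup) comma_colimiting_poset:
  fixes q :: "('k::order, 'k \<times> 'k, 'a, 'b) ftor"
  assumes u: "funct A C u" and c: "c \<in> Obj C" and q: "funct (poset_cat S) A q"
    and \<sigma>: "\<And>k. k \<in> S \<Longrightarrow> \<sigma> k \<in> hom C (OM u (OM q k)) c"
    and \<sigma>_nat: "\<And>k k'. k \<in> S \<Longrightarrow> k' \<in> S \<Longrightarrow> k \<le> k' \<Longrightarrow> Comp C (\<sigma> k') (MM u (MM q (k, k'))) = \<sigma> k"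
    and \<rho>: "\<And>x. x \<in> comma_obj u c \<Longrightarrow> \<rho> x \<in> S"
    and h: "\<And>a f. (a, f) \<in> comma_obj u c \<Longrightarrow> h (a, f) \<in> hom A a (OM q (\<rho> (a, f)))"
      "\<And>a f. (a, f) \<in> comma_obj u c \<Longrightarrow> Comp C (\<sigma> (\<rho> (a, f))) (MM u (h (a, f))) = f"
    and \<kappa>: "\<And>a f b f' g. (a, f) \<in> comma_obj u c \<Longrightarrow> (b, f') \<in> comma_obj u c \<Longrightarrow> g \<in> hom A a b \<Longrightarrow>
      Comp C f' (MM u g) = f \<Longrightarrow> \<rho> (a, f) \<le> \<rho> (b, f') \<and>
        Comp A (MM q (\<rho> (a, f), \<rho> (b, f'))) (h (a, f)) = Comp A (h (b, f')) g"
    and triv: "\<And>k. k \<in> S \<Longrightarrow> \<rho> (OM q k, \<sigma> k) = k"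
      "\<And>k. k \<in> S \<Longrightarrow> h (OM q k, \<sigma> k) = Ident A (OM q k)"
    and sm: "small_in TYPE('u) A" "small_in TYPE('u) C" and S: "finite S" and W: "W \<in> Obj (DC C)"
  shows "(colimiting C c (comma_cell u c) W \<longleftrightarrow> colimiting C c (cocone (comp_functor u q) c \<sigma>) W) \<and>
    natt (comp_functor u q) (const_functor (poset_cat S) C c) (cocone (comp_functor u q) c \<sigma>)"
proof -
  let ?K = "comma_cat u c" and ?p = "comma_proj (comma_cat u c) A"
  define s where "s = \<lparr>Src = poset_cat S, Tgt = comma_cat u c, OM = (\<lambda>k\<in>S. (OM q k, \<sigma> k)),
    MM = (\<lambda>x\<in>Arr (poset_cat S). ((OM q (fst x), \<sigma> (fst x)), MM q x, (OM q (snd x), \<sigma> (snd x))))\<rparr>"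
  obtain r \<eta> where refl: "reflection ?K (poset_cat S) s r \<eta>"
    unfolding s_def by (rule comma_poset_reflection[OF u q \<sigma> \<sigma>_nat \<rho> h \<kappa> triv])
  note s = reflectionD(1)[OF refl]
  note n = comma_cell_natt[OF u c] and p = comma_proj_funct[OF u, of c]
  note uq = comp_functor_funct[OF q u] and up = comp_functor_funct[OF p u]
  have n': "natt (comp_functor u q) (const_functor (poset_cat S) C c) (cocone (comp_functor u q) c \<sigma>)"
  proof (rule cocone_natt[OF uq c])
    show "\<sigma> k \<in> hom C (OM (comp_functor u q) k) c" if "k \<in> Obj (poset_cat S)" for k
      using that \<sigma> q by simp
    show "Comp C (\<sigma> k') (MM (comp_functor u q) f) = \<sigma> k" if "f \<in> hom (poset_cat S) k k'" for f k k'
      using that \<sigma>_nat q by (cases f) (auto simp: hom_def)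
  qed
  have ps: "comp_functor ?p s = q"
  proof (rule funct_eqI[OF comp_functor_funct[OF s p] q])
    fix k assume "k \<in> Obj (poset_cat S)"
    then show "OM (comp_functor ?p s) k = OM q k" using s funct_obj[OF s] by (simp add: s_def)
  next
    fix f assume "f \<in> Arr (poset_cat S)"
    then show "MM (comp_functor ?p s) f = MM q f" using s funct_arr[OF s, of f] by (simp add: s_def)
  qed
  have "hcomp (comma_cell u c) (id_nat s) = cocone (comp_functor u q) c \<sigma>"
  proof (rule natt_eqI[OF _ n' uq])
    show "natt (comp_functor u q) (const_functor (poset_cat S) C c) (hcomp (comma_cell u c) (id_nat s))"
      using hcomp_natt[OF id_nat_natt[OF s] s n up] comp_functor_assoc[OF s p u]
        comp_const_functor[OF s funct_cat_tgt[OF u] c] ps by simp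
    fix k assume k: "k \<in> Obj (poset_cat S)"
    then show "NComp (hcomp (comma_cell u c) (id_nat s)) k = NComp (cocone (comp_functor u q) c \<sigma>) k"
      using hcomp_id_right[OF n up s k] funct_obj[OF s k] q
      by (simp add: comma_cell_def cocone_def) (simp add: s_def)
  qed
  then show ?thesis
    using n' colimiting_reflection[OF refl n up c small_in_comma[OF u sm] small_in_poset[OF S] sm(2) W] by simp
qed

section \<open>Posets with a parameter\<close>

lemma prod_cat_simps [simp]:
  "Obj (prod_cat A B) = Obj A \<times> Obj B" "Arr (prod_cat A B) = Arr A \<times> Arr B"
  "Dom (prod_cat A B) = map_prod (Dom A) (Dom B)" "Cod (prod_cat A B) = map_prod (Cod A) (Cod B)"
  "Ident (prod_cat A B) = map_prod (Ident A) (Ident B)"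
  "Comp (prod_cat A B) g f = (Comp A (fst g) (fst f), Comp B (snd g) (snd f))"
  by (auto simp: prod_cat_def)

lemma prod_hom_iff: "x \<in> hom (prod_cat A B) y z \<longleftrightarrow>
    fst x \<in> hom A (fst y) (fst z) \<and> snd x \<in> hom B (snd y) (snd z)"
  by (cases x; cases y; cases z) (auto simp: hom_def)

lemma poset_hom_iff: "f \<in> hom (poset_cat P) x y \<longleftrightarrow> f = (x, y) \<and> x \<in> P \<and> y \<in> P \<and> x \<le> y"
  by (cases f) (auto simp: hom_def)

lemma prod_functor_simps [simp]:
  "Src (prod_functor F G) = prod_cat (Src F) (Src G)" "Tgt (prod_functor F G) = prod_cat (Tgt F) (Tgt G)"
  "x \<in> Obj (Src F) \<Longrightarrow> y \<in> Obj (Src G) \<Longrightarrow> OM (prod_functor F G) (x, y) = (OM F x, OM G y)"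
  "f \<in> Arr (Src F) \<Longrightarrow> g \<in> Arr (Src G) \<Longrightarrow> MM (prod_functor F G) (f, g) = (MM F f, MM G g)"
  by (auto simp: prod_functor_def)

lemma prod_functor_funct:
  assumes F: "funct A A' F" and G: "funct B B' G"
  shows "funct (prod_cat A B) (prod_cat A' B') (prod_functor F G)"
proof (rule functI, goal_cases)
  case (7 x)
  then show ?case
    using F G funct_hom[OF F arr_hom] funct_hom[OF G arr_hom]
      hom_objs[OF funct_cat_src[OF F] arr_hom] hom_objs[OF funct_cat_src[OF G] arr_hom]
    by (cases x) (auto simp: prod_hom_iff)
next
  case (9 x)
  then show ?case
    using F G ident_hom[OF funct_cat_src[OF F], THEN hom_arr] ident_hom[OF funct_cat_src[OF G], THEN hom_arr]
    by (cases x) (auto simp: funct_ident)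
next
  case (10 x y)
  obtain f f' g g' where x: "x = (f, f')" "y = (g, g')" by (cases x; cases y)
  then have h: "f \<in> hom A (Dom A f) (Cod A f)" "g \<in> hom A (Cod A f) (Cod A g)"
    "f' \<in> hom B (Dom B f') (Cod B f')" "g' \<in> hom B (Cod B f') (Cod B g')"
    using 10 by (auto simp: hom_def)
  then have "Comp A g f \<in> Arr A" "Comp B g' f' \<in> Arr B"
    using comp_hom[OF funct_cat_src[OF F] h(1,2)] comp_hom[OF funct_cat_src[OF G] h(3,4)]
    by (auto simp: hom_arr)
  then show ?case
    using x 10 F G funct_comp[OF F h(1,2)] funct_comp[OF G h(3,4)] by simp
qed (use F G in \<open>auto simp: funct_obj intro: prod_category funct_cat_src funct_cat_tgt\<close>,
  auto simp: prod_functor_def extensional_def)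

locale poset_setup = derivator_setup D for D :: "('u::infinite, 'o, 'm) prederiv" +
  fixes B :: "'u scat" and P :: "'p::order set"
  assumes B: "small_in TYPE('u) B" and finite_P: "finite P"
begin

abbreviation "PB \<equiv> prod_cat (poset_cat P) B"

lemma PB_small: "small_in TYPE('u) PB"
  by (rule small_in_prod[OF small_in_poset[OF finite_P] B])

definition slice_functor :: "'p set \<Rightarrow> 'u \<Rightarrow> ('p, 'p \<times> 'p, 'p \<times> 'u, ('p \<times> 'p) \<times> 'u) ftor" where
  "slice_functor S b = \<lparr>Src = poset_cat S, Tgt = PB, OM = (\<lambda>w\<in>S. (w, b)),
     MM = (\<lambda>f\<in>Arr (poset_cat S). (f, Ident B b))\<rparr>"

definition cone :: "'p set \<Rightarrow> 'p \<Rightarrow> 'u \<Rightarrow> ('p, 'p \<times> 'p, 'p \<times> 'u, ('p \<times> 'p) \<times> 'u) ntrans" where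
  "cone S y b = cocone (slice_functor S b) (y, b) (\<lambda>w. ((w, y), Ident B b))"

text \<open>In pointwise language: the value of \<open>X\<close> at \<open>(y, b)\<close> is the
  colimit of its values at \<open>(w, b)\<close> with \<open>w\<close> in \<open>S\<close>. The
  parameter stays fixed, so later arguments vary only the posets.\<close>

definition is_colim :: "'o \<Rightarrow> 'p set \<Rightarrow> 'p \<Rightarrow> 'u \<Rightarrow> bool" where
  "is_colim X S y b \<longleftrightarrow> colimiting PB (y, b) (cone S y b) X"

lemma Ident_B:
  assumes "b \<in> Obj B"
  shows "Ident B b \<in> hom B b b" "Ident B b \<in> Arr B" "Comp B (Ident B b) (Ident B b) = Ident B b"
  using ident_hom[OF small_inD(1)[OF B] assms] ident_left[OF small_inD(1)[OF B] ident_hom[OF small_inD(1)[OF B] assms]]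
  by (auto simp: hom_def)

lemma slice_functor_simps [simp]:
  "Src (slice_functor S b) = poset_cat S" "Tgt (slice_functor S b) = PB"
  "w \<in> S \<Longrightarrow> OM (slice_functor S b) w = (w, b)"
  "f \<in> Arr (poset_cat S) \<Longrightarrow> MM (slice_functor S b) f = (f, Ident B b)"
  by (auto simp: slice_functor_def)

lemma slice_functor_funct:
  assumes "S \<subseteq> P" "b \<in> Obj B"
  shows "funct (poset_cat S) PB (slice_functor S b)"
proof (rule functI, goal_cases)
  case (7 f) then show ?case using assms Ident_B by (cases f) (auto simp: hom_def)
next
  case (10 f g) then show ?case using Ident_B[OF assms(2)] order_trans by (cases f; cases g) auto
qed (use assms small_inD(1)[OF PB_small] in \<open>auto simp: poset_category\<close>, auto simp: slice_functor_def)

lemma cone_natt: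
  assumes "S \<subseteq> P" "y \<in> P" "b \<in> Obj B" and le: "\<And>w. w \<in> S \<Longrightarrow> w \<le> y"
  shows "natt (slice_functor S b) (const_functor (poset_cat S) PB (y, b)) (cone S y b)"
  unfolding cone_def
proof (rule cocone_natt[OF slice_functor_funct[OF assms(1,3)]])
  show "(y, b) \<in> Obj PB" using assms by simp
  show "((k, y), Ident B b) \<in> hom PB (OM (slice_functor S b) k) (y, b)" if "k \<in> Obj (poset_cat S)" for k
    using that assms Ident_B[OF assms(3)] by (auto simp: prod_hom_iff poset_hom_iff)
  show "Comp PB ((k', y), Ident B b) (MM (slice_functor S b) f) = ((k, y), Ident B b)"
    if "f \<in> hom (poset_cat S) k k'" for f k k'
    using that Ident_B[OF assms(3)] by (auto simp: poset_hom_iff)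
qed

lemma cone_restrict:
  assumes T: "T \<subseteq> P" "y \<in> P" "b \<in> Obj B" "\<And>w. w \<in> T \<Longrightarrow> w \<le> y" and S: "S \<subseteq> T"
  shows "funct (poset_cat S) (poset_cat T) (poset_functor S T id)"
    and "hcomp (cone T y b) (id_nat (poset_functor S T id)) = cone S y b"
    and "comp_functor (slice_functor T b) (poset_functor S T id) = slice_functor S b"
proof -
  have SP: "S \<subseteq> P" using S T(1) by blast
  show s: "funct (poset_cat S) (poset_cat T) (poset_functor S T id)"
    using S by (intro poset_functor_funct) auto
  note F = slice_functor_funct[OF T(1,3)]
  have n: "natt (slice_functor T b) (const_functor (poset_cat T) PB (y, b)) (cone T y b)"
    by (rule cone_natt[OF T(1-3)]) (rule T(4))
  have "natt (slice_functor S b) (const_functor (poset_cat S) PB (y, b)) (cone S y b)"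
    using S T(4) by (intro cone_natt[OF SP T(2,3)]) auto
  note nS = this
  show c: "comp_functor (slice_functor T b) (poset_functor S T id) = slice_functor S b"
  proof (rule funct_eqI[OF comp_functor_funct[OF s F] slice_functor_funct[OF SP T(3)]])
    fix f assume "f \<in> Arr (poset_cat S)"
    then show "MM (comp_functor (slice_functor T b) (poset_functor S T id)) f = MM (slice_functor S b) f"
      by (cases f) (auto simp: subsetD[OF S])
  qed (use S in auto)
  show "hcomp (cone T y b) (id_nat (poset_functor S T id)) = cone S y b"
  proof (rule natt_eqI[OF _ nS slice_functor_funct[OF SP T(3)]])
    show "natt (slice_functor S b) (const_functor (poset_cat S) PB (y, b))
        (hcomp (cone T y b) (id_nat (poset_functor S T id)))"
      using hcomp_natt[OF id_nat_natt[OF s] s n F] T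
        comp_const_functor[OF s small_inD(1)[OF PB_small], of "(y, b)"] c by simp
    fix k assume "k \<in> Obj (poset_cat S)"
    then show "NComp (hcomp (cone T y b) (id_nat (poset_functor S T id))) k = NComp (cone S y b) k"
      using hcomp_id_right[OF n F s, of k] S by (auto simp: cone_def cocone_def)
  qed
qed

text \<open>The conditions on \<open>r\<close> describe a closure operator on \<open>T\<close> with
  image \<open>S\<close>, that is, a left adjoint to the inclusion of \<open>S\<close>.\<close>

lemma is_colim_reflection:
  assumes X: "X \<in> Obj (DC PB)"
    and T: "T \<subseteq> P" "y \<in> P" "b \<in> Obj B" "\<And>w. w \<in> T \<Longrightarrow> w \<le> y" and S: "S \<subseteq> T"
    and r: "\<And>w. w \<in> T \<Longrightarrow> r w \<in> S" "\<And>w. w \<in> T \<Longrightarrow> w \<le> r w" "\<And>w. w \<in> S \<Longrightarrow> r w = w"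
      "\<And>w w'. w \<in> T \<Longrightarrow> w' \<in> T \<Longrightarrow> w \<le> w' \<Longrightarrow> r w \<le> r w'"
  shows "is_colim X T y b \<longleftrightarrow> is_colim X S y b"
proof -
  let ?s = "poset_functor S T id" and ?r = "poset_functor T S r"
  define \<eta> where "\<eta> = \<lparr>NSrc = id_functor (poset_cat T), NTgt = comp_functor ?s ?r,
    NComp = (\<lambda>w\<in>T. (w, r w))\<rparr>"
  have fin: "finite T" "finite S"
    using finite_subset[OF T(1) finite_P] finite_subset[OF S] by auto
  note F = slice_functor_funct[OF T(1,3)]
  have n: "natt (slice_functor T b) (const_functor (poset_cat T) PB (y, b)) (cone T y b)"
    by (rule cone_natt[OF T(1-3)]) (rule T(4))
  have c: "hcomp (cone T y b) (id_nat (poset_functor S T id)) = cone S y b"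
    by (rule cone_restrict(2)[OF T(1-3) _ S]) (rule T(4))
  have s: "funct (poset_cat S) (poset_cat T) (poset_functor S T id)"
    by (rule cone_restrict(1)[OF T(1-3) _ S]) (rule T(4))
  have r': "funct (poset_cat T) (poset_cat S) ?r" using r by (intro poset_functor_funct) auto
  have "comp_functor ?r ?s = id_functor (poset_cat S)"
  proof (rule funct_eqI[OF comp_functor_funct[OF s r'] id_functor_funct[OF poset_category]])
    fix f assume "f \<in> Arr (poset_cat S)"
    then show "MM (comp_functor ?r ?s) f = MM (id_functor (poset_cat S)) f"
      by (cases f) (auto simp: subsetD[OF S] r)
  qed (use S r in auto)
  moreover have "natt (id_functor (poset_cat T)) (comp_functor ?s ?r) \<eta>"
  proof (rule nattI[OF id_functor_funct[OF poset_category] comp_functor_funct[OF r' s]], goal_cases)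
    case (5 f) then show ?case using r by (cases f) (auto simp: \<eta>_def)
  qed (use S r in \<open>auto simp: \<eta>_def poset_hom_iff\<close>)
  moreover have "NComp \<eta> (OM ?s k) = Ident (poset_cat T) (OM ?s k)" if "k \<in> S" for k
    using that S r by (auto simp: \<eta>_def)
  ultimately have "reflection (poset_cat T) (poset_cat S) ?s ?r \<eta>"
    using s r' by (simp add: reflection_def)
  from colimiting_reflection[OF this n F _ small_in_poset[OF fin(1)] small_in_poset[OF fin(2)] PB_small X]
  show ?thesis
    unfolding is_colim_def c using T by simp
qed

text \<open>Reduces the pointwise Kan condition for the inclusion of \<open>S\<close> into
  \<open>T\<close> to a colimit condition on \<open>X\<close> itself, since the comma category over
  \<open>w\<close> is the part of \<open>S\<close> below \<open>w\<close>.\<close>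

lemma inclusion_colimiting:
  assumes X: "X \<in> Obj (DC PB)" and T: "T \<subseteq> P" "b \<in> Obj B" and S: "S \<subseteq> T" and w: "w \<in> T"
  shows "colimiting (poset_cat T) w (comma_cell (poset_functor S T id) w) (OM (pull (slice_functor T b)) X)
    \<longleftrightarrow> is_colim X {v \<in> S. v \<le> w} w b"
proof -
  let ?u = "poset_functor S T id" and ?V = "OM (pull (slice_functor T b)) X"
  let ?S = "{v \<in> S. v \<le> w}"
  let ?q = "poset_functor ?S S id"
  have fin: "finite T" "finite S" "finite ?S"
    using finite_subset[OF T(1) finite_P] finite_subset[OF S] by auto
  have u: "funct (poset_cat S) (poset_cat T) ?u" using S by (intro poset_functor_funct) auto
  have q: "funct (poset_cat ?S) (poset_cat S) ?q" by (intro poset_functor_funct) auto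
  have wT: "w \<in> Obj (poset_cat T)" using w by simp
  note F = slice_functor_funct[OF T]
  have smT: "small_in TYPE('u) (poset_cat T)" by (rule small_in_poset[OF fin(1)])
  have V: "?V \<in> Obj (DC (poset_cat T))" by (rule funct_obj[OF pull_funct[OF F smT PB_small] X])
  have co: "(a, f) \<in> comma_obj ?u w \<longleftrightarrow> a \<in> S \<and> a \<le> w \<and> f = (a, w)" for a f
    using S w by (auto simp: comma_obj_iff[OF u] poset_hom_iff)
  \<comment> \<open>Arrows of a poset are determined by their ends, so \<rho> forgets them and the
    unit \<open>h\<close> consists of identities.\<close>
  have "(colimiting (poset_cat T) w (comma_cell ?u w) ?V \<longleftrightarrow>
      colimiting (poset_cat T) w (cocone (comp_functor ?u ?q) w (\<lambda>v. (v, w))) ?V) \<and>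
      natt (comp_functor ?u ?q) (const_functor (poset_cat ?S) (poset_cat T) w)
      (cocone (comp_functor ?u ?q) w (\<lambda>v. (v, w)))"
    by (rule comma_colimiting_poset[OF u wT q, where \<rho> = fst and h = "\<lambda>x. (fst x, fst x)"])
      (use fin V w in \<open>auto simp: co poset_hom_iff subsetD[OF S] intro: small_in_poset\<close>)
  then have 1: "colimiting (poset_cat T) w (comma_cell ?u w) ?V \<longleftrightarrow>
      colimiting (poset_cat T) w (cocone (comp_functor ?u ?q) w (\<lambda>v. (v, w))) ?V"
    and n: "natt (comp_functor ?u ?q) (const_functor (poset_cat ?S) (poset_cat T) w)
      (cocone (comp_functor ?u ?q) w (\<lambda>v. (v, w)))" by auto
  note uq = comp_functor_funct[OF q u]
  have SP: "?S \<subseteq> P" and wP: "w \<in> P" using S T w by auto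
  have Fw: "OM (slice_functor T b) w = (w, b)" using w by simp
  have e: "comp_functor (slice_functor T b) (comp_functor ?u ?q) = slice_functor ?S b"
  proof (rule funct_eqI[OF comp_functor_funct[OF uq F] slice_functor_funct[OF SP T(2)]])
    fix f assume "f \<in> Arr (poset_cat ?S)"
    then show "MM (comp_functor (slice_functor T b) (comp_functor ?u ?q)) f = MM (slice_functor ?S b) f"
      by (cases f) (auto simp: subsetD[OF S])
  qed (use S in auto)
  have "hcomp (id_nat (slice_functor T b)) (cocone (comp_functor ?u ?q) w (\<lambda>v. (v, w))) = cone ?S w b"
  proof (rule natt_eqI[OF _ cone_natt[OF SP wP T(2)] slice_functor_funct[OF SP T(2)]])
    show "natt (slice_functor ?S b) (const_functor (poset_cat ?S) PB (w, b))
        (hcomp (id_nat (slice_functor T b)) (cocone (comp_functor ?u ?q) w (\<lambda>v. (v, w))))"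
      using hcomp_natt[OF n uq id_nat_natt[OF F] F] e comp_functor_const[OF F poset_category[of ?S] wT] Fw by simp
    fix k assume k: "k \<in> Obj (poset_cat ?S)"
    then show "NComp (hcomp (id_nat (slice_functor T b)) (cocone (comp_functor ?u ?q) w (\<lambda>v. (v, w)))) k
        = NComp (cone ?S w b) k"
      using hcomp_id_left[OF n uq F k] S w by (auto simp: cone_def cocone_def)
  qed auto
  then show ?thesis
    unfolding 1 is_colim_def
    using colimiting_pull[OF n uq wT F small_in_poset[OF fin(3)] smT PB_small X] Fw by simp
qed

text \<open>The hypothesis \<open>col\<close> says that \<open>X\<close> over \<open>T\<close> is
  left Kan extended from \<open>S\<close>. Morphisms out of it are then determined by their
  restrictions to \<open>S\<close>, in particular morphisms into constant diagrams.\<close>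

lemma is_colim_extend:
  assumes X: "X \<in> Obj (DC PB)"
    and T: "T \<subseteq> P" "y \<in> P" "b \<in> Obj B" "\<And>w. w \<in> T \<Longrightarrow> w \<le> y" and S: "S \<subseteq> T"
    and col: "\<And>w. w \<in> T \<Longrightarrow> is_colim X {v \<in> S. v \<le> w} w b"
  shows "is_colim X T y b \<longleftrightarrow> is_colim X S y b"
proof -
  let ?s = "poset_functor S T id" and ?V = "OM (pull (slice_functor T b)) X"
  have fin: "finite T" "finite S"
    using finite_subset[OF T(1) finite_P] finite_subset[OF S] by auto
  note smT = small_in_poset[OF fin(1)] and smS = small_in_poset[OF fin(2)]
  note F = slice_functor_funct[OF T(1,3)]
  have n: "natt (slice_functor T b) (const_functor (poset_cat T) PB (y, b)) (cone T y b)"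
    by (rule cone_natt[OF T(1-3)]) (rule T(4))
  have c: "hcomp (cone T y b) (id_nat (poset_functor S T id)) = cone S y b"
    by (rule cone_restrict(2)[OF T(1-3) _ S]) (rule T(4))
  have s: "funct (poset_cat S) (poset_cat T) (poset_functor S T id)"
    by (rule cone_restrict(1)[OF T(1-3) _ S]) (rule T(4))
  have V: "?V \<in> Obj (DC (poset_cat T))" by (rule funct_obj[OF pull_funct[OF F smT PB_small] X])
  have "colimiting (poset_cat T) w (comma_cell ?s w) ?V" if "w \<in> Obj (poset_cat T)" for w
    using col[of w] inclusion_colimiting[OF X T(1,3) S, of w] that by simp
  then have bij: "bij_betw (MM (pull ?s)) (hom (DC (poset_cat T)) ?V Z)
      (hom (DC (poset_cat S)) (OM (pull ?s) ?V) (OM (pull ?s) Z))" if "Z \<in> Obj (DC (poset_cat T))" for Z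
    by (rule colimiting_ess_image(2)[OF s smS smT V _ that])
  have "bij_betw (MM (pull ?s)) (hom (DC (poset_cat T)) ?V (OM (pull (terminal_functor (poset_cat T))) E))
        (hom (DC (poset_cat S)) (OM (pull ?s) ?V) (OM (pull (terminal_functor (poset_cat S))) E))"
    if E: "E \<in> Obj (DC unit_cat)" for E
    using bij[OF funct_obj[OF pull_terminal_funct[OF smT] E]]
      pull_terminal_comp(1)[OF s smS smT E] by simp
  from colimiting_restriction[OF n F _ s smT smS PB_small X this]
  show ?thesis
    unfolding is_colim_def c using T by simp
qed

end

section \<open>Essential images for poset inclusions with a parameter\<close>

lemma fully_faithful_inclusion:
  assumes "S \<subseteq> T"
  shows "fully_faithful (poset_functor S T id)"
proof -
  have "bij_betw (MM (poset_functor S T id)) (hom (poset_cat S) a b) (hom (poset_cat T) a b)"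
    if "a \<in> S" "b \<in> S" for a b
    by (rule bij_betw_byWitness[where f' = "\<lambda>f. f"])
      (use that subsetD[OF assms] in \<open>auto simp: poset_hom_iff\<close>)
  then show ?thesis by (simp add: fully_faithful_def)
qed

lemma fully_faithful_prod_id:
  assumes F: "funct A A' F" and ff: "fully_faithful F" and B: "category B"
  shows "fully_faithful (prod_functor F (id_functor B))"
proof -
  have "bij_betw (MM (prod_functor F (id_functor B))) (hom (prod_cat A B) (a, b) (a', b'))
      (hom (prod_cat A' B) (OM F a, b) (OM F a', b'))"
    if "a \<in> Obj A" "a' \<in> Obj A" for a a' b b'
  proof -
    have bij: "bij_betw (MM F) (hom A a a') (hom A' (OM F a) (OM F a'))"
      using ff that F by (simp add: fully_faithful_def)
    have e: "MM (prod_functor F (id_functor B)) (f, g) = (MM F f, g)" if "f \<in> hom A a a'" "g \<in> hom B b b'" for f g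
      using that F by (simp add: hom_arr)
    show ?thesis
      unfolding bij_betw_def
    proof (intro conjI inj_onI equalityI subsetI)
      fix x y assume "x \<in> hom (prod_cat A B) (a, b) (a', b')" "y \<in> hom (prod_cat A B) (a, b) (a', b')"
        "MM (prod_functor F (id_functor B)) x = MM (prod_functor F (id_functor B)) y"
      then show "x = y"
        using e inj_onD[OF bij_betw_imp_inj_on[OF bij]] by (cases x; cases y) (auto simp: prod_hom_iff)
    next
      fix x assume "x \<in> hom (prod_cat A' B) (OM F a, b) (OM F a', b')"
      moreover then obtain f where "f \<in> hom A a a'" "MM F f = fst x"
        using bij_betw_imp_surj_on[OF bij] by (metis fst_conv imageE prod_hom_iff)
      ultimately show "x \<in> MM (prod_functor F (id_functor B)) ` hom (prod_cat A B) (a, b) (a', b')"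
        using e[of f "snd x"] by (intro image_eqI[of _ _ "(f, snd x)"]) (auto simp: prod_hom_iff)
    next
      fix x assume "x \<in> MM (prod_functor F (id_functor B)) ` hom (prod_cat A B) (a, b) (a', b')"
      then show "x \<in> hom (prod_cat A' B) (OM F a, b) (OM F a', b')"
        using e funct_hom[OF F] by (auto simp: prod_hom_iff)
    qed
  qed
  then show ?thesis using F by (auto simp: fully_faithful_def)
qed

context poset_setup
begin

text \<open>Here \<open>w\<close> is itself the largest element of the shape. This settles the sets
  with at most k elements.\<close>

lemma is_colim_self:
  assumes X: "X \<in> Obj (DC PB)" and S: "S \<subseteq> P" and w: "w \<in> S" and b: "b \<in> Obj B"
  shows "is_colim X {v \<in> S. v \<le> w} w b"
proof -
  have u: "funct (poset_cat S) (poset_cat P) (poset_functor S P id)"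
    using S by (intro poset_functor_funct) auto
  note smP = small_in_poset[OF finite_P] and smS = small_in_poset[OF finite_subset[OF S finite_P]]
  have "colimiting (poset_cat P) w (comma_cell (poset_functor S P id) w) (OM (pull (slice_functor P b)) X)"
    using colimiting_at_image[OF u smS smP fully_faithful_inclusion[OF S], of w] w
      funct_obj[OF pull_funct[OF slice_functor_funct[OF order_refl b] smP PB_small] X] by simp
  then show ?thesis
    using inclusion_colimiting[OF X order_refl b S, of w] S w by blast
qed

context
  fixes Q Q' :: "'q::order set" and \<psi> :: "'q \<Rightarrow> 'p"
  assumes Q: "finite Q" "Q' \<subseteq> Q" and \<psi>: "\<And>q. q \<in> Q \<Longrightarrow> \<psi> q \<in> P"
    "\<And>q q'. q \<in> Q \<Longrightarrow> q' \<in> Q \<Longrightarrow> \<psi> q \<le> \<psi> q' \<longleftrightarrow> q \<le> q'"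
begin

abbreviation "incl_functor \<equiv> prod_functor (poset_functor Q' Q id) (id_functor B)"
abbreviation "embed_functor \<equiv> prod_functor (poset_functor Q P \<psi>) (id_functor B)"

lemma incl_functor_funct: "funct (prod_cat (poset_cat Q') B) (prod_cat (poset_cat Q) B) incl_functor"
  using Q by (intro prod_functor_funct poset_functor_funct id_functor_funct small_inD(1)[OF B]) auto

lemma embed_functor_funct: "funct (prod_cat (poset_cat Q) B) PB embed_functor"
  using \<psi> by (intro prod_functor_funct poset_functor_funct id_functor_funct small_inD(1)[OF B]) auto

lemma Q_small: "small_in TYPE('u) (prod_cat (poset_cat Q) B)" "small_in TYPE('u) (prod_cat (poset_cat Q') B)"
  using small_in_prod[OF small_in_poset[OF Q(1)] B]
    small_in_prod[OF small_in_poset[OF finite_subset[OF Q(2,1)]] B] by auto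

text \<open>This step removes \<open>B\<close> from the shape: an object (w, c) with w \<le> y and f
  : c \<rightarrow> b is reflected along f to (w, b) with the identity of b, so only the elements of
  \<open>Q'\<close> below \<open>y\<close> remain.\<close>

lemma incl_colimiting:
  assumes X: "X \<in> Obj (DC PB)" and y: "y \<in> Q" and b: "b \<in> Obj B"
  shows "colimiting (prod_cat (poset_cat Q) B) (y, b) (comma_cell incl_functor (y, b)) (OM (pull embed_functor) X)
    \<longleftrightarrow> is_colim X (\<psi> ` {w \<in> Q'. w \<le> y}) (\<psi> y) b"
proof -
  let ?u = incl_functor and ?\<Psi> = embed_functor and ?V = "OM (pull embed_functor) X"
  let ?S = "\<psi> ` {w \<in> Q'. w \<le> y}" and ?QB = "prod_cat (poset_cat Q) B"
  note u = incl_functor_funct and F = embed_functor_funct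
  have inj: "inj_on \<psi> Q" using \<psi>(2) by (intro inj_onI antisym) (metis order_refl)+
  \<comment> \<open>The shape is a subposet of \<open>P\<close>, but the comma category lies over
    \<open>Q'\<close>; \<theta> leads back.\<close>
  define \<theta> where "\<theta> = inv_into Q \<psi>"
  have \<theta>: "\<theta> (\<psi> w) = w" if "w \<in> Q" for w using inv_into_f_f[OF inj that] by (simp add: \<theta>_def)
  note QQ = subsetD[OF Q(2)]
  define q where "q = \<lparr>Src = poset_cat ?S, Tgt = prod_cat (poset_cat Q') B, OM = (\<lambda>k\<in>?S. (\<theta> k, b)),
     MM = (\<lambda>f\<in>Arr (poset_cat ?S). ((\<theta> (fst f), \<theta> (snd f)), Ident B b))\<rparr>"
  let ?\<sigma> = "\<lambda>k. ((\<theta> k, y), Ident B b)"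
  have q_simps: "Src q = poset_cat ?S" "Tgt q = prod_cat (poset_cat Q') B"
    "w \<in> Q' \<Longrightarrow> w \<le> y \<Longrightarrow> OM q (\<psi> w) = (w, b)"
    "w \<in> Q' \<Longrightarrow> w \<le> y \<Longrightarrow> w' \<in> Q' \<Longrightarrow> w' \<le> y \<Longrightarrow> w \<le> w' \<Longrightarrow> MM q (\<psi> w, \<psi> w') = ((w, w'), Ident B b)" for w w'
    using \<theta> QQ \<psi>(2) by (auto simp: q_def)
  note IB = Ident_B[OF b] and cB = small_inD(1)[OF B]
  have q: "funct (poset_cat ?S) (prod_cat (poset_cat Q') B) q"
  proof (rule functI, goal_cases)
    case (7 f)
    then show ?case using IB by (cases f) (auto simp: q_simps \<psi>(2) QQ prod_hom_iff poset_hom_iff)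
  next
    case (9 x)
    then show ?case by (auto simp: q_simps \<psi>(2) QQ)
  next
    case (10 f g)
    then show ?case using IB by (cases f; cases g) (auto simp: q_simps \<psi>(2) QQ dest: order_trans)
  qed (use b in \<open>auto simp: q_simps poset_category small_inD(1)[OF Q_small(2)]\<close>, auto simp: q_def)
  have yb: "(y, b) \<in> Obj ?QB" using y b by simp
  have V: "?V \<in> Obj (DC ?QB)" by (rule funct_obj[OF pull_funct[OF F Q_small(1) PB_small] X])
  have co: "((w, c), (e, f)) \<in> comma_obj ?u (y, b) \<longleftrightarrow> w \<in> Q' \<and> w \<le> y \<and> e = (w, y) \<and> f \<in> hom B c b" for w c e f
    using y QQ hom_objs[OF cB] by (auto simp: comma_obj_iff[OF u] prod_hom_iff poset_hom_iff)
  have fS: "finite ?S" using finite_subset[OF Q(2,1)] by simp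
  \<comment> \<open>The unit keeps the poset coordinate and moves the parameter along the second
    component of the comma arrow.\<close>
  let ?h = "\<lambda>x. ((fst (fst x), fst (fst x)), snd (snd x))"
  have "(colimiting ?QB (y, b) (comma_cell ?u (y, b)) ?V \<longleftrightarrow>
      colimiting ?QB (y, b) (cocone (comp_functor ?u q) (y, b) ?\<sigma>) ?V) \<and>
    natt (comp_functor ?u q) (const_functor (poset_cat ?S) ?QB (y, b)) (cocone (comp_functor ?u q) (y, b) ?\<sigma>)"
  proof (rule comma_colimiting_poset[OF u yb q, where \<rho> = "\<lambda>x. \<psi> (fst (fst x))" and h = ?h], goal_cases)
    case (1 k)
    then show ?case using IB b y by (auto simp: q_simps \<theta> QQ prod_hom_iff poset_hom_iff)
  next
    case (2 k k')
    then show ?case using IB b y by (auto simp: q_simps \<theta> QQ \<psi>(2))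
  next
    case (3 x)
    then show ?case by (cases x; cases "fst x"; cases "snd x") (auto simp: co)
  next
    case (4 a f)
    then show ?case by (cases a; cases f) (auto simp: co q_simps prod_hom_iff poset_hom_iff)
  next
    case (5 a f)
    then show ?case
      using ident_left[OF cB] by (cases a; cases f) (auto simp: co q_simps \<theta> QQ hom_arr)
  next
    case (6 a f b' f' g)
    then show ?case
      using ident_left[OF cB]
      by (cases a; cases f; cases b'; cases f'; cases g)
        (auto simp: co q_simps \<psi>(2) QQ prod_hom_iff poset_hom_iff hom_arr)
  next
    case (7 k)
    then show ?case by (auto simp: q_simps)
  next
    case (8 k)
    then show ?case by (auto simp: q_simps)
  qed (use Q_small fS V in auto)
  then have 1: "colimiting ?QB (y, b) (comma_cell ?u (y, b)) ?V \<longleftrightarrow>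
      colimiting ?QB (y, b) (cocone (comp_functor ?u q) (y, b) ?\<sigma>) ?V"
    and n: "natt (comp_functor ?u q) (const_functor (poset_cat ?S) ?QB (y, b)) (cocone (comp_functor ?u q) (y, b) ?\<sigma>)"
    by auto
  note uq = comp_functor_funct[OF q u]
  have SP: "?S \<subseteq> P" using \<psi>(1) QQ by auto
  have yP: "\<psi> y \<in> P" using \<psi>(1) y by blast
  have le: "w \<le> \<psi> y" if "w \<in> ?S" for w using that \<psi>(2) QQ y by auto
  have Fy: "OM ?\<Psi> (y, b) = (\<psi> y, b)" using y b by simp
  have e: "comp_functor ?\<Psi> (comp_functor ?u q) = slice_functor ?S b"
  proof (rule funct_eqI[OF comp_functor_funct[OF uq F] slice_functor_funct[OF SP b]])
    fix k assume "k \<in> Obj (poset_cat ?S)"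
    then show "OM (comp_functor ?\<Psi> (comp_functor ?u q)) k = OM (slice_functor ?S b) k"
      using b by (auto simp: q_simps QQ)
  next
    fix f assume "f \<in> Arr (poset_cat ?S)"
    then show "MM (comp_functor ?\<Psi> (comp_functor ?u q)) f = MM (slice_functor ?S b) f"
      using IB by (cases f) (auto simp: q_simps QQ \<psi>(2))
  qed
  have nc: "natt (slice_functor ?S b) (const_functor (poset_cat ?S) PB (\<psi> y, b)) (cone ?S (\<psi> y) b)"
    by (rule cone_natt[OF SP yP b le])
  have "hcomp (id_nat ?\<Psi>) (cocone (comp_functor ?u q) (y, b) ?\<sigma>) = cone ?S (\<psi> y) b"
  proof (rule natt_eqI[OF _ nc slice_functor_funct[OF SP b]])
    show "natt (slice_functor ?S b) (const_functor (poset_cat ?S) PB (\<psi> y, b))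
        (hcomp (id_nat ?\<Psi>) (cocone (comp_functor ?u q) (y, b) ?\<sigma>))"
      using hcomp_natt[OF n uq id_nat_natt[OF F] F] e comp_functor_const[OF F poset_category[of ?S] yb] Fy by simp
    fix k assume k: "k \<in> Obj (poset_cat ?S)"
    then show "NComp (hcomp (id_nat ?\<Psi>) (cocone (comp_functor ?u q) (y, b) ?\<sigma>)) k = NComp (cone ?S (\<psi> y) b) k"
      using hcomp_id_left[OF n uq F k] IB y by (auto simp: cone_def cocone_def q_simps QQ \<theta>)
  qed
  then show ?thesis
    unfolding 1 is_colim_def
    using colimiting_pull[OF n uq yb F small_in_poset[OF fS] Q_small(1) PB_small X] Fy by simp
qed

text \<open>Stated for an order embedding \<psi> in order to serve twice: the identity gives
  cotruncation, the inclusion of an interval gives cocartesian subcubes. Only points outside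
  \<open>Q'\<close> appear, because points of \<open>Q'\<close> lie in the image.\<close>

lemma ess_image_iff_is_colim:
  assumes X: "X \<in> Obj (DC PB)"
  shows "OM (pull embed_functor) X \<in> ess_image (lkan D (cp_functor incl_functor)) \<longleftrightarrow>
    (\<forall>y\<in>Q - Q'. \<forall>b\<in>Obj B. is_colim X (\<psi> ` {w \<in> Q'. w \<le> y}) (\<psi> y) b)"
proof -
  let ?V = "OM (pull embed_functor) X" and ?QB = "prod_cat (poset_cat Q) B"
  note u = incl_functor_funct
  have V: "?V \<in> Obj (DC ?QB)"
    by (rule funct_obj[OF pull_funct[OF embed_functor_funct Q_small(1) PB_small] X])
  have "funct (poset_cat Q') (poset_cat Q) (poset_functor Q' Q id)"
    using Q by (intro poset_functor_funct) auto
  note ff = fully_faithful_prod_id[OF this fully_faithful_inclusion[OF Q(2)] small_inD(1)[OF B]]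
  have "?V \<in> ess_image (lkan D (cp_functor incl_functor)) \<longleftrightarrow>
      (\<forall>c\<in>Obj ?QB. colimiting ?QB c (comma_cell incl_functor c) ?V)"
    using ess_image_colimiting[OF u Q_small(2,1) ff] colimiting_ess_image(1)[OF u Q_small(2,1) V] by blast
  also have "\<dots> \<longleftrightarrow> (\<forall>y\<in>Q. \<forall>b\<in>Obj B. colimiting ?QB (y, b) (comma_cell incl_functor (y, b)) ?V)"
    by simp
  also have "\<dots> \<longleftrightarrow> (\<forall>y\<in>Q - Q'. \<forall>b\<in>Obj B. colimiting ?QB (y, b) (comma_cell incl_functor (y, b)) ?V)"
  proof -
    have "colimiting ?QB (y, b) (comma_cell incl_functor (y, b)) ?V" if "y \<in> Q'" "b \<in> Obj B" for y b
      using colimiting_at_image[OF u Q_small(2,1) ff _ V, of "(y, b)"] that by simp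
    then show ?thesis by blast
  qed
  also have "\<dots> \<longleftrightarrow> (\<forall>y\<in>Q - Q'. \<forall>b\<in>Obj B. is_colim X (\<psi> ` {w \<in> Q'. w \<le> y}) (\<psi> y) b)"
    using incl_colimiting[OF X] by simp
  finally show ?thesis .
qed

end

end

section \<open>Cubes\<close>

lemma cube_le_iff: "S \<in> cube_le n l \<longleftrightarrow> S \<subseteq> {1..n} \<and> card S \<le> l"
  by (auto simp: cube_le_def cube_def)

lemma finite_cube: "finite (cube n)" "finite (cube_le n l)"
  by (auto simp: cube_le_def cube_def)

locale cube_setup = derivator_setup D for D :: "('u::infinite, 'o, 'm) prederiv" +
  fixes B :: "'u scat" and n k l :: nat and X :: 'o
  assumes B: "small_in TYPE('u) B" and kl: "k \<le> l"
    and X: "X \<in> Obj (DC (prod_cat (poset_cat (cube_le n l)) B))"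
begin

sublocale poset_setup D B "cube_le n l"
  by unfold_locales (use B finite_cube in auto)

definition lower :: "nat set \<Rightarrow> nat set set" where
  "lower y = {w \<in> cube_le n k. w \<subseteq> y}"

text \<open>The case of the identity embedding; the points outside the smaller poset are the sets
  with more than k elements.\<close>

lemma cotruncated_iff:
  "cotruncated D B n l k X \<longleftrightarrow>
    (\<forall>y\<in>cube_le n l. k < card y \<longrightarrow> (\<forall>b\<in>Obj B. is_colim X (lower y) y b))"
proof -
  have sub: "cube_le n k \<subseteq> cube_le n l" using kl by (auto simp: cube_le_iff)
  have "prod_functor (poset_functor (cube_le n l) (cube_le n l) id) (id_functor B) = id_functor PB"
  proof (rule funct_eqI[OF _ id_functor_funct[OF small_inD(1)[OF PB_small]]])
    show "funct PB PB (prod_functor (poset_functor (cube_le n l) (cube_le n l) id) (id_functor B))"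
      by (intro prod_functor_funct poset_functor_funct id_functor_funct small_inD(1)[OF B]) auto
  qed auto
  then have "OM (pull (prod_functor (poset_functor (cube_le n l) (cube_le n l) id) (id_functor B))) X = X"
    using X by (simp add: pull_id[OF PB_small])
  then have "cotruncated D B n l k X \<longleftrightarrow>
      (\<forall>y\<in>cube_le n l - cube_le n k. \<forall>b\<in>Obj B. is_colim X (id ` {w \<in> cube_le n k. w \<le> y}) (id y) b)"
    using ess_image_iff_is_colim[OF finite_cube(2) sub, of id, OF _ _ X]
    by (simp add: cotruncated_def shift_lkan_def)
  then show ?thesis by (auto simp: lower_def cube_le_iff)
qed

text \<open>The case of an interval embedding. The truncated m-cube misses only its top, so one
  colimit condition per parameter object remains.\<close>

lemma cocartesian_iff:
  assumes xy: "x \<subseteq> y" "y \<in> cube_le n l" "card (y - x) = m" and m: "1 \<le> m"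
    and \<phi>: "bij_betw \<phi> (cube m) {w. x \<subseteq> w \<and> w \<subseteq> y}" "\<forall>S\<in>cube m. \<forall>T\<in>cube m. \<phi> S \<subseteq> \<phi> T \<longleftrightarrow> S \<subseteq> T"
  shows "cocartesian D B m (OM (shift_pull D (poset_functor (cube m) (cube_le n l) \<phi>) B) X) \<longleftrightarrow>
    (\<forall>b\<in>Obj B. is_colim X {w. x \<subseteq> w \<and> w \<subset> y} y b)"
proof -
  let ?Q = "cube m" and ?Q' = "cube_le m (m - 1)"
  have fy: "finite y" using xy(2) by (auto simp: cube_le_iff intro: finite_subset)
  have sub: "?Q' \<subseteq> ?Q" by (auto simp: cube_le_def)
  have P: "w \<in> cube_le n l" if "w \<subseteq> y" for w
    using that xy(2) card_mono[OF fy that] by (auto simp: cube_le_iff)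
  have \<phi>P: "\<phi> S \<in> cube_le n l" if "S \<in> ?Q" for S
    using bij_betwE[OF \<phi>(1)] that by (auto intro!: P)
  \<comment> \<open>With 1 \<le> m the natural-number subtraction m - 1 is genuine, and the full set
    is the only one with more than m - 1 elements.\<close>
  have top: "?Q - ?Q' = {{1..m}}"
  proof -
    have "S = {1..m}" if "S \<subseteq> {1..m}" "\<not> card S \<le> m - 1" for S
      using that m by (intro card_subset_eq) (auto dest: card_mono[rotated])
    then show ?thesis using m by (auto simp: cube_def cube_le_def)
  qed
  have topQ: "{1..m} \<in> ?Q" by (simp add: cube_def)
  \<comment> \<open>Some S is sent to \<open>y\<close>; since S \<subseteq> {1..m}, monotonicity
    puts \<open>y\<close> below the image of the top.\<close>
  have y: "\<phi> {1..m} = y"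
  proof (rule antisym)
    show "\<phi> {1..m} \<subseteq> y" using bij_betwE[OF \<phi>(1)] topQ by blast
    have "y \<in> \<phi> ` cube m" using bij_betw_imp_surj_on[OF \<phi>(1)] xy(1) by blast
    then obtain S where "S \<in> cube m" "y = \<phi> S" by blast
    then show "y \<subseteq> \<phi> {1..m}" using \<phi>(2) topQ by (auto simp: cube_def)
  qed
  have "\<phi> ` {w \<in> ?Q'. w \<le> {1..m}} = \<phi> ` (?Q - {{1..m}})"
    using top sub by (intro arg_cong[where f = "image \<phi>"]) (auto simp: cube_le_def cube_def)
  also have "\<dots> = \<phi> ` ?Q - {y}"
    using inj_on_image_set_diff[OF bij_betw_imp_inj_on[OF \<phi>(1)], of ?Q "{{1..m}}"] topQ y by auto
  also have "\<dots> = {w. x \<subseteq> w \<and> w \<subset> y}"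
    using bij_betw_imp_surj_on[OF \<phi>(1)] by auto
  finally have im: "\<phi> ` {w \<in> ?Q'. w \<le> {1..m}} = {w. x \<subseteq> w \<and> w \<subset> y}" .
  show ?thesis
    using ess_image_iff_is_colim[OF finite_cube(1) sub, of \<phi>, OF \<phi>P _ X] \<phi>(2) top im y
    by (simp add: cocartesian_def shift_pull_def shift_lkan_def pull_def)
qed

text \<open>The hypothesis \<open>col\<close> concerns proper subsets of \<open>y\<close> only.
  Cotruncation supplies it directly, and an induction on cardinality supplies it as its
  hypothesis.\<close>

lemma interval_colim_iff:
  assumes xy: "x \<subseteq> y" "y \<in> cube_le n l" "k < card (y - x)" and b: "b \<in> Obj B"
    and col: "\<And>w. w \<subset> y \<Longrightarrow> k < card w \<Longrightarrow> is_colim X (lower w) w b"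
  shows "is_colim X (lower y) y b \<longleftrightarrow> is_colim X {w. x \<subseteq> w \<and> w \<subset> y} y b"
proof -
  define T where "T = {w. w \<subseteq> y \<and> x \<union> w \<noteq> y}"
  have fy: "finite y" using xy(2) by (auto simp: cube_le_iff intro: finite_subset)
  have P: "w \<in> cube_le n l" if "w \<subseteq> y" for w
    using that xy(2) card_mono[OF fy that] by (auto simp: cube_le_iff)
  have T: "T \<subseteq> cube_le n l" using P by (auto simp: T_def)
  have S: "lower y \<subseteq> T"
  proof
    fix w assume w: "w \<in> lower y"
    have "x \<union> w \<noteq> y"
    proof
      assume "x \<union> w = y"
      then have "y - x \<subseteq> w" by blast
      moreover have "finite w" using w fy by (auto simp: lower_def intro: finite_subset)
      ultimately show False using xy(3) w card_mono[of w "y - x"] by (auto simp: lower_def cube_le_iff)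
    qed
    then show "w \<in> T" using w by (auto simp: T_def lower_def)
  qed
  have "is_colim X T y b \<longleftrightarrow> is_colim X (lower y) y b"
  proof (rule is_colim_extend[OF X T xy(2) b _ S])
    show "w \<le> y" if "w \<in> T" for w using that by (simp add: T_def)
    fix w assume w: "w \<in> T"
    then have e: "{v \<in> lower y. v \<le> w} = lower w" by (auto simp: T_def lower_def)
    \<comment> \<open>If \<open>w\<close> has more than k elements, \<open>col\<close> applies,
      \<open>w\<close> being proper because x \<union> w \<noteq> y. Otherwise \<open>w\<close>
      already belongs to the smaller poset and is its own colimit.\<close>
    show "is_colim X {v \<in> lower y. v \<le> w} w b"
    proof (cases "k < card w")
      case True
      moreover have "w \<subset> y" using w xy(1) by (auto simp: T_def)
      ultimately show ?thesis using col e by simp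
    next
      case False
      then have "w \<in> cube_le n k" using subsetD[OF T w] by (simp add: cube_le_iff)
      moreover have "cube_le n k \<subseteq> cube_le n l" using kl by (auto simp: cube_le_iff)
      ultimately show ?thesis
        using is_colim_self[OF X _ _ b, of "cube_le n k" w] unfolding e by (simp add: lower_def)
    qed
  qed
  moreover have "is_colim X T y b \<longleftrightarrow> is_colim X {w. x \<subseteq> w \<and> w \<subset> y} y b"
    by (rule is_colim_reflection[OF X T xy(2) b, where r = "\<lambda>w. x \<union> w"]) (use xy(1) in \<open>auto simp: T_def\<close>)
  ultimately show ?thesis by simp
qed

text \<open>Cotruncation gives the colimit condition at all subsets of \<open>y\<close> with more
  than k elements at once, so a single comparison at \<open>y\<close> suffices for every m >
  k.\<close>

lemma cocartesian_if_cotruncated: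
  assumes "cotruncated D B n l k X" "k < m" "Y \<in> subcubes D B n l m X"
  shows "cocartesian D B m Y"
proof -
  obtain \<phi> where \<phi>: "interval_incl n l m \<phi>" "Y = OM (shift_pull D (poset_functor (cube m) (cube_le n l) \<phi>) B) X"
    using assms(3) by (auto simp: subcubes_def)
  then obtain x y where xy: "x \<subseteq> y" "y \<in> cube_le n l" "card (y - x) = m"
    "bij_betw \<phi> (cube m) {w. x \<subseteq> w \<and> w \<subseteq> y}" "\<forall>S\<in>cube m. \<forall>T\<in>cube m. \<phi> S \<subseteq> \<phi> T \<longleftrightarrow> S \<subseteq> T"
    unfolding interval_incl_def by blast
  have fy: "finite y" using xy(2) by (auto simp: cube_le_iff intro: finite_subset)
  have col: "is_colim X (lower w) w b" if "w \<subseteq> y" "k < card w" "b \<in> Obj B" for w b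
    using assms(1) that xy(2) card_mono[OF fy that(1)] unfolding cotruncated_iff by (auto simp: cube_le_iff)
  have "k < card y" using assms(2) xy(3) card_mono[OF fy, of "y - x"] by auto
  then have "is_colim X {w. x \<subseteq> w \<and> w \<subset> y} y b" if "b \<in> Obj B" for b
    using interval_colim_iff[OF xy(1,2) _ that] col[OF _ _ that] assms(2) xy(3) by auto
  then show ?thesis
    using cocartesian_iff[OF xy(1-3) _ xy(4,5)] assms(2) \<phi>(2) by auto
qed

text \<open>Strong induction on the cardinality of \<open>y\<close>: below \<open>y\<close> the
  conditions are known, and one (k + 1)-subcube with top \<open>y\<close> provides the condition at
  \<open>y\<close>.\<close>

lemma cotruncated_if_cocartesian:
  assumes coc: "\<And>Y. Y \<in> subcubes D B n l (k + 1) X \<Longrightarrow> cocartesian D B (k + 1) Y"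
  shows "cotruncated D B n l k X"
proof -
  have "is_colim X (lower y) y b" if "y \<in> cube_le n l" "k < card y" and b: "b \<in> Obj B" for y b
    using that(1,2)
  proof (induction "card y" arbitrary: y rule: less_induct)
    case less
    have fy: "finite y" using less.prems(1) by (auto simp: cube_le_iff intro: finite_subset)
    \<comment> \<open>The choice of \<open>z\<close> is arbitrary; its complement in
      \<open>y\<close> becomes the bottom of the subcube.\<close>
    obtain z where z: "z \<subseteq> y" "card z = k + 1"
      using obtain_subset_with_card_n[of "k + 1" y] less.prems(2) by auto
    define x where "x = y - z"
    have yx: "y - x = z" "x \<subseteq> y" "x \<inter> z = {}" using z by (auto simp: x_def)
    obtain g where g: "bij_betw g {1..k + 1} z"
      using finite_same_card_bij[of "{1..k + 1}" z] finite_subset[OF z(1) fy] z(2) by auto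
    define \<phi> where "\<phi> S = x \<union> g ` S" for S
    have gS: "g ` S \<subseteq> z" if "S \<subseteq> {1..k + 1}" for S
      using that bij_betw_imp_surj_on[OF g] by blast
    \<comment> \<open>Since \<open>x\<close> and \<open>z\<close> are disjoint, inclusion is decided
      by the parts in \<open>z\<close>, where \<open>g\<close> is injective.\<close>
    have emb: "\<phi> S \<subseteq> \<phi> T \<longleftrightarrow> S \<subseteq> T" if "S \<subseteq> {1..k + 1}" "T \<subseteq> {1..k + 1}" for S T
    proof -
      have "\<phi> S \<subseteq> \<phi> T \<longleftrightarrow> g ` S \<subseteq> g ` T"
        using gS[OF that(1)] yx(3) unfolding \<phi>_def by blast
      then show ?thesis
        using inj_on_image_mem_iff[OF bij_betw_imp_inj_on[OF g] _ that(2)] that(1) by blast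
    qed
    have "bij_betw \<phi> (cube (k + 1)) {w. x \<subseteq> w \<and> w \<subseteq> y}"
      unfolding bij_betw_def
    proof (intro conjI equalityI subsetI)
      show "inj_on \<phi> (cube (k + 1))"
      proof (rule inj_onI)
        fix S T assume "S \<in> cube (k + 1)" "T \<in> cube (k + 1)" "\<phi> S = \<phi> T"
        then show "S = T" using emb[of S T] emb[of T S] by (simp add: cube_def)
      qed
      fix w assume "w \<in> \<phi> ` cube (k + 1)"
      then obtain S where "S \<subseteq> {1..k + 1}" "w = x \<union> g ` S" by (auto simp: \<phi>_def cube_def)
      then show "w \<in> {w. x \<subseteq> w \<and> w \<subseteq> y}" using gS[of S] z(1) yx(2) by blast
    next
      fix w assume w: "w \<in> {w. x \<subseteq> w \<and> w \<subseteq> y}"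
      then have "w - x \<subseteq> g ` {1..k + 1}" using bij_betw_imp_surj_on[OF g] yx(1) by blast
      then obtain S where "S \<subseteq> {1..k + 1}" "w - x = g ` S" by (auto simp: subset_image_iff)
      then show "w \<in> \<phi> ` cube (k + 1)"
        using w by (intro image_eqI[of _ _ S]) (auto simp: \<phi>_def cube_def)
    qed
    moreover have "\<forall>S\<in>cube (k + 1). \<forall>T\<in>cube (k + 1). \<phi> S \<subseteq> \<phi> T \<longleftrightarrow> S \<subseteq> T"
      using emb by (simp add: cube_def)
    moreover have "x \<in> cube_le n l"
      using less.prems(1) yx(2) card_mono[OF fy yx(2)] by (auto simp: cube_le_iff)
    moreover have c: "card (y - x) = k + 1" using yx z by simp
    ultimately have \<phi>: "interval_incl n l (k + 1) \<phi>" and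
      iff: "cocartesian D B (k + 1) (OM (shift_pull D (poset_functor (cube (k + 1)) (cube_le n l) \<phi>) B) X) \<longleftrightarrow>
        (\<forall>b\<in>Obj B. is_colim X {w. x \<subseteq> w \<and> w \<subset> y} y b)"
      using cocartesian_iff[OF yx(2) less.prems(1)] less.prems(1) yx(2) unfolding interval_incl_def by auto
    have "is_colim X {w. x \<subseteq> w \<and> w \<subset> y} y b"
      using coc iff \<phi> b by (auto simp: subcubes_def)
    moreover have "is_colim X (lower w) w b" if "w \<subset> y" "k < card w" for w
      using less.hyps[of w] psubset_card_mono[OF fy that(1)] less.prems(1) that by (auto simp: cube_le_iff)
    ultimately show ?case
      using interval_colim_iff[OF yx(2) less.prems(1) _ b] c by simp
  qed
  then show ?thesis by (simp add: cotruncated_iff)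
qed

text \<open>For k = l condition (ii) is vacuous and says nothing about m = k + 1. Condition (iii) is
  vacuous too, since the top of a (k + 1)-subcube would have more than l elements.\<close>

lemma subcubes_empty: "k = l \<Longrightarrow> subcubes D B n l (k + 1) X = {}"
proof -
  assume "k = l"
  have "\<not> interval_incl n l (k + 1) \<phi>" for \<phi>
  proof
    assume "interval_incl n l (k + 1) \<phi>"
    then obtain x y where y: "y \<in> cube_le n l" "card (y - x) = k + 1"
      unfolding interval_incl_def by blast
    have "finite y" using y(1) by (auto simp: cube_le_iff intro: finite_subset)
    then show False using card_mono[of y "y - x"] y \<open>k = l\<close> by (auto simp: cube_le_iff)
  qed
  then show ?thesis by (auto simp: subcubes_def)
qed

end

theorem theorem7p15:
  fixes D :: "('u::infinite, 'o, 'm) prederiv"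
    and B :: "'u scat"
    and X :: 'o
    and n k l :: nat
  assumes "derivator D"
    and "n \<ge> 2" and "1 \<le> k" and "k \<le> l" and "l \<le> n"
    and "small_cat B"
    and "X \<in> Obj (shift_ob D (poset_cat (cube_le n l)) B)"
  shows "(cotruncated D B n l k X \<longleftrightarrow>
            (\<forall>m. k < m \<and> m \<le> l \<longrightarrow> (\<forall>Y\<in>subcubes D B n l m X. cocartesian D B m Y))) \<and>
         (cotruncated D B n l k X \<longleftrightarrow>
            (\<forall>Y\<in>subcubes D B n l (k + 1) X. cocartesian D B (k + 1) Y))"
proof -
  interpret prederiv D
    using assms(1) by unfold_locales (simp add: derivator_def)
  interpret cube_setup D B n k l X
    using assms by unfold_locales (simp_all add: small_cat_iff shift_ob_def DC_def)
  have "cotruncated D B n l k X"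
    if "\<forall>m. k < m \<and> m \<le> l \<longrightarrow> (\<forall>Y\<in>subcubes D B n l m X. cocartesian D B m Y)"
  proof (rule cotruncated_if_cocartesian)
    fix Y assume "Y \<in> subcubes D B n l (k + 1) X"
    moreover then have "k \<noteq> l" using subcubes_empty by auto
    ultimately show "cocartesian D B (k + 1) Y" using that assms(4) by simp
  qed
  then show ?thesis
    using cocartesian_if_cotruncated cotruncated_if_cocartesian by (metis less_add_one)
qed

end
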